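(* Let $T_1>0$, $T_0\in[0,T_1)$, $\alpha\in(\tfrac12,1)$, $\beta\in(0,\alpha)$. Fix $B_w>0$ and an initial history $w\in\mathcal C^\alpha([0,T_0],\mathbb R^m)$ with $\|w\|_{\alpha;[0,T_0]}\le B_w$. Let $f:\Lambda^\alpha_\beta([0,T_1],\mathbb R^m)\to L(\mathbb R^d,\mathbb R^m)$ be a non-anticipative functional which is Lipschitz with respect to the metric $d^\Lambda_\beta$. Let $\sigma:\mathbb R\to\mathbb R$ be Lipschitz, strictly monotone, and such that $|\sigma(r)|\le C_\sigma(1+\ln(1+|r|))$ for all $r\in\mathbb R$ and some constant $C_\sigma$. For $x\in\mathcal C^1([0,T_1],\mathbb R^d)$ let $y(x)$ be the unique solution of $$y^i_t=w^i_{T_0}+\sum_{j=1}^d\int_{T_0}^tf^{ij}(y|_{[0,s]})\,\mathrm dx^j_s,\ t\in[T_0,T_1],\qquad y^i|_{[0,T_0]}=w^i,\quad i=1,\dots,m,$$ and, for $\boldsymbol\ell\in T(\mathbb R^{m+1})^{m\times d}$, $c_0\in\mathbb R$, $c_1>0$, let $y^{\mathrm{Sig}}(x)$ be the unique solution of $$y^{\mathrm{Sig},i}_t=w^i_{T_0}+\sum_{j=1}^d\int_{T_0}^t\Big(c_1\sigma\big(\langle\boldsymbol\ell^{ij},S(\hat y^{\mathrm{Sig}})_{0,s}\rangle\big)+c_0\Big)\mathrm dx^j_s,\ t\in[T_0,T_1],\qquad y^{\mathrm{Sig},i}|_{[0,T_0]}=w^i .$$ Then there exist $\eta\in(0,1)$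 and an admissible weight function $\psi_c$ on $\mathcal C^1_\eta([0,T_1],\mathbb R^d)$ such that for every $\delta>0$ there exist $\boldsymbol\ell\in T(\mathbb R^{m+1})^{m\times d}$ and constants $c_0\in\mathbb R$, $c_1>0$ for which $$\sup_{x\in\mathcal C^1_\eta([0,T_1],\mathbb R^d)}\psi_c(x)^{-1}\,\|y(x)-y^{\mathrm{Sig}}(x)\|_{\beta;[0,T_1]}<\delta .$$ In particular, if both $f$ and $\sigma$ are bounded, one may take $\psi_c(x)=\eta_c(|x_0|+\|x\|_{1;[0,T_1]})$ with $\eta_c:[0,\infty)\to(0,\infty)$ any continuous, increasing function of superlinear growth.
   Context: $\mathcal C^\gamma([0,T],\mathbb R^m)$, $\gamma\in(0,1]$, is the space of $\gamma$-H\"older paths with norm $|y_0|+\|y\|_{\gamma;[0,T]}$, $\|y\|_{\gamma;[0,T]}=\sup_{s<t}|y_t-y_s|/|t-s|^\gamma$ ($\gamma=1$: Lipschitz). For $\eta<1$, $\mathcal C^1_\eta$ is the set $\mathcal C^1$ of Lipschitz paths with the topology of the $\eta$-H\"older norm. A function $\psi:X\to(0,\infty)$ on a completely regular Hausdorff space $X$ is an admissible weight function if $\{x\in X:\psi(x)\le R\}$ is compact for every $R>0$; $(X,\psi)$ is then called a weighted space. Superlinear growth of $\eta_c$ means $\eta_c(t)/t\to\infty$ as $t\to\infty$. $y_{\cdot\wedge t}$ is the path stopped at $t$; $\Lambda^\alpha_\beta([0,T],\mathbb R^m)=\{(t,y_{\cdot\wedge t}):t\in[0,T],y\in\mathcal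 C^\alpha([0,T],\mathbb R^m)\}$ has metric $d^\Lambda_\beta((t,y_{\cdot\wedge t}),(s,z_{\cdot\wedge s}))=|t-s|+|y_0-z_0|+\|y_{\cdot\wedge t}-z_{\cdot\wedge s}\|_{\beta;[0,T]}$; $(t,y_{\cdot\wedge t})$ is also written $y|_{[0,t]}$. A non-anticipative functional is a map on $\Lambda^\alpha_\beta$; $f^{ij}$ are its matrix entries. $T(\mathbb R^{m+1})=\bigoplus_{n\ge0}(\mathbb R^{m+1})^{\otimes n}$, paired coordinatewise via $\langle\cdot,\cdot\rangle$ with $T((\mathbb R^{m+1}))=\prod_{n\ge0}(\mathbb R^{m+1})^{\otimes n}$. $\hat y_t=(t,y_t)\in\mathbb R^{m+1}$. The signature is $S(\hat y)_{0,t}=(1,S^{(1)},S^{(2)},\dots)$, $S^{(n)}=\int_{0<t_1<\dots<t_n<t}\mathrm d\hat y_{t_1}\otimes\cdots\otimes\mathrm d\hat y_{t_n}$ (iterated Young integrals). Integrals against $x$ are Riemann–Stieltjes. Solutions are paths in $\mathcal C^\alpha([0,T_1],\mathbb R^m)$. *)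

theory Defs
  imports "HOL-Analysis.Analysis" "HOL-Library.Poly_Mapping"
begin

text \<open>Paths on \<open>[0,T]\<close> are represented by functions that are \<open>extensional\<close> on \<open>{0..T}\<close>, so
  that equality of functions is equality of paths.

  The Hoelder seminorm takes values in \<open>ennreal\<close>: it is \<open>\<infinity>\<close> outside the Hoelder space, and it
  is \<open>0\<close> when the interval degenerates to a point.\<close>

definition holder_seminorm :: "real \<Rightarrow> real \<Rightarrow> (real \<Rightarrow> 'a::real_normed_vector) \<Rightarrow> ennreal"
  where "holder_seminorm \<gamma> T y =
    (SUP (s, t) \<in> {(s, t). 0 \<le> s \<and> s < t \<and> t \<le> T}. ennreal (norm (y t - y s) / (t - s) powr \<gamma>))"

definition holder_paths :: "real \<Rightarrow> real \<Rightarrow> (real \<Rightarrow> 'a::real_normed_vector) set"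
  where "holder_paths \<gamma> T = {y \<in> extensional {0..T}. holder_seminorm \<gamma> T y < \<infinity>}"

definition holder_norm :: "real \<Rightarrow> real \<Rightarrow> (real \<Rightarrow> 'a::real_normed_vector) \<Rightarrow> real"
  where "holder_norm \<gamma> T y = norm (y 0) + enn2real (holder_seminorm \<gamma> T y)"

definition holder_dist ::
    "real \<Rightarrow> real \<Rightarrow> (real \<Rightarrow> 'a::real_normed_vector) \<Rightarrow> (real \<Rightarrow> 'a) \<Rightarrow> real"
  where "holder_dist \<gamma> T x z = holder_norm \<gamma> T (\<lambda>t. x t - z t)"

definition lipschitz_path_topology ::
    "real \<Rightarrow> real \<Rightarrow> (real \<Rightarrow> 'a::real_normed_vector) topology"
  where "lipschitz_path_topology \<eta> T = Metric_space.mtopology (holder_paths 1 T) (holder_dist \<eta> T)"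

definition admissible_weight :: "'a topology \<Rightarrow> ('a \<Rightarrow> real) \<Rightarrow> bool"
  where "admissible_weight X \<psi> \<longleftrightarrow>
    completely_regular_space X \<and> Hausdorff_space X \<and>
    (\<forall>x \<in> topspace X. 0 < \<psi> x) \<and>
    (\<forall>R>0. compactin X {x \<in> topspace X. \<psi> x \<le> R})"

definition stopped_path :: "real \<Rightarrow> (real \<Rightarrow> 'a) \<Rightarrow> real \<Rightarrow> real \<Rightarrow> 'a"
  where "stopped_path T y t = restrict (\<lambda>s. y (min s t)) {0..T}"

definition stopped_paths :: "real \<Rightarrow> real \<Rightarrow> (real \<times> (real \<Rightarrow> 'a::real_normed_vector)) set"
  where "stopped_paths \<alpha> T = {(t, stopped_path T y t) | t y. t \<in> {0..T} \<and> y \<in> holder_paths \<alpha> T}"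

definition stopped_dist ::
    "real \<Rightarrow> real \<Rightarrow> real \<times> (real \<Rightarrow> 'a::real_normed_vector) \<Rightarrow> real \<times> (real \<Rightarrow> 'a) \<Rightarrow> real"
  where "stopped_dist \<beta> T = (\<lambda>(t, y) (s, z). \<bar>t - s\<bar> + holder_dist \<beta> T y z)"

definition lipschitz_functional ::
    "real \<Rightarrow> real \<Rightarrow> real \<Rightarrow> (real \<times> (real \<Rightarrow> 'a::real_normed_vector) \<Rightarrow> 'b::real_normed_vector) \<Rightarrow> bool"
  where "lipschitz_functional \<alpha> \<beta> T f \<longleftrightarrow>
    (\<exists>L. \<forall>p \<in> stopped_paths \<alpha> T. \<forall>q \<in> stopped_paths \<alpha> T. norm (f p - f q) \<le> L * stopped_dist \<beta> T p q)"

text \<open>Riemann--Stieltjes integral of \<open>g\<close> against \<open>h\<close> over \<open>[a,b]\<close>: the limit of the Riemann--Stieltjes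
  sums as the mesh tends to \<open>0\<close>. The Young integral of \<open>\<alpha>\<close>-Hoelder paths with \<open>\<alpha> > 1/2\<close>
  is this same limit.\<close>

definition has_rs_integral :: "(real \<Rightarrow> real) \<Rightarrow> (real \<Rightarrow> real) \<Rightarrow> real \<Rightarrow> real \<Rightarrow> real \<Rightarrow> bool"
  where "has_rs_integral g h a b I \<longleftrightarrow>
    (\<forall>\<epsilon>>0. \<exists>\<delta>>0. \<forall>p. p tagged_division_of {a..b} \<and> (\<forall>(u, K) \<in> p. Sup K - Inf K < \<delta>) \<longrightarrow>
      \<bar>(\<Sum>(u, K) \<in> p. g u * (h (Sup K) - h (Inf K))) - I\<bar> < \<epsilon>)"

definition rs_integrable :: "(real \<Rightarrow> real) \<Rightarrow> (real \<Rightarrow> real) \<Rightarrow> real \<Rightarrow> real \<Rightarrow> bool"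
  where "rs_integrable g h a b \<longleftrightarrow> (\<exists>I. has_rs_integral g h a b I)"

definition rs_integral :: "(real \<Rightarrow> real) \<Rightarrow> (real \<Rightarrow> real) \<Rightarrow> real \<Rightarrow> real \<Rightarrow> real"
  where "rs_integral g h a b = (THE I. has_rs_integral g h a b I)"

text \<open>The coordinates of \<open>\<real>\<^sup>m\<^sup>+\<^sup>1\<close> are indexed by \<open>'m option\<close>, with \<open>None\<close> for time.\<close>

definition time_augmented :: "(real \<Rightarrow> real ^ 'm) \<Rightarrow> real \<Rightarrow> real ^ ('m option)"
  where "time_augmented y t = (\<chi> k. case k of None \<Rightarrow> t | Some i \<Rightarrow> y t $ i)"

text \<open>Elements of \<open>T(\<real>\<^sup>n)\<close> and \<open>T((\<real>\<^sup>n))\<close> are given by their coordinates in the basis of words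
  over the index set of \<open>\<real>\<^sup>n\<close>: finitely supported functions on words, respectively all functions.\<close>

type_synonym 'k tensor_poly = "'k list \<Rightarrow>\<^sub>0 real"
type_synonym 'k tensor_series = "'k list \<Rightarrow> real"

definition tensor_pairing :: "'k tensor_poly \<Rightarrow> 'k tensor_series \<Rightarrow> real"
  where "tensor_pairing l S = (\<Sum>v \<in> Poly_Mapping.keys l. Poly_Mapping.lookup l v * S v)"

text \<open>The outermost integration variable belongs to the last letter, hence the recursion
  over reversed words.\<close>

fun iterated_integral_rev :: "(real \<Rightarrow> real ^ 'k) \<Rightarrow> 'k list \<Rightarrow> real \<Rightarrow> real"
  where
    "iterated_integral_rev z [] t = 1"
  | "iterated_integral_rev z (k # v) t =
      rs_integral (\<lambda>s. iterated_integral_rev z v s) (\<lambda>s. z s $ k) 0 t"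

definition signature :: "(real \<Rightarrow> real ^ 'k) \<Rightarrow> real \<Rightarrow> 'k tensor_series"
  where "signature z t = (\<lambda>v. iterated_integral_rev z (rev v) t)"

text \<open>\<open>G y s\<close> is the coefficient matrix at time \<open>s\<close> along the path \<open>y\<close>.\<close>

definition is_solution ::
    "real \<Rightarrow> real \<Rightarrow> real \<Rightarrow> (real \<Rightarrow> real ^ 'm) \<Rightarrow> ((real \<Rightarrow> real ^ 'm) \<Rightarrow> real \<Rightarrow> real ^ 'd ^ 'm) \<Rightarrow>
      (real \<Rightarrow> real ^ 'd) \<Rightarrow> (real \<Rightarrow> real ^ 'm) \<Rightarrow> bool"
  where "is_solution T0 T1 \<alpha> w G x y \<longleftrightarrow>
    y \<in> holder_paths \<alpha> T1 \<and>
    (\<forall>t \<in> {0..T0}. y t = w t) \<and>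
    (\<forall>t \<in> {T0..T1}. \<forall>i.
      (\<forall>j. rs_integrable (\<lambda>s. G y s $ i $ j) (\<lambda>s. x s $ j) T0 t) \<and>
      y t $ i = w T0 $ i + (\<Sum>j\<in>UNIV. rs_integral (\<lambda>s. G y s $ i $ j) (\<lambda>s. x s $ j) T0 t))"

definition solution ::
    "real \<Rightarrow> real \<Rightarrow> real \<Rightarrow> (real \<Rightarrow> real ^ 'm) \<Rightarrow> ((real \<Rightarrow> real ^ 'm) \<Rightarrow> real \<Rightarrow> real ^ 'd ^ 'm) \<Rightarrow>
      (real \<Rightarrow> real ^ 'd) \<Rightarrow> real \<Rightarrow> real ^ 'm"
  where "solution T0 T1 \<alpha> w G x = (THE y. is_solution T0 T1 \<alpha> w G x y)"

definition functional_coeff ::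
    "real \<Rightarrow> (real \<times> (real \<Rightarrow> real ^ 'm) \<Rightarrow> (real ^ 'd) \<Rightarrow>\<^sub>L (real ^ 'm)) \<Rightarrow>
      (real \<Rightarrow> real ^ 'm) \<Rightarrow> real \<Rightarrow> real ^ 'd ^ 'm"
  where "functional_coeff T f y s = matrix (blinfun_apply (f (s, stopped_path T y s)))"

definition signature_coeff ::
    "(real \<Rightarrow> real) \<Rightarrow> 'm option tensor_poly ^ 'd ^ 'm \<Rightarrow> real \<Rightarrow> real \<Rightarrow>
      (real \<Rightarrow> real ^ 'm) \<Rightarrow> real \<Rightarrow> real ^ 'd ^ 'm"
  where "signature_coeff \<sigma> l c0 c1 y s =
    (\<chi> i j. c1 * \<sigma> (tensor_pairing (l $ i $ j) (signature (time_augmented y) s)) + c0)"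

text \<open>\<open>Metric_space.mtopology\<close> is the expected topology only for an actual metric, which
  \<open>Metric_space_lipschitz_paths\<close> establishes for \<open>holder_dist \<eta> T\<close> on the Lipschitz paths.\<close>

lemma holder_seminorm_le_iff:
  assumes "0 \<le> C"
  shows "holder_seminorm \<gamma> T y \<le> ennreal C \<longleftrightarrow>
    (\<forall>s t. 0 \<le> s \<longrightarrow> s < t \<longrightarrow> t \<le> T \<longrightarrow> norm (y t - y s) \<le> C * (t - s) powr \<gamma>)"
  unfolding holder_seminorm_def SUP_le_iff using assms
  by (auto simp: divide_le_eq)

lemma holder_finite_iff:
  "holder_seminorm \<gamma> T y < \<infinity> \<longleftrightarrow>
    (\<exists>C\<ge>0. \<forall>s t. 0 \<le> s \<longrightarrow> s < t \<longrightarrow> t \<le> T \<longrightarrow> norm (y t - y s) \<le> C * (t - s) powr \<gamma>)"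
  (is "?L \<longleftrightarrow> ?R")
proof
  assume ?L
  then have "holder_seminorm \<gamma> T y \<le> ennreal (enn2real (holder_seminorm \<gamma> T y))"
    by simp
  then show ?R
    using holder_seminorm_le_iff[OF enn2real_nonneg] enn2real_nonneg by blast
next
  assume ?R
  then obtain C where "C \<ge> 0" "holder_seminorm \<gamma> T y \<le> ennreal C"
    using holder_seminorm_le_iff by blast
  then show ?L
    by (simp add: order_le_less_trans)
qed

lemma holder_norm_increment_le:
  assumes "holder_seminorm \<gamma> T y < \<infinity>" "0 \<le> s" "s < t" "t \<le> T"
  shows "norm (y t - y s) \<le> enn2real (holder_seminorm \<gamma> T y) * (t - s) powr \<gamma>"
proof -
  have "holder_seminorm \<gamma> T y \<le> ennreal (enn2real (holder_seminorm \<gamma> T y))"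
    using assms(1) by simp
  then show ?thesis
    using holder_seminorm_le_iff[OF enn2real_nonneg] assms by blast
qed

lemma holder_finite_diff:
  assumes x: "x \<in> holder_paths 1 T" and z: "z \<in> holder_paths 1 T" and "0 < \<eta>" "\<eta> \<le> 1"
  shows "holder_seminorm \<eta> T (\<lambda>t. x t - z t) < \<infinity>"
proof -
  obtain C where C: "C \<ge> 0" "\<And>s t. 0 \<le> s \<Longrightarrow> s < t \<Longrightarrow> t \<le> T \<Longrightarrow> norm (x t - x s) \<le> C * (t - s) powr 1"
    using x unfolding holder_paths_def holder_finite_iff by blast
  obtain D where D: "D \<ge> 0" "\<And>s t. 0 \<le> s \<Longrightarrow> s < t \<Longrightarrow> t \<le> T \<Longrightarrow> norm (z t - z s) \<le> D * (t - s) powr 1"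
    using z unfolding holder_paths_def holder_finite_iff by blast
  have "norm ((x t - z t) - (x s - z s)) \<le> ((C + D) * \<bar>T\<bar> powr (1 - \<eta>)) * (t - s) powr \<eta>"
    if "0 \<le> s" "s < t" "t \<le> T" for s t
  proof -
    have "norm ((x t - z t) - (x s - z s)) \<le> norm (x t - x s) + norm (z t - z s)"
      using norm_triangle_ineq4[of "x t - x s" "z t - z s"] by (simp add: algebra_simps)
    also have "\<dots> \<le> (C + D) * (t - s) powr 1"
      using C(2)[OF that] D(2)[OF that] by (simp add: algebra_simps)
    also have "(t - s) powr 1 = (t - s) powr (1 - \<eta>) * (t - s) powr \<eta>"
      using that by (simp add: powr_add [symmetric])
    also have "(t - s) powr (1 - \<eta>) \<le> \<bar>T\<bar> powr (1 - \<eta>)"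
      using that assms by (intro powr_mono2) auto
    finally show ?thesis
      using C(1) D(1) by (simp add: mult_left_mono mult_right_mono mult.assoc)
  qed
  then show ?thesis
    unfolding holder_finite_iff using C(1) D(1) by (metis add_nonneg_nonneg mult_nonneg_nonneg powr_ge_zero)
qed

lemma Metric_space_lipschitz_paths:
  assumes "0 < \<eta>" "\<eta> \<le> 1"
  shows "Metric_space (holder_paths 1 T) (holder_dist \<eta> T)"
proof
  fix x y z :: "real \<Rightarrow> 'a"
  show "0 \<le> holder_dist \<eta> T x y"
    by (simp add: holder_dist_def holder_norm_def)
  have "norm ((x t - y t) - (x s - y s)) = norm ((y t - x t) - (y s - x s))" for s t
    using norm_minus_commute[of "x t - y t" "x s - y s"] by (simp add: algebra_simps)
  then show "holder_dist \<eta> T x y = holder_dist \<eta> T y x"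
    by (simp add: holder_dist_def holder_norm_def holder_seminorm_def norm_minus_commute)
  assume x: "x \<in> holder_paths 1 T" and y: "y \<in> holder_paths 1 T"
  have fxy: "holder_seminorm \<eta> T (\<lambda>t. x t - y t) < \<infinity>"
    using holder_finite_diff[OF x y assms] .
  show "holder_dist \<eta> T x y = 0 \<longleftrightarrow> x = y"
  proof
    assume "holder_dist \<eta> T x y = 0"
    then have "enn2real (holder_seminorm \<eta> T (\<lambda>t. x t - y t)) = 0 \<and> norm (x 0 - y 0) = 0"
      unfolding holder_dist_def holder_norm_def
      using enn2real_nonneg[of "holder_seminorm \<eta> T (\<lambda>t. x t - y t)"] norm_ge_zero[of "x 0 - y 0"]
      by linarith
    then have z: "enn2real (holder_seminorm \<eta> T (\<lambda>t. x t - y t)) = 0" "x 0 = y 0"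
      by auto
    have "x t = y t" if "t \<in> {0..T}" for t
    proof (cases "t = 0")
      case False
      then show ?thesis
        using holder_norm_increment_le[OF fxy, of 0 t] that z by simp
    qed (use z in simp)
    then show "x = y"
      using x y by (auto simp: holder_paths_def intro: extensionalityI)
  next
    assume "x = y"
    then have "holder_seminorm \<eta> T (\<lambda>t. x t - y t) \<le> ennreal 0"
      by (subst holder_seminorm_le_iff) auto
    with \<open>x = y\<close> show "holder_dist \<eta> T x y = 0"
      by (simp add: holder_dist_def holder_norm_def)
  qed
  assume z: "z \<in> holder_paths 1 T"
  let ?A = "enn2real (holder_seminorm \<eta> T (\<lambda>t. x t - y t))"
  let ?B = "enn2real (holder_seminorm \<eta> T (\<lambda>t. y t - z t))"
  have "norm ((x t - z t) - (x s - z s)) \<le> (?A + ?B) * (t - s) powr \<eta>"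
    if "0 \<le> s" "s < t" "t \<le> T" for s t
  proof -
    have "norm ((x t - z t) - (x s - z s))
        \<le> norm ((x t - y t) - (x s - y s)) + norm ((y t - z t) - (y s - z s))"
      using norm_triangle_ineq[of "(x t - y t) - (x s - y s)" "(y t - z t) - (y s - z s)"]
      by (simp add: algebra_simps)
    also have "\<dots> \<le> (?A + ?B) * (t - s) powr \<eta>"
      using holder_norm_increment_le[OF fxy that]
        holder_norm_increment_le[OF holder_finite_diff[OF y z assms] that]
      by (simp add: algebra_simps)
    finally show ?thesis .
  qed
  then have "holder_seminorm \<eta> T (\<lambda>t. x t - z t) \<le> ennreal (?A + ?B)"
    by (subst holder_seminorm_le_iff) auto
  then have "enn2real (holder_seminorm \<eta> T (\<lambda>t. x t - z t)) \<le> ?A + ?B"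
    by (simp add: enn2real_leI)
  moreover have "norm (x 0 - z 0) \<le> norm (x 0 - y 0) + norm (y 0 - z 0)"
    using norm_triangle_ineq[of "x 0 - y 0" "y 0 - z 0"] by simp
  ultimately show "holder_dist \<eta> T x z \<le> holder_dist \<eta> T x y + holder_dist \<eta> T y z"
    by (simp add: holder_dist_def holder_norm_def)
qed

end

theory Submission
  imports Defs
begin

text \<open>Both equations are of the form \<open>dy = G(y) dx\<close> with a coefficient \<open>G\<close> that is locally Lipschitz in the
  \<open>\<alpha>\<close>-Hoelder norm of the past and of linear growth; for the signature coefficient this follows from the Young
  estimate for iterated integrals and from the logarithmic growth of \<open>\<sigma>\<close>. Since the solutions are Lipschitz
  after \<open>T0\<close> and \<open>\<alpha> < 1\<close>, Picard iteration contracts in a Hoelder norm weighted by \<open>exp (\<mu> * t)\<close>.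

  Solutions driven by \<open>\<parallel>x\<parallel> \<le> K\<close> stay in a Hoelder ball, on which stopped paths form a compact set in the product
  topology. There the linear functionals of the signature are an algebra (integration by parts) and separate points
  (integrate polynomials in time against the path), so by Stone--Weierstrass \<open>\<langle>l, S\<rangle>\<close> approximates
  \<open>\<sigma>\<^sup>-\<^sup>1 ((f - c0) / c1)\<close> uniformly.

  For the weight, pick for every \<open>n\<close> a signature equation with error at most \<open>1 / (n + 1)\<close> on
  \<open>\<parallel>x\<parallel> \<le> n\<close>. Each of these countably many equations has a finite error bound on every ball, and a function
  of \<open>\<parallel>x\<parallel>\<close> growing faster than all of them is an admissible weight. If \<open>f\<close> and \<open>\<sigma>\<close> are bounded, then
  \<open>c0\<close> and \<open>c1\<close> do not depend on \<open>n\<close> and the error is at most linear in \<open>\<parallel>x\<parallel>\<close>.\<close>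

section \<open>Riemann--Stieltjes and Young integrals\<close>

text \<open>Two dependencies run in the wrong direction and shape the proof. The degree of l enters
  every direct a priori bound for the signature equation, although l can only be chosen once the
  ball on which it must approximate is known; the cure is a truncated coefficient
  (\<open>corrected\<close>) whose growth constant is known in advance. Likewise the weight must be
  fixed before \<delta>, while the error outside a given ball depends on l, c0, c1 and so on
  \<delta>; this forces the countable family of equations. As for exponents, \<gamma> will be
  \<alpha> - \<beta>, the regularity in time of f along an \<alpha>-Hoelder path, and any positive
  value is enough against a Lipschitz driver. The history before T0 is merely \<alpha>-Hoelder, so
  the signature needs genuine Young integrals, whence 2 * \<alpha> > 1. In the product topology,
  convergence inside an \<alpha>-Hoelder ball only upgrades to exponents strictly below \<alpha>:
  this is where \<beta> < \<alpha> enters, and why continuity of the signature goes through an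
  exponent between 1 / 2 and \<alpha>.\<close>

definition holder_on :: "real \<Rightarrow> real \<Rightarrow> real \<Rightarrow> real \<Rightarrow> (real \<Rightarrow> 'a::real_normed_vector) \<Rightarrow> bool"
  where "holder_on a b \<gamma> C g \<longleftrightarrow>
    (\<forall>s t. a \<le> s \<longrightarrow> s < t \<longrightarrow> t \<le> b \<longrightarrow> norm (g t - g s) \<le> C * (t - s) powr \<gamma>)"

lemma holder_onD:
  assumes "holder_on a b \<gamma> C g" "a \<le> s" "s \<le> t" "t \<le> b"
  shows "norm (g t - g s) \<le> C * (t - s) powr \<gamma>"
  using assms unfolding holder_on_def by (cases "s = t") auto

lemma holder_on_subinterval:
  assumes "holder_on a b \<gamma> C g" "a \<le> a'" "b' \<le> b"
  shows "holder_on a' b' \<gamma> C g"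
  using assms unfolding holder_on_def by (meson order_trans)

lemma holder_on_mono:
  assumes "holder_on a b \<gamma> C g" "C \<le> C'"
  shows "holder_on a b \<gamma> C' g"
  using assms unfolding holder_on_def
  by (meson mult_right_mono order_trans powr_ge_zero)

lemma powr_le_powr_interval:
  fixes x T :: real
  assumes "0 \<le> x" "x \<le> T" "\<gamma>' \<le> \<gamma>"
  shows "x powr \<gamma> \<le> T powr (\<gamma> - \<gamma>') * x powr \<gamma>'"
proof (cases "x = 0")
  case False
  have "x powr \<gamma> = x powr (\<gamma> - \<gamma>') * x powr \<gamma>'"
    using False by (simp flip: powr_add)
  also have "\<dots> \<le> T powr (\<gamma> - \<gamma>') * x powr \<gamma>'"
    using assms by (intro mult_right_mono powr_mono2) auto
  finally show ?thesis .
qed auto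

lemma holder_on_exponent_le:
  assumes "holder_on a b \<gamma> C g" "\<gamma>' \<le> \<gamma>" "b - a \<le> T" "0 \<le> C"
  shows "holder_on a b \<gamma>' (C * T powr (\<gamma> - \<gamma>')) g"
  unfolding holder_on_def
proof (intro allI impI)
  fix s t assume st: "a \<le> s" "s < t" "t \<le> b"
  have "norm (g t - g s) \<le> C * (t - s) powr \<gamma>"
    using assms(1) st unfolding holder_on_def by auto
  also have "\<dots> \<le> C * (T powr (\<gamma> - \<gamma>') * (t - s) powr \<gamma>')"
    using st assms by (intro mult_left_mono powr_le_powr_interval) auto
  finally show "norm (g t - g s) \<le> C * T powr (\<gamma> - \<gamma>') * (t - s) powr \<gamma>'"
    by (simp add: mult.assoc)
qed

lemma holder_on_diff:
  assumes "holder_on a b \<gamma> C g" "holder_on a b \<gamma> D h"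
  shows "holder_on a b \<gamma> (C + D) (\<lambda>t. g t - h t)"
  unfolding holder_on_def
proof (intro allI impI)
  fix s t assume st: "a \<le> s" "s < t" "t \<le> b"
  have "norm ((g t - h t) - (g s - h s)) \<le> norm (g t - g s) + norm (h t - h s)"
    using norm_triangle_ineq4[of "g t - g s" "h t - h s"] by (simp add: algebra_simps)
  also have "\<dots> \<le> C * (t - s) powr \<gamma> + D * (t - s) powr \<gamma>"
    using assms st unfolding holder_on_def by (intro add_mono) auto
  finally show "norm ((g t - h t) - (g s - h s)) \<le> (C + D) * (t - s) powr \<gamma>"
    by (simp add: algebra_simps)
qed

lemma holder_on_add:
  assumes "holder_on a b \<gamma> C g" "holder_on a b \<gamma> D h"
  shows "holder_on a b \<gamma> (C + D) (\<lambda>t. g t + h t)"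
  unfolding holder_on_def
proof (intro allI impI)
  fix s t assume st: "a \<le> s" "s < t" "t \<le> b"
  have "norm ((g t + h t) - (g s + h s)) \<le> norm (g t - g s) + norm (h t - h s)"
    using norm_triangle_ineq[of "g t - g s" "h t - h s"] by (simp add: algebra_simps)
  also have "\<dots> \<le> C * (t - s) powr \<gamma> + D * (t - s) powr \<gamma>"
    using assms st unfolding holder_on_def by (intro add_mono) auto
  finally show "norm ((g t + h t) - (g s + h s)) \<le> (C + D) * (t - s) powr \<gamma>"
    by (simp add: algebra_simps)
qed

lemma holder_on_const: "0 \<le> C \<Longrightarrow> holder_on a b \<gamma> C (\<lambda>_. c)"
  by (simp add: holder_on_def)

lemma holder_on_cmult:
  fixes g :: "real \<Rightarrow> real"
  assumes "holder_on a b \<gamma> C g"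
  shows "holder_on a b \<gamma> (\<bar>c\<bar> * C) (\<lambda>t. c * g t)"
  unfolding holder_on_def
proof (intro allI impI)
  fix s t assume st: "a \<le> s" "s < t" "t \<le> b"
  have "norm (c * g t - c * g s) = \<bar>c\<bar> * norm (g t - g s)"
    by (simp add: abs_mult flip: right_diff_distrib)
  also have "\<dots> \<le> \<bar>c\<bar> * (C * (t - s) powr \<gamma>)"
    using assms st unfolding holder_on_def by (intro mult_left_mono) auto
  finally show "norm (c * g t - c * g s) \<le> \<bar>c\<bar> * C * (t - s) powr \<gamma>"
    by (simp add: mult.assoc)
qed

lemma holder_on_continuous:
  assumes "holder_on a b \<gamma> C g" "0 < \<gamma>"
  shows "continuous_on {a..b} g"
proof (rule continuous_on_iff[THEN iffD2], intro ballI allI impI)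
  fix x e :: real assume x: "x \<in> {a..b}" and e: "0 < e"
  \<comment> \<open>The exponent 1 / \<gamma> makes \<open>d powr \<gamma>\<close> equal to e / (|C|
    + 1); the added 1 covers C = 0 and leaves the final inequality strict.\<close>
  define d where "d = (e / (\<bar>C\<bar> + 1)) powr (1 / \<gamma>)"
  have d: "d > 0" using e by (simp add: d_def)
  have "dist (g y) (g x) < e" if y: "y \<in> {a..b}" "dist y x < d" for y
  proof -
    have "norm (g y - g x) \<le> \<bar>C\<bar> * \<bar>y - x\<bar> powr \<gamma>"
    proof -
      have m: "norm (g (max x y) - g (min x y)) \<le> C * (max x y - min x y) powr \<gamma>"
        using x y by (intro holder_onD[OF assms(1)]) auto
      have "norm (g y - g x) \<le> C * \<bar>y - x\<bar> powr \<gamma>"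
        using m by (cases "x \<le> y") (auto simp: norm_minus_commute max_def min_def)
      also have "\<dots> \<le> \<bar>C\<bar> * \<bar>y - x\<bar> powr \<gamma>" by (intro mult_right_mono) auto
      finally show ?thesis .
    qed
    also have "\<dots> \<le> \<bar>C\<bar> * (e / (\<bar>C\<bar> + 1))"
    proof (intro mult_left_mono)
      have "\<bar>y - x\<bar> powr \<gamma> \<le> d powr \<gamma>"
        using y(2) assms(2) by (intro powr_mono2) (auto simp: dist_real_def)
      also have "d powr \<gamma> = e / (\<bar>C\<bar> + 1)"
        unfolding d_def using e assms(2) by (simp add: powr_powr)
      finally show "\<bar>y - x\<bar> powr \<gamma> \<le> e / (\<bar>C\<bar> + 1)" .
    qed auto
    also have "\<dots> < e" using e by (simp add: field_simps)
    finally show ?thesis by (simp add: dist_norm)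
  qed
  then show "\<exists>d>0. \<forall>x'\<in>{a..b}. dist x' x < d \<longrightarrow> dist (g x') (g x) < e"
    using d by blast
qed

section \<open>Riemann--Stieltjes sums and their limits\<close>

lemma tagged_interval:
  fixes a b :: real
  assumes "p tagged_division_of {a..b}" "(u, K) \<in> p"
  shows "a \<le> Inf K" "Inf K \<le> u" "u \<le> Sup K" "Sup K \<le> b"
proof -
  obtain c d where K: "K = {c..d}"
    using tagged_division_ofD(4)[OF assms] by auto
  have "u \<in> K" "K \<subseteq> {a..b}"
    using assms by (auto dest: tagged_division_ofD)
  with K show "a \<le> Inf K" "Inf K \<le> u" "u \<le> Sup K" "Sup K \<le> b"
    by auto
qed

text \<open>Without divisions of arbitrarily small mesh the condition in
  \<open>has_rs_integral\<close> would be vacuous; this is what makes the limit unique. A gauge of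
  constant radius \<delta> / 3 suffices, since an interval inside such a ball is shorter than
  \<delta>.\<close>

lemma fine_tagged_division_exists:
  fixes a b \<delta> :: real
  assumes "0 < \<delta>"
  obtains p where "p tagged_division_of {a..b}" "\<forall>(u, K) \<in> p. Sup K - Inf K < \<delta>"
proof -
  have "gauge (\<lambda>u::real. ball u (\<delta> / 3))"
    using assms by (auto simp: gauge_def)
  then obtain p where p: "p tagged_division_of {a..b}" "(\<lambda>u. ball u (\<delta> / 3)) fine p"
    using fine_division_exists_real by blast
  have "Sup K - Inf K < \<delta>" if uK: "(u, K) \<in> p" for u K
  proof -
    obtain c d where K: "K = {c..d}"
      using tagged_division_ofD(4)[OF p(1) uK] by auto
    have "u \<in> K" using p uK by (auto dest: tagged_division_ofD)
    then have "c \<in> K" "d \<in> K" "c \<le> d" using K by auto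
    moreover have "K \<subseteq> ball u (\<delta> / 3)" using p(2) uK by (auto simp: fine_def)
    ultimately have "\<bar>u - c\<bar> < \<delta> / 3" "\<bar>u - d\<bar> < \<delta> / 3"
      by (auto simp: dist_real_def)
    then have "d - c < \<delta>" using assms by linarith
    then show ?thesis using K \<open>c \<le> d\<close> by simp
  qed
  then show ?thesis using that[OF p(1)] by blast
qed

abbreviation rs_sum :: "(real \<Rightarrow> real) \<Rightarrow> (real \<Rightarrow> real) \<Rightarrow> (real \<times> real set) set \<Rightarrow> real"
  where "rs_sum g h p \<equiv> (\<Sum>(u, K) \<in> p. g u * (h (Sup K) - h (Inf K)))"

lemma has_rs_integralD:
  assumes "has_rs_integral g h a b I" "0 < \<epsilon>"
  obtains \<delta> where "0 < \<delta>" "\<And>p. p tagged_division_of {a..b} \<Longrightarrow>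
      (\<forall>(u, K) \<in> p. Sup K - Inf K < \<delta>) \<Longrightarrow> \<bar>rs_sum g h p - I\<bar> < \<epsilon>"
proof -
  have "\<exists>\<delta>>0. \<forall>p. p tagged_division_of {a..b} \<and> (\<forall>(u, K) \<in> p. Sup K - Inf K < \<delta>) \<longrightarrow>
      \<bar>rs_sum g h p - I\<bar> < \<epsilon>"
    using assms unfolding has_rs_integral_def by simp
  then obtain \<delta> where \<delta>: "0 < \<delta>" "\<forall>p. p tagged_division_of {a..b} \<and> (\<forall>(u, K) \<in> p. Sup K - Inf K < \<delta>) \<longrightarrow>
      \<bar>rs_sum g h p - I\<bar> < \<epsilon>"
    by (elim exE conjE)
  show ?thesis
    by (rule that[OF \<delta>(1)]) (rule \<delta>(2)[rule_format, OF conjI])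
qed

lemma mesh_less_mono:
  fixes \<delta> \<delta>' :: real
  assumes "\<forall>(u, K) \<in> p. Sup K - Inf K < \<delta>" "\<delta> \<le> \<delta>'"
  shows "\<forall>(u, K) \<in> p. Sup K - Inf K < \<delta>'"
  using assms by fastforce

lemma has_rs_integral_approx2:
  assumes "has_rs_integral g h a b I" "has_rs_integral g' h' a b I'" "0 < \<epsilon>"
  obtains p where "p tagged_division_of {a..b}" "\<bar>rs_sum g h p - I\<bar> < \<epsilon>" "\<bar>rs_sum g' h' p - I'\<bar> < \<epsilon>"
proof -
  obtain \<delta> where \<delta>: "\<delta> > 0" "\<And>p. p tagged_division_of {a..b} \<Longrightarrow>
      (\<forall>(u, K) \<in> p. Sup K - Inf K < \<delta>) \<Longrightarrow> \<bar>rs_sum g h p - I\<bar> < \<epsilon>"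
    by (rule has_rs_integralD[OF assms(1) assms(3)]) (rule that)
  obtain \<delta>' where \<delta>': "\<delta>' > 0" "\<And>p. p tagged_division_of {a..b} \<Longrightarrow>
      (\<forall>(u, K) \<in> p. Sup K - Inf K < \<delta>') \<Longrightarrow> \<bar>rs_sum g' h' p - I'\<bar> < \<epsilon>"
    by (rule has_rs_integralD[OF assms(2) assms(3)]) (rule that)
  obtain p where p: "p tagged_division_of {a..b}" "\<forall>(u, K) \<in> p. Sup K - Inf K < min \<delta> \<delta>'"
    using fine_tagged_division_exists[of "min \<delta> \<delta>'" a b] \<delta> \<delta>' by auto
  show ?thesis
    by (intro that[OF p(1)] \<delta>(2)[OF p(1) mesh_less_mono[OF p(2)]] \<delta>'(2)[OF p(1) mesh_less_mono[OF p(2)]]) simp_all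
qed

lemma has_rs_integral_unique:
  assumes "has_rs_integral g h a b I" "has_rs_integral g h a b I'"
  shows "I = I'"
proof (rule ccontr)
  assume "I \<noteq> I'"
  then have "0 < \<bar>I - I'\<bar> / 2" by simp
  then obtain p where "p tagged_division_of {a..b}"
    "\<bar>rs_sum g h p - I\<bar> < \<bar>I - I'\<bar> / 2" "\<bar>rs_sum g h p - I'\<bar> < \<bar>I - I'\<bar> / 2"
    using has_rs_integral_approx2[OF assms] by blast
  then show False by (simp add: abs_if split: if_splits)
qed

lemma rs_integral_eqI:
  assumes "has_rs_integral g h a b I"
  shows "rs_integral g h a b = I"
  unfolding rs_integral_def using assms has_rs_integral_unique by blast

text \<open>The relation is asked only of the sums over a common tagged division. This covers
  linearity in the integrand, linearity in the integrator and congruence at once.\<close>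

lemma has_rs_integral_combine:
  assumes "has_rs_integral g h a b I" "has_rs_integral g' h' a b I'"
    and sum: "\<And>p. p tagged_division_of {a..b} \<Longrightarrow> rs_sum k l p = c * rs_sum g h p + d * rs_sum g' h' p"
  shows "has_rs_integral k l a b (c * I + d * I')"
  unfolding has_rs_integral_def
proof (intro allI impI)
  fix \<epsilon> :: real assume \<epsilon>: "\<epsilon> > 0"
  define e where "e = \<epsilon> / (\<bar>c\<bar> + \<bar>d\<bar> + 1)"
  have e: "e > 0" using \<epsilon> by (simp add: e_def add_nonneg_pos)
  obtain \<delta> where \<delta>: "\<delta> > 0" "\<And>p. p tagged_division_of {a..b} \<Longrightarrow>
      (\<forall>(u, K) \<in> p. Sup K - Inf K < \<delta>) \<Longrightarrow> \<bar>rs_sum g h p - I\<bar> < e"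
    by (rule has_rs_integralD[OF assms(1) e]) (rule that)
  obtain \<delta>' where \<delta>': "\<delta>' > 0" "\<And>p. p tagged_division_of {a..b} \<Longrightarrow>
      (\<forall>(u, K) \<in> p. Sup K - Inf K < \<delta>') \<Longrightarrow> \<bar>rs_sum g' h' p - I'\<bar> < e"
    by (rule has_rs_integralD[OF assms(2) e]) (rule that)
  have "\<bar>rs_sum k l p - (c * I + d * I')\<bar> < \<epsilon>"
    if p: "p tagged_division_of {a..b}" and m: "\<forall>(u, K) \<in> p. Sup K - Inf K < min \<delta> \<delta>'" for p
  proof -
    have 1: "\<bar>rs_sum g h p - I\<bar> < e" by (rule \<delta>(2)[OF p mesh_less_mono[OF m]]) simp
    have 2: "\<bar>rs_sum g' h' p - I'\<bar> < e" by (rule \<delta>'(2)[OF p mesh_less_mono[OF m]]) simp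
    have "\<bar>rs_sum k l p - (c * I + d * I')\<bar> = \<bar>c * (rs_sum g h p - I) + d * (rs_sum g' h' p - I')\<bar>"
      unfolding sum[OF p] by (simp only: algebra_simps)
    also have "\<dots> \<le> \<bar>c\<bar> * \<bar>rs_sum g h p - I\<bar> + \<bar>d\<bar> * \<bar>rs_sum g' h' p - I'\<bar>"
      unfolding abs_mult[symmetric] by (rule abs_triangle_ineq)
    also have "\<dots> \<le> \<bar>c\<bar> * e + \<bar>d\<bar> * e"
      using 1 2 by (intro add_mono mult_left_mono) auto
    also have "\<dots> < (\<bar>c\<bar> + \<bar>d\<bar> + 1) * e" using e by (simp add: algebra_simps)
    also have "\<dots> = \<epsilon>"
    proof -
      have "\<bar>c\<bar> + \<bar>d\<bar> + 1 \<noteq> 0" by linarith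
      then show ?thesis unfolding e_def by simp
    qed
    finally show ?thesis .
  qed
  then show "\<exists>\<delta>>0. \<forall>p. p tagged_division_of {a..b} \<and> (\<forall>(u, K) \<in> p. Sup K - Inf K < \<delta>) \<longrightarrow>
      \<bar>rs_sum k l p - (c * I + d * I')\<bar> < \<epsilon>"
    using \<delta>(1) \<delta>'(1) by (intro exI[of _ "min \<delta> \<delta>'"]) auto
qed

lemma has_rs_integral_congI:
  assumes "has_rs_integral g h a b I"
    and g: "\<And>u. u \<in> {a..b} \<Longrightarrow> g u = g' u" and h: "\<And>u. u \<in> {a..b} \<Longrightarrow> h u = h' u"
  shows "has_rs_integral g' h' a b I"
proof -
  \<comment> \<open>The coefficients 1 and 0 make congruence a degenerate case of
    \<open>has_rs_integral_combine\<close>.\<close>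
  have "rs_sum g' h' p = 1 * rs_sum g h p + 0 * rs_sum g h p" if "p tagged_division_of {a..b}" for p
  proof -
    have "rs_sum g' h' p = rs_sum g h p"
    proof (intro sum.cong refl, clarify)
      fix u K assume "(u, K) \<in> p"
      from tagged_interval[OF that this]
      show "g' u * (h' (Sup K) - h' (Inf K)) = g u * (h (Sup K) - h (Inf K))"
        using g h by auto
    qed
    then show ?thesis by simp
  qed
  from has_rs_integral_combine[OF assms(1,1) this] show ?thesis by simp
qed

lemma has_rs_integral_cong:
  assumes "\<And>u. u \<in> {a..b} \<Longrightarrow> g u = g' u" "\<And>u. u \<in> {a..b} \<Longrightarrow> h u = h' u"
  shows "has_rs_integral g h a b I \<longleftrightarrow> has_rs_integral g' h' a b I"
proof
  assume "has_rs_integral g h a b I"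
  then show "has_rs_integral g' h' a b I" by (rule has_rs_integral_congI) (use assms in auto)
next
  assume "has_rs_integral g' h' a b I"
  then show "has_rs_integral g h a b I" by (rule has_rs_integral_congI) (use assms in auto)
qed

lemma rs_integral_cong:
  assumes "\<And>u. u \<in> {a..b} \<Longrightarrow> g u = g' u" "\<And>u. u \<in> {a..b} \<Longrightarrow> h u = h' u"
  shows "rs_integral g h a b = rs_integral g' h' a b"
proof -
  have "has_rs_integral g h a b = has_rs_integral g' h' a b"
    by (rule ext, rule has_rs_integral_cong) (fact assms)+
  then show ?thesis by (simp add: rs_integral_def)
qed

lemma has_rs_integral_linear_left:
  assumes "has_rs_integral g h a b I" "has_rs_integral g' h a b I'"
  shows "has_rs_integral (\<lambda>u. c * g u + d * g' u) h a b (c * I + d * I')"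
  by (rule has_rs_integral_combine[OF assms])
    (simp add: sum_distrib_left case_prod_unfold algebra_simps flip: sum.distrib)

lemma has_rs_integral_linear_right:
  assumes "has_rs_integral g h a b I" "has_rs_integral g h' a b I'"
  shows "has_rs_integral g (\<lambda>u. c * h u + d * h' u) a b (c * I + d * I')"
  by (rule has_rs_integral_combine[OF assms])
    (simp add: sum_distrib_left case_prod_unfold algebra_simps flip: sum.distrib)

lemma has_rs_integral_diff_left:
  assumes "has_rs_integral g h a b I" "has_rs_integral g' h a b I'"
  shows "has_rs_integral (\<lambda>u. g u - g' u) h a b (I - I')"
  using has_rs_integral_linear_left[OF assms, of 1 "-1"] by simp

lemma has_rs_integral_diff_right:
  assumes "has_rs_integral g h a b I" "has_rs_integral g h' a b I'"
  shows "has_rs_integral g (\<lambda>u. h u - h' u) a b (I - I')"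
  using has_rs_integral_linear_right[OF assms, of 1 "-1"] by simp

text \<open>The increments of F telescope over a tagged division, so an error of \<epsilon> per unit
  length adds up to \<epsilon> * (b - a). The tag u ranges over the whole of [s,t] because the sums
  leave it free.\<close>

lemma has_rs_integral_germ:
  assumes "a \<le> b" and germ: "\<And>\<epsilon>. \<epsilon> > 0 \<Longrightarrow> \<exists>\<delta>>0. \<forall>s u t. a \<le> s \<and> s \<le> u \<and> u \<le> t \<and> t \<le> b \<and> t - s < \<delta> \<longrightarrow>
      \<bar>F t - F s - g u * (h t - h s)\<bar> \<le> \<epsilon> * (t - s)"
  shows "has_rs_integral g h a b (F b - F a)"
  unfolding has_rs_integral_def
proof (intro allI impI)
  fix \<epsilon> :: real assume \<epsilon>: "\<epsilon> > 0"
  define e where "e = \<epsilon> / (b - a + 1)"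
  have e: "e > 0" using \<epsilon> assms(1) by (simp add: e_def)
  obtain \<delta> where \<delta>: "\<delta> > 0" "\<And>s u t. a \<le> s \<and> s \<le> u \<and> u \<le> t \<and> t \<le> b \<and> t - s < \<delta> \<Longrightarrow>
      \<bar>F t - F s - g u * (h t - h s)\<bar> \<le> e * (t - s)"
    using germ[OF e] by blast
  have "\<bar>rs_sum g h p - (F b - F a)\<bar> < \<epsilon>"
    if p: "p tagged_division_of {a..b}" and m: "\<forall>(u, K) \<in> p. Sup K - Inf K < \<delta>" for p
  proof -
    have "rs_sum g h p - (F b - F a) =
        (\<Sum>(u, K) \<in> p. g u * (h (Sup K) - h (Inf K)) - (F (Sup K) - F (Inf K)))"
      using additive_tagged_division_1[OF assms(1) p, of F]
      by (simp add: sum_subtractf case_prod_unfold)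
    also have "\<bar>\<dots>\<bar> \<le> (\<Sum>(u, K) \<in> p. e * (Sup K - Inf K))"
    proof (rule order_trans[OF sum_abs], rule sum_mono, clarify)
      fix u K assume uK: "(u, K) \<in> p"
      have "\<bar>F (Sup K) - F (Inf K) - g u * (h (Sup K) - h (Inf K))\<bar> \<le> e * (Sup K - Inf K)"
        using tagged_interval[OF p uK] m uK by (intro \<delta>(2)) auto
      then show "\<bar>g u * (h (Sup K) - h (Inf K)) - (F (Sup K) - F (Inf K))\<bar> \<le> e * (Sup K - Inf K)"
        by (simp add: abs_minus_commute)
    qed
    also have "\<dots> = e * (b - a)"
      using additive_tagged_division_1[OF assms(1) p, of "\<lambda>x. e * x"]
      by (simp add: algebra_simps)
    also have "\<dots> < e * (b - a + 1)" using e by simp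
    also have "\<dots> = \<epsilon>" unfolding e_def using assms(1) by simp
    finally show ?thesis .
  qed
  then show "\<exists>\<delta>>0. \<forall>p. p tagged_division_of {a..b} \<and> (\<forall>(u, K) \<in> p. Sup K - Inf K < \<delta>) \<longrightarrow>
      \<bar>rs_sum g h p - (F b - F a)\<bar> < \<epsilon>"
    using \<delta>(1) by blast
qed

text \<open>An error of order \<theta> > 1 is o(t - s): the surplus factor
  \<open>(t - s) powr (\<theta> - 1)\<close> drops below any \<epsilon>, and d in the proof is the
  length at which it does.\<close>

lemma has_rs_integral_germ_powr:
  assumes "a \<le> b" "1 < \<theta>"
    and germ: "\<And>s u t. a \<le> s \<Longrightarrow> s \<le> u \<Longrightarrow> u \<le> t \<Longrightarrow> t \<le> b \<Longrightarrow>
      \<bar>F t - F s - g u * (h t - h s)\<bar> \<le> C * (t - s) powr \<theta>"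
  shows "has_rs_integral g h a b (F b - F a)"
proof (rule has_rs_integral_germ[OF assms(1)])
  fix \<epsilon> :: real assume \<epsilon>: "\<epsilon> > 0"
  define d where "d = (\<epsilon> / (\<bar>C\<bar> + 1)) powr (1 / (\<theta> - 1))"
  have d: "d > 0" using \<epsilon> by (simp add: d_def)
  have "\<bar>F t - F s - g u * (h t - h s)\<bar> \<le> \<epsilon> * (t - s)"
    if "a \<le> s \<and> s \<le> u \<and> u \<le> t \<and> t \<le> b \<and> t - s < d" for s u t
  proof (cases "s = t")
    case True
    then show ?thesis using germ[of s u t] that by simp
  next
    case False
    have "\<bar>F t - F s - g u * (h t - h s)\<bar> \<le> C * (t - s) powr \<theta>"
      using that by (intro germ) auto
    also have "(t - s) powr \<theta> = (t - s) powr (\<theta> - 1) * (t - s)"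
      using that False by (metis add.commute diff_add_cancel diff_ge_0_iff_ge order.trans powr_add powr_one)
    also have "C * ((t - s) powr (\<theta> - 1) * (t - s)) \<le> \<bar>C\<bar> * ((t - s) powr (\<theta> - 1) * (t - s))"
      using that by (intro mult_right_mono) auto
    also have "\<dots> \<le> \<bar>C\<bar> * (\<epsilon> / (\<bar>C\<bar> + 1) * (t - s))"
    proof (intro mult_left_mono mult_right_mono)
      have "(t - s) powr (\<theta> - 1) \<le> d powr (\<theta> - 1)"
        using that assms(2) by (intro powr_mono2) auto
      also have "d powr (\<theta> - 1) = \<epsilon> / (\<bar>C\<bar> + 1)"
        unfolding d_def using \<epsilon> assms(2) by (simp add: powr_powr)
      finally show "(t - s) powr (\<theta> - 1) \<le> \<epsilon> / (\<bar>C\<bar> + 1)" .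
    qed (use that in auto)
    also have "\<dots> = (\<bar>C\<bar> / (\<bar>C\<bar> + 1)) * (\<epsilon> * (t - s))" by simp
    also have "\<dots> \<le> 1 * (\<epsilon> * (t - s))"
      using that \<epsilon> by (intro mult_right_mono) auto
    finally show ?thesis by simp
  qed
  then show "\<exists>\<delta>>0. \<forall>s u t. a \<le> s \<and> s \<le> u \<and> u \<le> t \<and> t \<le> b \<and> t - s < \<delta> \<longrightarrow>
      \<bar>F t - F s - g u * (h t - h s)\<bar> \<le> \<epsilon> * (t - s)"
    using d by blast
qed

text \<open>Comparing both sums on one tagged division keeps the pointwise majorant \<phi> under the
  integral instead of replacing it by its supremum. With \<phi> an exponential this is the source of
  the small factor in the contraction estimates.\<close>

lemma has_rs_integral_abs_le:
  assumes I: "has_rs_integral g h a b I" and J: "has_rs_integral \<phi> (\<lambda>u. u) a b J"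
    and g: "\<And>u. u \<in> {a..b} \<Longrightarrow> \<bar>g u\<bar> \<le> \<phi> u"
    and h: "\<And>s t. a \<le> s \<Longrightarrow> s \<le> t \<Longrightarrow> t \<le> b \<Longrightarrow> \<bar>h t - h s\<bar> \<le> K * (t - s)" and "0 \<le> K"
  shows "\<bar>I\<bar> \<le> K * J"
proof (rule field_le_epsilon)
  fix e :: real assume e: "e > 0"
  then have e': "e / (K + 1) > 0" using \<open>0 \<le> K\<close> by simp
  obtain p where p: "p tagged_division_of {a..b}" "\<bar>rs_sum g h p - I\<bar> < e / (K + 1)"
    "\<bar>rs_sum \<phi> (\<lambda>u. u) p - J\<bar> < e / (K + 1)"
    using has_rs_integral_approx2[OF I J e'] by blast
  have "\<bar>rs_sum g h p\<bar> \<le> (\<Sum>(u, K') \<in> p. K * (\<phi> u * (Sup K' - Inf K')))"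
  proof (rule order_trans[OF sum_abs], rule sum_mono, clarify)
    fix u K' assume uK: "(u, K') \<in> p"
    note t = tagged_interval[OF p(1) uK]
    have "\<bar>g u * (h (Sup K') - h (Inf K'))\<bar> \<le> \<phi> u * (K * (Sup K' - Inf K'))"
      unfolding abs_mult using t by (intro mult_mono g h order_trans[OF abs_ge_zero g]) auto
    then show "\<bar>g u * (h (Sup K') - h (Inf K'))\<bar> \<le> K * (\<phi> u * (Sup K' - Inf K'))"
      by (simp add: algebra_simps)
  qed
  also have "\<dots> = K * rs_sum \<phi> (\<lambda>u. u) p"
    by (simp add: sum_distrib_left case_prod_unfold)
  also have "\<dots> \<le> K * (J + e / (K + 1))"
    using p(3) \<open>0 \<le> K\<close> by (intro mult_left_mono) auto
  finally have "\<bar>I\<bar> \<le> K * (J + e / (K + 1)) + e / (K + 1)"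
    using p(2) by linarith
  also have "\<dots> = K * J + (K + 1) * (e / (K + 1))" by (simp only: algebra_simps)
  also have "\<dots> = K * J + e" using \<open>0 \<le> K\<close> by simp
  finally show "\<bar>I\<bar> \<le> K * J + e" .
qed

text \<open>Sum of the geometric series with ratio 2 / \<open>2 powr \<theta>\<close>: each
  bisection doubles the number of pieces and divides the error of a piece by
  \<open>2 powr \<theta>\<close>.\<close>

definition young_const :: "real \<Rightarrow> real"
  where "young_const \<theta> = 1 / (1 - 2 powr (1 - \<theta>))"

lemma young_const_nonneg: "1 < \<theta> \<Longrightarrow> 0 \<le> young_const \<theta>"
proof -
  assume "1 < \<theta>"
  then have "2 powr (1 - \<theta>) \<le> 2 powr (0::real)" by (intro powr_mono) auto
  then show ?thesis by (simp add: young_const_def)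
qed

text \<open>The a priori bound \<open>N\<close> on the defect \<open>R\<close> only has to be finite: bisecting the interval
  multiplies it by \<open>2 powr (1 - \<theta>) < 1\<close>, and in the limit it disappears from the conclusion.\<close>

lemma bisection_bound:
  fixes R :: "real \<Rightarrow> real \<Rightarrow> real"
  assumes \<theta>: "1 < \<theta>" and "0 \<le> C" "0 \<le> N"
    and mid: "\<And>s t. a \<le> s \<Longrightarrow> s \<le> t \<Longrightarrow> t \<le> b \<Longrightarrow>
      \<bar>R s t - R s ((s + t) / 2) - R ((s + t) / 2) t\<bar> \<le> C * (t - s) powr \<theta>"
    and apriori: "\<And>s t. a \<le> s \<Longrightarrow> s \<le> t \<Longrightarrow> t \<le> b \<Longrightarrow> \<bar>R s t\<bar> \<le> N * (t - s) powr \<theta>"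
    and st: "a \<le> s" "s \<le> t" "t \<le> b"
  shows "\<bar>R s t\<bar> \<le> young_const \<theta> * C * (t - s) powr \<theta>"
proof -
  define q :: real where "q = 2 powr (1 - \<theta>)"
  define Q where "Q = young_const \<theta>"
  have "2 powr (1 - \<theta>) < 2 powr (0::real)" using \<theta> by (intro powr_less_mono) auto
  then have q: "0 < q" "q < 1" by (auto simp: q_def)
  have Q: "1 + q * Q = Q" using q by (simp add: Q_def young_const_def flip: q_def) (simp add: field_simps)
  have Q0: "0 \<le> Q" using young_const_nonneg[OF \<theta>] by (simp add: Q_def)
  have "\<bar>R s t\<bar> \<le> (Q * C + q ^ n * N) * (t - s) powr \<theta>" if "a \<le> s" "s \<le> t" "t \<le> b" for n s t
    using that
  proof (induction n arbitrary: s t)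
    case 0
    have "\<bar>R s t\<bar> \<le> N * (t - s) powr \<theta>" using 0 by (rule apriori)
    also have "\<dots> \<le> (Q * C + q ^ 0 * N) * (t - s) powr \<theta>"
      using Q0 \<open>0 \<le> C\<close> by (intro mult_right_mono) auto
    finally show ?case .
  next
    case (Suc n)
    define m where "m = (s + t) / 2"
    define B where "B = Q * C + q ^ n * N"
    define X where "X = (t - s) powr \<theta>"
    have half: "((t - s) / 2) powr \<theta> = X / 2 powr \<theta>"
      unfolding X_def by (rule powr_divide)
    have 1: "\<bar>R s m\<bar> \<le> B * (X / 2 powr \<theta>)"
    proof -
      have "\<bar>R s m\<bar> \<le> B * (m - s) powr \<theta>"
        unfolding B_def using Suc.prems by (intro Suc.IH) (auto simp: m_def)
      also have "m - s = (t - s) / 2" by (simp add: m_def field_simps)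
      finally show ?thesis unfolding half .
    qed
    have 2: "\<bar>R m t\<bar> \<le> B * (X / 2 powr \<theta>)"
    proof -
      have "\<bar>R m t\<bar> \<le> B * (t - m) powr \<theta>"
        unfolding B_def using Suc.prems by (intro Suc.IH) (auto simp: m_def)
      also have "t - m = (t - s) / 2" by (simp add: m_def field_simps)
      finally show ?thesis unfolding half .
    qed
    have 3: "\<bar>R s t - R s m - R m t\<bar> \<le> C * X"
      unfolding X_def m_def using Suc.prems by (rule mid)
    have qq: "2 / 2 powr \<theta> = q"
      unfolding q_def by (simp add: powr_diff)
    have "\<bar>R s t\<bar> \<le> C * X + 2 * (B * (X / 2 powr \<theta>))"
      using 1 2 3 by linarith
    also have "\<dots> = (C + (2 / 2 powr \<theta>) * B) * X" by (simp add: algebra_simps)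
    also have "\<dots> = (C * (1 + q * Q) + q * (q ^ n * N)) * X"
      unfolding qq B_def by (simp add: algebra_simps)
    also have "\<dots> = (Q * C + q ^ Suc n * N) * X"
      unfolding Q by simp
    finally show ?case unfolding X_def .
  qed
  note bound = this
  have "(\<lambda>n. (Q * C + q ^ n * N) * (t - s) powr \<theta>) \<longlonglongrightarrow> (Q * C + 0 * N) * (t - s) powr \<theta>"
    by (intro tendsto_intros LIMSEQ_power_zero) (use q in auto)
  then have "\<bar>R s t\<bar> \<le> (Q * C + 0 * N) * (t - s) powr \<theta>"
    by (rule LIMSEQ_le_const) (use bound[OF st] in auto)
  then show ?thesis by (simp add: Q_def)
qed

text \<open>The defect R of the left-point rule satisfies R s t - R s m - R m t = (g m - g s) * (h t
  - h m), which is of order \<gamma> + \<kappa>, so \<open>bisection_bound\<close> applies. The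
  derivative k enters only the a priori bound, which leaves no trace in the conclusion; hence the
  estimate survives when a rough h is approximated by smooth ones.\<close>

lemma young_bound_smooth:
  fixes g h k :: "real \<Rightarrow> real"
  assumes \<gamma>: "0 < \<gamma>" and \<kappa>: "0 < \<kappa>" "\<kappa> \<le> 1" and sum: "1 < \<gamma> + \<kappa>" and C: "0 \<le> Cg" "0 \<le> Ch"
    and g: "holder_on a b \<gamma> Cg g" and h: "holder_on a b \<kappa> Ch h"
    and h': "\<And>u. u \<in> {a..b} \<Longrightarrow> (h has_vector_derivative k u) (at u within {a..b})"
    and k: "continuous_on {a..b} k"
    and st: "a \<le> s" "s \<le> t" "t \<le> b"
  shows "\<bar>integral {s..t} (\<lambda>u. g u * k u) - g s * (h t - h s)\<bar>
    \<le> young_const (\<gamma> + \<kappa>) * (Cg * Ch) * (t - s) powr (\<gamma> + \<kappa>)"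
proof -
  define R where "R = (\<lambda>s t. integral {s..t} (\<lambda>u. g u * k u) - g s * (h t - h s))"
  have gc: "continuous_on {a..b} g" using holder_on_continuous[OF g \<gamma>] .
  have gk: "(\<lambda>u. g u * k u) integrable_on {s..t}" if "a \<le> s" "t \<le> b" for s t
    using that by (intro integrable_continuous_real continuous_on_subset[OF continuous_on_mult[OF gc k]]) auto
  obtain B where B: "B \<ge> 0" "\<And>u. u \<in> {a..b} \<Longrightarrow> \<bar>k u\<bar> \<le> B"
  proof -
    have "bounded (k ` {a..b})" using k by (intro compact_imp_bounded compact_continuous_image) auto
    then obtain B where "\<forall>u\<in>{a..b}. norm (k u) \<le> B" by (auto simp: bounded_iff)
    then show ?thesis by (intro that[of "max B 0"]) (auto simp: le_max_iff_disj)
  qed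
  have "\<bar>R s t\<bar> \<le> young_const (\<gamma> + \<kappa>) * (Cg * Ch) * (t - s) powr (\<gamma> + \<kappa>)"
  \<comment> \<open>With |k| bounded by B the defect is of order \<gamma> + 1; the factor
    \<open>(b - a) powr (1 - \<kappa>)\<close> lowers this to the order \<gamma> + \<kappa> that is
    required.\<close>
  proof (rule bisection_bound[OF sum _ _ _ _ st, where N = "Cg * B * (b - a) powr (1 - \<kappa>)"])
    fix s t assume st: "a \<le> s" "s \<le> t" "t \<le> b"
    define m where "m = (s + t) / 2"
    have m: "s \<le> m" "m \<le> t" using st by (auto simp: m_def)
    have "integral {s..m} (\<lambda>u. g u * k u) + integral {m..t} (\<lambda>u. g u * k u) = integral {s..t} (\<lambda>u. g u * k u)"
      by (rule Henstock_Kurzweil_Integration.integral_combine[OF m gk]) (use st in auto)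
    then have "R s t - R s m - R m t = (g m - g s) * (h t - h m)"
      unfolding R_def by (simp add: algebra_simps)
    also have "\<bar>\<dots>\<bar> \<le> (Cg * (m - s) powr \<gamma>) * (Ch * (t - m) powr \<kappa>)"
      unfolding abs_mult using m st C
      by (intro mult_mono holder_onD[OF g, unfolded real_norm_def] holder_onD[OF h, unfolded real_norm_def]) auto
    also have "\<dots> \<le> (Cg * (t - s) powr \<gamma>) * (Ch * (t - s) powr \<kappa>)"
      using m st C \<gamma> \<kappa> by (intro mult_mono mult_left_mono powr_mono2) auto
    also have "\<dots> = Cg * Ch * (t - s) powr (\<gamma> + \<kappa>)"
      by (simp add: powr_add)
    finally show "\<bar>R s t - R s ((s + t) / 2) - R ((s + t) / 2) t\<bar> \<le> Cg * Ch * (t - s) powr (\<gamma> + \<kappa>)"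
      unfolding m_def .
  next
    fix s t assume st: "a \<le> s" "s \<le> t" "t \<le> b"
    have sub: "{s..t} \<subseteq> {a..b}" using st by auto
    have hk: "(k has_integral (h t - h s)) {s..t}"
      by (rule fundamental_theorem_of_calculus[OF st(2)])
        (use sub h' in \<open>blast intro: has_vector_derivative_within_subset\<close>)
    have "((\<lambda>u. g u * k u - g s * k u) has_integral (integral {s..t} (\<lambda>u. g u * k u) - g s * (h t - h s))) {s..t}"
      by (intro has_integral_diff has_integral_mult_right hk integrable_integral gk) (use st in auto)
    then have "R s t = integral {s..t} (\<lambda>u. g u * k u - g s * k u)"
      unfolding R_def by (simp add: integral_unique)
    also have "norm \<dots> \<le> (Cg * (t - s) powr \<gamma> * B) * (t - s)"
    proof (rule integral_bound[OF st(2)])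
      show "continuous_on {s..t} (\<lambda>u. g u * k u - g s * k u)"
        by (intro continuous_intros continuous_on_subset[OF gc sub] continuous_on_subset[OF k sub])
      fix u assume u: "u \<in> {s..t}"
      have "norm (g u - g s) \<le> Cg * (u - s) powr \<gamma>" using u st by (intro holder_onD[OF g]) auto
      also have "\<dots> \<le> Cg * (t - s) powr \<gamma>" using u C \<gamma> by (intro mult_left_mono powr_mono2) auto
      finally have "norm (g u - g s) * norm (k u) \<le> (Cg * (t - s) powr \<gamma>) * B"
        using B u st by (intro mult_mono) auto
      then show "norm (g u * k u - g s * k u) \<le> Cg * (t - s) powr \<gamma> * B"
        by (simp add: abs_mult flip: left_diff_distrib)
    qed
    also have "\<dots> = Cg * B * ((t - s) powr \<gamma> * (t - s) powr 1)"
      using st by simp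
    also have "\<dots> = Cg * B * (t - s) powr (\<gamma> + 1)"
      by (simp only: powr_add)
    also have "\<dots> \<le> Cg * B * ((b - a) powr ((\<gamma> + 1) - (\<gamma> + \<kappa>)) * (t - s) powr (\<gamma> + \<kappa>))"
      using st C B \<kappa> by (intro mult_left_mono powr_le_powr_interval) auto
    finally show "\<bar>R s t\<bar> \<le> Cg * B * (b - a) powr (1 - \<kappa>) * (t - s) powr (\<gamma> + \<kappa>)"
      by (simp add: mult.assoc)
  qed (use C B in auto)
  then show ?thesis by (simp add: R_def)
qed

section \<open>The Young integral, by smoothing the integrator\<close>

lemma holder_on_clamp:
  assumes "holder_on a b \<kappa> C h" "a \<le> b" "0 < \<kappa>" "0 \<le> C"
  shows "holder_on p q \<kappa> C (\<lambda>u. h (max a (min b u)))"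
  unfolding holder_on_def
proof (intro allI impI)
  fix s t :: real assume "s < t"
  have "norm (h (max a (min b t)) - h (max a (min b s)))
      \<le> C * (max a (min b t) - max a (min b s)) powr \<kappa>"
    using \<open>s < t\<close> assms(2) by (intro holder_onD[OF assms(1)]) (auto simp: max_def min_def)
  also have "\<dots> \<le> C * (t - s) powr \<kappa>"
    using \<open>s < t\<close> assms by (intro mult_left_mono powr_mono2) (auto simp: max_def min_def)
  finally show "norm (h (max a (min b t)) - h (max a (min b s))) \<le> C * (t - s) powr \<kappa>" .
qed

text \<open>The moving average over [t, t + \<epsilon>] is continuously differentiable and, being an
  average of translates, inherits the Hoelder constant of h. This makes the Young bound uniform in
  \<epsilon>. The average looks beyond b, so h is first continued constantly.\<close>

lemma steklov_mean:
  fixes h :: "real \<Rightarrow> real"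
  assumes h: "holder_on a b \<kappa> C h" and "a \<le> b" "0 < \<kappa>" "0 \<le> C" "0 < \<epsilon>"
  obtains h\<epsilon> k where "\<And>u. u \<in> {a..b} \<Longrightarrow> (h\<epsilon> has_vector_derivative k u) (at u within {a..b})" "continuous_on {a..b} k"
    "holder_on a b \<kappa> C h\<epsilon>" "\<And>u. u \<in> {a..b} \<Longrightarrow> \<bar>h\<epsilon> u - h u\<bar> \<le> C * \<epsilon> powr \<kappa>"
proof -
  define f where "f = (\<lambda>u. h (max a (min b u)))"
  have f: "holder_on p q \<kappa> C f" for p q
    unfolding f_def using holder_on_clamp assms by blast
  have fc: "continuous_on {p..q} f" for p q
    using holder_on_continuous[OF f assms(3)] .
  \<comment> \<open>The margin 1 on both sides puts [a, b + \<epsilon>] inside an open interval, so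
    that the primitive H has two-sided derivatives at all points needed.\<close>
  define D where "D = {a - 1<..<b + \<epsilon> + 1}"
  define H where "H = (\<lambda>u. integral {a - 1..u} f)"
  have H: "(H has_real_derivative f u) (at u)" if "u \<in> D" for u
  proof -
    have "(H has_vector_derivative f u) (at u within {a - 1..b + \<epsilon> + 1})"
      unfolding H_def by (rule integral_has_vector_derivative[OF fc]) (use that in \<open>auto simp: D_def\<close>)
    then have "(H has_vector_derivative f u) (at u within D)"
      by (rule has_vector_derivative_within_subset) (auto simp: D_def)
    moreover have "at u within D = at u"
      using that by (intro at_within_open) (auto simp: D_def)
    ultimately show ?thesis by (simp add: has_real_derivative_iff_has_vector_derivative)
  qed
  have Hs: "((\<lambda>t. H (t + r)) has_real_derivative f (t + r)) (at t)" if "t + r \<in> D" for r t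
    using H[OF that] by (simp add: DERIV_shift)
  have Hs': "((\<lambda>r. H (t + r)) has_real_derivative f (t + r)) (at r)" if "t + r \<in> D" for r t
    using Hs[of r t] that by (simp add: add.commute)
  define h\<epsilon> where "h\<epsilon> = (\<lambda>t. (H (t + \<epsilon>) - H t) / \<epsilon>)"
  define k where "k = (\<lambda>t. (f (t + \<epsilon>) - f t) / \<epsilon>)"
  show ?thesis
  proof (rule that[of h\<epsilon> k])
    fix u assume "u \<in> {a..b}"
    then have "(h\<epsilon> has_real_derivative k u) (at u)"
      unfolding h\<epsilon>_def k_def using \<open>0 < \<epsilon>\<close> by (intro DERIV_cdivide DERIV_diff Hs H) (auto simp: D_def)
    then show "(h\<epsilon> has_vector_derivative k u) (at u within {a..b})"
      by (simp add: has_real_derivative_iff_has_vector_derivative has_vector_derivative_at_within)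
  next
    have "continuous_on {a..b} (\<lambda>t. f (t + \<epsilon>))"
      by (rule continuous_on_compose2[OF fc[of "a + \<epsilon>" "b + \<epsilon>"]]) (auto intro: continuous_intros)
    then show "continuous_on {a..b} k"
      unfolding k_def using \<open>0 < \<epsilon>\<close> by (intro continuous_intros fc) auto
  next
    show "holder_on a b \<kappa> C h\<epsilon>"
      unfolding holder_on_def
    proof (intro allI impI)
      fix s t assume st: "a \<le> s" "s < t" "t \<le> b"
      \<comment> \<open>The mean value theorem in the averaging variable r: the difference of two
        averages is a single difference f (t + z) - f (s + z).\<close>
      obtain z where z: "(H (t + \<epsilon>) - H (s + \<epsilon>)) - (H (t + 0) - H (s + 0)) = (\<epsilon> - 0) * (f (t + z) - f (s + z))"
        using MVT2[OF \<open>0 < \<epsilon>\<close>, of "\<lambda>r. H (t + r) - H (s + r)" "\<lambda>r. f (t + r) - f (s + r)"]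
          DERIV_diff[OF Hs' Hs'] st by (auto simp: D_def)
      have "h\<epsilon> t - h\<epsilon> s = ((H (t + \<epsilon>) - H (s + \<epsilon>)) - (H (t + 0) - H (s + 0))) / \<epsilon>"
        by (simp add: h\<epsilon>_def diff_divide_distrib)
      also have "\<dots> = f (t + z) - f (s + z)"
        unfolding z using \<open>0 < \<epsilon>\<close> by simp
      finally show "norm (h\<epsilon> t - h\<epsilon> s) \<le> C * (t - s) powr \<kappa>"
        using holder_onD[OF f, of "s + z" "s + z" "t + z" "t + z"] \<open>s < t\<close> by simp
    qed
  next
    fix u assume u: "u \<in> {a..b}"
    obtain z where z: "0 < z" "z < \<epsilon>" "H (u + \<epsilon>) - H (u + 0) = (\<epsilon> - 0) * f (u + z)"
      using MVT2[OF \<open>0 < \<epsilon>\<close>, of "\<lambda>r. H (u + r)" "\<lambda>r. f (u + r)"] Hs' u by (auto simp: D_def)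
    then have "h\<epsilon> u = f (u + z)" using \<open>0 < \<epsilon>\<close> by (simp add: h\<epsilon>_def)
    moreover have "f u = h u" using u by (simp add: f_def)
    moreover have "\<bar>f (u + z) - f u\<bar> \<le> C * z powr \<kappa>"
      using holder_onD[OF f, of u u "u + z" "u + z"] z by simp
    moreover have "C * z powr \<kappa> \<le> C * \<epsilon> powr \<kappa>"
      using z assms by (intro mult_left_mono powr_mono2) auto
    ultimately show "\<bar>h\<epsilon> u - h u\<bar> \<le> C * \<epsilon> powr \<kappa>" by linarith
  qed
qed

text \<open>Interpolation of Hoelder norms in scalar form: write x =
  \<open>x powr \<theta> * x powr (1 - \<theta>)\<close> and bound each factor by a different
  hypothesis.\<close>

lemma powr_interpolation:
  fixes x A B p :: real
  assumes "0 \<le> x" "x \<le> A * p" "x \<le> B" "0 \<le> \<theta>" "\<theta> \<le> 1" "0 \<le> p" "0 \<le> A"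
  shows "x \<le> A powr \<theta> * B powr (1 - \<theta>) * p powr \<theta>"
proof (cases "x = 0")
  case False
  then have "x = x powr \<theta> * x powr (1 - \<theta>)" using assms by (simp flip: powr_add)
  also have "\<dots> \<le> (A * p) powr \<theta> * B powr (1 - \<theta>)"
    using assms by (intro mult_mono powr_mono2) auto
  also have "\<dots> = A powr \<theta> * B powr (1 - \<theta>) * p powr \<theta>"
    by (simp add: powr_mult)
  finally show ?thesis .
qed auto

lemma convergent_if_tail_bound:
  fixes X :: "nat \<Rightarrow> real"
  assumes "\<And>N n m. N \<le> n \<Longrightarrow> N \<le> m \<Longrightarrow> \<bar>X n - X m\<bar> \<le> E N" "E \<longlonglongrightarrow> 0"
  shows "convergent X"
proof -
  have "Cauchy X"
  proof (rule metric_CauchyI)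
    fix e :: real assume "e > 0"
    then obtain N where N: "\<bar>E N\<bar> < e"
      using assms(2) unfolding LIMSEQ_iff by fastforce
    show "\<exists>M. \<forall>m\<ge>M. \<forall>n\<ge>M. dist (X m) (X n) < e"
    proof (intro exI allI impI)
      fix m n assume "m \<ge> N" "n \<ge> N"
      from assms(1)[OF this] N show "dist (X m) (X n) < e" by (simp add: dist_real_def)
    qed
  qed
  then show ?thesis by (simp add: Cauchy_convergent_iff)
qed

locale young_pair =
  fixes a b \<gamma> \<kappa> Cg Ch :: real and g h :: "real \<Rightarrow> real"
  assumes ab: "a \<le> b" and \<gamma>: "0 < \<gamma>" and \<kappa>: "0 < \<kappa>" "\<kappa> \<le> 1" and exponents: "1 < \<gamma> + \<kappa>"
    and constants: "0 \<le> Cg" "0 \<le> Ch"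
    and holder_g: "holder_on a b \<gamma> Cg g" and holder_h: "holder_on a b \<kappa> Ch h"
begin

text \<open>F is the limit of the integrals of g against smoothed versions of h. The differences of
  the smoothings are bounded but not small in the \<kappa>-Hoelder seminorm; interpolation makes
  them small for a slightly smaller exponent \<kappa>', and as long as \<gamma> + \<kappa>' > 1 the
  smooth Young bound makes the integrals a Cauchy sequence.\<close>

lemma germ_exists:
  "\<exists>F. \<forall>s t. a \<le> s \<longrightarrow> s \<le> t \<longrightarrow> t \<le> b \<longrightarrow>
    \<bar>F t - F s - g s * (h t - h s)\<bar> \<le> young_const (\<gamma> + \<kappa>) * (Cg * Ch) * (t - s) powr (\<gamma> + \<kappa>)"
proof -
  define \<epsilon> where "\<epsilon> = (\<lambda>n. 1 / real (Suc n))"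
  have "\<exists>p. (\<forall>u\<in>{a..b}. (fst p has_vector_derivative snd p u) (at u within {a..b})) \<and> continuous_on {a..b} (snd p) \<and>
      holder_on a b \<kappa> Ch (fst p) \<and> (\<forall>u\<in>{a..b}. \<bar>fst p u - h u\<bar> \<le> Ch * \<epsilon> n powr \<kappa>)" for n
  proof -
    have "0 < \<epsilon> n" by (simp add: \<epsilon>_def)
    from steklov_mean[OF holder_h ab \<kappa>(1) constants(2) this]
    obtain h\<epsilon> k where "\<And>u. u \<in> {a..b} \<Longrightarrow> (h\<epsilon> has_vector_derivative k u) (at u within {a..b})" "continuous_on {a..b} k"
      "holder_on a b \<kappa> Ch h\<epsilon>" "\<And>u. u \<in> {a..b} \<Longrightarrow> \<bar>h\<epsilon> u - h u\<bar> \<le> Ch * \<epsilon> n powr \<kappa>"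
      by blast
    then show ?thesis by (intro exI[of _ "(h\<epsilon>, k)"]) auto
  qed
  then obtain P where P: "\<And>n. (\<forall>u\<in>{a..b}. (fst (P n) has_vector_derivative snd (P n) u) (at u within {a..b})) \<and>
      continuous_on {a..b} (snd (P n)) \<and>
      holder_on a b \<kappa> Ch (fst (P n)) \<and> (\<forall>u\<in>{a..b}. \<bar>fst (P n) u - h u\<bar> \<le> Ch * \<epsilon> n powr \<kappa>)"
    by metis
  define H where "H = (\<lambda>n. fst (P n))"
  define k where "k = (\<lambda>n. snd (P n))"
  have H': "(H n has_vector_derivative k n u) (at u within {a..b})" if "u \<in> {a..b}" for n u
    using P that by (simp add: H_def k_def)
  have k: "continuous_on {a..b} (k n)" for n using P by (simp add: k_def)
  have Hh: "holder_on a b \<kappa> Ch (H n)" for n using P by (simp add: H_def)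
  have Hn: "\<bar>H n u - h u\<bar> \<le> Ch * \<epsilon> n powr \<kappa>" if "u \<in> {a..b}" for n u
    using P that by (simp add: H_def)
  have \<epsilon>0: "\<epsilon> \<longlonglongrightarrow> 0"
    unfolding \<epsilon>_def using LIMSEQ_inverse_real_of_nat by (simp add: divide_inverse)
  have \<epsilon>\<kappa>: "(\<lambda>n. \<epsilon> n powr \<kappa>) \<longlonglongrightarrow> 0"
    by (rule tendsto_zero_powrI[OF \<epsilon>0 tendsto_const]) (auto simp: \<epsilon>_def \<kappa>)
  have gc: "continuous_on {a..b} g" using holder_on_continuous[OF holder_g \<gamma>] .
  have int: "(\<lambda>u. g u * k n u) integrable_on {s..t}" if "a \<le> s" "t \<le> b" for n s t
    using that by (intro integrable_continuous_real continuous_on_subset[OF continuous_on_mult[OF gc k]]) auto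
  define F where "F = (\<lambda>n t. integral {a..t} (\<lambda>u. g u * k n u))"
  have est: "\<bar>F n t - F n s - g s * (H n t - H n s)\<bar>
      \<le> young_const (\<gamma> + \<kappa>) * (Cg * Ch) * (t - s) powr (\<gamma> + \<kappa>)"
    if st: "a \<le> s" "s \<le> t" "t \<le> b" for n s t
  proof -
    have "integral {a..s} (\<lambda>u. g u * k n u) + integral {s..t} (\<lambda>u. g u * k n u) = integral {a..t} (\<lambda>u. g u * k n u)"
      by (rule Henstock_Kurzweil_Integration.integral_combine[OF st(1,2) int]) (use st in auto)
    then have "F n t - F n s = integral {s..t} (\<lambda>u. g u * k n u)" by (simp add: F_def)
    then show ?thesis
      using young_bound_smooth[OF \<gamma> \<kappa> exponents constants holder_g Hh H' k st] by simp
  qed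
  \<comment> \<open>The midpoint between \<kappa> and the larger of 0 and 1 - \<gamma>, hence
    strictly inside the admissible range.\<close>
  define \<kappa>' where "\<kappa>' = (\<kappa> + max 0 (1 - \<gamma>)) / 2"
  have \<kappa>': "0 < \<kappa>'" "\<kappa>' < \<kappa>" "1 < \<gamma> + \<kappa>'"
    using \<gamma> \<kappa> exponents by (auto simp: \<kappa>'_def max_def field_simps)
  define \<theta> where "\<theta> = \<kappa>' / \<kappa>"
  have \<theta>: "0 \<le> \<theta>" "\<theta> < 1" "\<kappa> * \<theta> = \<kappa>'" using \<kappa>' \<kappa> by (auto simp: \<theta>_def)
  \<comment> \<open>The \<kappa>'-Hoelder constant obtained by interpolation for a difference d of
    two smoothings: Ch + Ch is its \<kappa>-Hoelder constant, and 4 * Ch *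
    \<open>\<epsilon> N powr \<kappa>\<close> bounds its increments, since |d| is at most half of
    that.\<close>
  define D where "D = (\<lambda>N. (Ch + Ch) powr \<theta> * (4 * Ch * \<epsilon> N powr \<kappa>) powr (1 - \<theta>))"
  define E where "E = (\<lambda>N. \<bar>g a\<bar> * (4 * Ch * \<epsilon> N powr \<kappa>) +
      young_const (\<gamma> + \<kappa>') * (Cg * D N) * (b - a) powr (\<gamma> + \<kappa>'))"
  have D0: "D \<longlonglongrightarrow> 0"
  proof -
    have "(\<lambda>N. 4 * Ch * \<epsilon> N powr \<kappa>) \<longlonglongrightarrow> 0" using tendsto_mult_right_zero[OF \<epsilon>\<kappa>] by blast
    then have "(\<lambda>N. (4 * Ch * \<epsilon> N powr \<kappa>) powr (1 - \<theta>)) \<longlonglongrightarrow> 0"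
      by (rule tendsto_zero_powrI[OF _ tendsto_const]) (use \<theta> constants in auto)
    then show ?thesis unfolding D_def by (rule tendsto_mult_right_zero)
  qed
  have E0: "E \<longlonglongrightarrow> 0"
  proof -
    have "E \<longlonglongrightarrow> \<bar>g a\<bar> * (4 * Ch * 0) + young_const (\<gamma> + \<kappa>') * (Cg * 0) * (b - a) powr (\<gamma> + \<kappa>')"
      unfolding E_def by (intro tendsto_intros D0 \<epsilon>\<kappa>)
    then show ?thesis by simp
  qed
  have tail: "\<bar>F n t - F m t\<bar> \<le> E N" if nm: "N \<le> n" "N \<le> m" and t: "t \<in> {a..b}" for N n m t
  proof -
    define d where "d = (\<lambda>u. H n u - H m u)"
    have mono: "\<epsilon> n powr \<kappa> \<le> \<epsilon> N powr \<kappa>" if "N \<le> n" for n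
      using that \<kappa> by (intro powr_mono2) (auto simp: \<epsilon>_def frac_le)
    have dsmall: "\<bar>d u\<bar> \<le> 2 * Ch * \<epsilon> N powr \<kappa>" if "u \<in> {a..b}" for u
    proof -
      have "\<bar>d u\<bar> \<le> Ch * \<epsilon> n powr \<kappa> + Ch * \<epsilon> m powr \<kappa>"
        unfolding d_def using Hn[OF that, of n] Hn[OF that, of m] by linarith
      also have "\<dots> \<le> Ch * \<epsilon> N powr \<kappa> + Ch * \<epsilon> N powr \<kappa>"
        using constants nm by (intro add_mono mult_left_mono mono) auto
      finally show ?thesis by simp
    qed
    have dh: "holder_on a b \<kappa> (Ch + Ch) d" unfolding d_def by (intro holder_on_diff Hh)
    have dinc: "\<bar>d t - d s\<bar> \<le> 4 * Ch * \<epsilon> N powr \<kappa>" if "s \<in> {a..b}" "t \<in> {a..b}" for s t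
      using dsmall[OF that(1)] dsmall[OF that(2)] by linarith
    have dh': "holder_on a b \<kappa>' (D N) d"
      unfolding holder_on_def
    proof (intro allI impI)
      fix s t assume st: "a \<le> s" "s < t" "t \<le> b"
      have "norm (d t - d s) \<le> (Ch + Ch) powr \<theta> * (4 * Ch * \<epsilon> N powr \<kappa>) powr (1 - \<theta>) * ((t - s) powr \<kappa>) powr \<theta>"
        using st constants \<theta> dinc[of s t] holder_onD[OF dh, of s t] by (intro powr_interpolation) auto
      then show "norm (d t - d s) \<le> D N * (t - s) powr \<kappa>'"
        by (simp add: D_def powr_powr \<theta>(3))
    qed
    have d': "(d has_vector_derivative (k n u - k m u)) (at u within {a..b})" if "u \<in> {a..b}" for u
      unfolding d_def by (intro has_vector_derivative_diff H' that)
    have kc: "continuous_on {a..b} (\<lambda>u. k n u - k m u)" by (intro continuous_intros k)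
    have "0 \<le> D N" by (simp add: D_def)
    have "F n t - F m t = integral {a..t} (\<lambda>u. g u * (k n u - k m u))"
      unfolding F_def using t by (subst integral_diff[symmetric]) (auto intro!: int simp: algebra_simps)
    moreover have "\<bar>integral {a..t} (\<lambda>u. g u * (k n u - k m u)) - g a * (d t - d a)\<bar>
        \<le> young_const (\<gamma> + \<kappa>') * (Cg * D N) * (t - a) powr (\<gamma> + \<kappa>')"
      using t \<kappa>' \<kappa> by (intro young_bound_smooth[OF \<gamma> _ _ _ constants(1) \<open>0 \<le> D N\<close> holder_g dh' d' kc]) auto
    moreover have "young_const (\<gamma> + \<kappa>') * (Cg * D N) * (t - a) powr (\<gamma> + \<kappa>')
        \<le> young_const (\<gamma> + \<kappa>') * (Cg * D N) * (b - a) powr (\<gamma> + \<kappa>')"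
      using t \<kappa>' \<gamma> constants \<open>0 \<le> D N\<close> young_const_nonneg[of "\<gamma> + \<kappa>'"]
      by (intro mult_left_mono powr_mono2) auto
    moreover have "\<bar>g a * (d t - d a)\<bar> \<le> \<bar>g a\<bar> * (4 * Ch * \<epsilon> N powr \<kappa>)"
      unfolding abs_mult using t ab by (intro mult_left_mono dinc) auto
    ultimately show ?thesis unfolding E_def by linarith
  qed
  define L where "L = (\<lambda>t. lim (\<lambda>n. F n t))"
  have L: "(\<lambda>n. F n t) \<longlonglongrightarrow> L t" if "t \<in> {a..b}" for t
  proof -
    have "convergent (\<lambda>n. F n t)"
      by (rule convergent_if_tail_bound[OF _ E0]) (use tail that in blast)
    then show ?thesis by (simp add: convergent_LIMSEQ_iff L_def)
  qed
  have Hl: "(\<lambda>n. H n t) \<longlonglongrightarrow> h t" if "t \<in> {a..b}" for t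
  proof -
    have "(\<lambda>n. H n t - h t) \<longlonglongrightarrow> 0"
      by (rule tendsto_rabs_zero_cancel, rule tendsto_sandwich[OF _ _ tendsto_const tendsto_mult_right_zero[OF \<epsilon>\<kappa>, of Ch]])
        (use Hn[OF that] in auto)
    then show ?thesis using LIM_zero_iff by blast
  qed
  show ?thesis
  proof (intro exI[of _ L] allI impI)
    fix s t assume st: "a \<le> s" "s \<le> t" "t \<le> b"
    have "(\<lambda>n. \<bar>F n t - F n s - g s * (H n t - H n s)\<bar>) \<longlonglongrightarrow> \<bar>L t - L s - g s * (h t - h s)\<bar>"
      using st by (intro tendsto_intros L Hl) auto
    then show "\<bar>L t - L s - g s * (h t - h s)\<bar> \<le> young_const (\<gamma> + \<kappa>) * (Cg * Ch) * (t - s) powr (\<gamma> + \<kappa>)"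
      by (rule LIMSEQ_le_const2) (use est[OF st] in auto)
  qed
qed

text \<open>\<open>germ_exists\<close> controls the left-point rule only. Moving the tag to u adds
  (g u - g s') * (h t' - h s'), again of order \<gamma> + \<kappa>, so F is a primitive for
  arbitrary tags. Writing the integral over [s,t] as a difference of integrals from a yields
  additivity on the way.\<close>

lemma integral_facts:
  assumes st: "a \<le> s" "s \<le> t" "t \<le> b"
  shows has_integral: "has_rs_integral g h s t (rs_integral g h a t - rs_integral g h a s)"
    and integral_germ: "\<bar>rs_integral g h a t - rs_integral g h a s - g s * (h t - h s)\<bar>
      \<le> young_const (\<gamma> + \<kappa>) * (Cg * Ch) * (t - s) powr (\<gamma> + \<kappa>)"
proof -
  obtain F where F: "\<And>s t. a \<le> s \<Longrightarrow> s \<le> t \<Longrightarrow> t \<le> b \<Longrightarrow>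
      \<bar>F t - F s - g s * (h t - h s)\<bar> \<le> young_const (\<gamma> + \<kappa>) * (Cg * Ch) * (t - s) powr (\<gamma> + \<kappa>)"
    using germ_exists by blast
  have I: "has_rs_integral g h s t (F t - F s)" if st: "a \<le> s" "s \<le> t" "t \<le> b" for s t
  proof (rule has_rs_integral_germ_powr[OF st(2) exponents])
    fix s' u t' assume u: "s \<le> s'" "s' \<le> u" "u \<le> t'" "t' \<le> t"
    have "\<bar>(g u - g s') * (h t' - h s')\<bar> \<le> (Cg * (u - s') powr \<gamma>) * (Ch * (t' - s') powr \<kappa>)"
      unfolding abs_mult using u st constants
      by (intro mult_mono holder_onD[OF holder_g, unfolded real_norm_def] holder_onD[OF holder_h, unfolded real_norm_def]) auto
    also have "\<dots> \<le> (Cg * (t' - s') powr \<gamma>) * (Ch * (t' - s') powr \<kappa>)"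
      using u st constants \<gamma> \<kappa> by (intro mult_mono mult_left_mono powr_mono2) auto
    also have "\<dots> = (Cg * Ch) * (t' - s') powr (\<gamma> + \<kappa>)" by (simp add: powr_add)
    finally have 1: "\<bar>(g u - g s') * (h t' - h s')\<bar> \<le> (Cg * Ch) * (t' - s') powr (\<gamma> + \<kappa>)" .
    have 2: "\<bar>F t' - F s' - g s' * (h t' - h s')\<bar> \<le> young_const (\<gamma> + \<kappa>) * (Cg * Ch) * (t' - s') powr (\<gamma> + \<kappa>)"
      using u st by (intro F) auto
    have "F t' - F s' - g u * (h t' - h s') = (F t' - F s' - g s' * (h t' - h s')) - (g u - g s') * (h t' - h s')"
      by (simp add: algebra_simps)
    then have "\<bar>F t' - F s' - g u * (h t' - h s')\<bar> \<le>
        young_const (\<gamma> + \<kappa>) * (Cg * Ch) * (t' - s') powr (\<gamma> + \<kappa>) + (Cg * Ch) * (t' - s') powr (\<gamma> + \<kappa>)"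
      using 1 2 by linarith
    then show "\<bar>F t' - F s' - g u * (h t' - h s')\<bar>
        \<le> (young_const (\<gamma> + \<kappa>) * (Cg * Ch) + Cg * Ch) * (t' - s') powr (\<gamma> + \<kappa>)"
      by (simp add: algebra_simps)
  qed
  have eq: "rs_integral g h a r = F r - F a" if "a \<le> r" "r \<le> b" for r
    using I[of a r] that by (intro rs_integral_eqI) auto
  have d: "rs_integral g h a t - rs_integral g h a s = F t - F s"
    using st by (simp add: eq)
  show "has_rs_integral g h s t (rs_integral g h a t - rs_integral g h a s)"
    unfolding d using I st by blast
  show "\<bar>rs_integral g h a t - rs_integral g h a s - g s * (h t - h s)\<bar>
      \<le> young_const (\<gamma> + \<kappa>) * (Cg * Ch) * (t - s) powr (\<gamma> + \<kappa>)"
    unfolding d using F st by blast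
qed

lemma integral_self [simp]: "rs_integral g h a a = 0"
  using has_integral[of a a] ab by (auto dest: rs_integral_eqI)

lemma has_integral_from_start: "t \<in> {a..b} \<Longrightarrow> has_rs_integral g h a t (rs_integral g h a t)"
  using has_integral[of a t] by simp

lemma integrable: "a \<le> s \<Longrightarrow> s \<le> t \<Longrightarrow> t \<le> b \<Longrightarrow> rs_integrable g h s t"
  using has_integral by (auto simp: rs_integrable_def)

text \<open>Left-point value plus Young error. The length enters through an upper bound T, so that
  one constant serves all initial segments of a fixed interval.\<close>

lemma integral_holder:
  assumes G: "\<And>u. u \<in> {a..b} \<Longrightarrow> \<bar>g u\<bar> \<le> G" and T: "b - a \<le> T"
  shows "holder_on a b \<kappa> ((G + young_const (\<gamma> + \<kappa>) * Cg * T powr \<gamma>) * Ch) (\<lambda>t. rs_integral g h a t)"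
  unfolding holder_on_def
proof (intro allI impI)
  fix s t assume st: "a \<le> s" "s < t" "t \<le> b"
  have "\<bar>g s * (h t - h s)\<bar> \<le> G * (Ch * (t - s) powr \<kappa>)"
    unfolding abs_mult using st constants G[of s]
    by (intro mult_mono holder_onD[OF holder_h, unfolded real_norm_def]) auto
  moreover have "\<bar>rs_integral g h a t - rs_integral g h a s - g s * (h t - h s)\<bar>
      \<le> young_const (\<gamma> + \<kappa>) * (Cg * Ch) * (t - s) powr (\<gamma> + \<kappa>)"
    using st by (intro integral_germ) auto
  moreover have "young_const (\<gamma> + \<kappa>) * (Cg * Ch) * (t - s) powr (\<gamma> + \<kappa>)
      \<le> young_const (\<gamma> + \<kappa>) * (Cg * Ch) * (T powr \<gamma> * (t - s) powr \<kappa>)"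
  proof (intro mult_left_mono)
    show "(t - s) powr (\<gamma> + \<kappa>) \<le> T powr \<gamma> * (t - s) powr \<kappa>"
      using st T \<gamma> by (simp add: powr_add) (intro mult_right_mono powr_mono2, auto)
  qed (use constants young_const_nonneg[OF exponents] in auto)
  ultimately have "\<bar>rs_integral g h a t - rs_integral g h a s\<bar>
      \<le> G * (Ch * (t - s) powr \<kappa>) + young_const (\<gamma> + \<kappa>) * (Cg * Ch) * (T powr \<gamma> * (t - s) powr \<kappa>)"
    by linarith
  then show "norm (rs_integral g h a t - rs_integral g h a s)
      \<le> (G + young_const (\<gamma> + \<kappa>) * Cg * T powr \<gamma>) * Ch * (t - s) powr \<kappa>"
    by (simp add: algebra_simps)
qed

end

section \<open>Path-dependent equations driven by Lipschitz paths\<close>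

lemma holder_seminorm_le_holder_on:
  "0 \<le> C \<Longrightarrow> holder_seminorm \<gamma> T y \<le> ennreal C \<longleftrightarrow> holder_on 0 T \<gamma> C y"
  by (simp add: holder_seminorm_le_iff holder_on_def)

lemma holder_pathsI:
  assumes "y \<in> extensional {0..T}" "holder_on 0 T \<gamma> C y" "0 \<le> C"
  shows "y \<in> holder_paths \<gamma> T"
  using assms unfolding holder_paths_def holder_finite_iff holder_on_def by blast

lemma holder_pathsE:
  assumes "y \<in> holder_paths \<gamma> T"
  obtains C where "0 \<le> C" "holder_on 0 T \<gamma> C y" "y \<in> extensional {0..T}"
  using assms unfolding holder_paths_def holder_finite_iff holder_on_def by blast

lemma holder_on_component:
  fixes y :: "real \<Rightarrow> real ^ 'n"
  assumes "holder_on a b \<gamma> C y"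
  shows "holder_on a b \<gamma> C (\<lambda>t. y t $ i)"
  unfolding holder_on_def
proof (intro allI impI)
  fix s t assume st: "a \<le> s" "s < t" "t \<le> b"
  have "norm (y t $ i - y s $ i) \<le> norm (y t - y s)"
    using component_le_norm_cart[of "y t - y s" i] by simp
  also have "\<dots> \<le> C * (t - s) powr \<gamma>" using assms st unfolding holder_on_def by blast
  finally show "norm (y t $ i - y s $ i) \<le> C * (t - s) powr \<gamma>" .
qed

section \<open>Exponentially weighted Hoelder seminorms\<close>

definition rs_drive :: "(real \<Rightarrow> real ^ 'd ^ 'm) \<Rightarrow> (real \<Rightarrow> real ^ 'd) \<Rightarrow> real \<Rightarrow> real \<Rightarrow> real ^ 'm"
  where "rs_drive g x a t = (\<chi> i. \<Sum>j\<in>UNIV. rs_integral (\<lambda>s. g s $ i $ j) (\<lambda>s. x s $ j) a t)"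

text \<open>A Hoelder version of Bielecki's weighted norm. The weight sits at the right end point,
  so a bound D restricts to the ordinary Hoelder constant D * exp (\<mu> * u) on [0,u], and this is
  the quantity a coefficient at time u reacts to.\<close>

definition bielecki :: "real \<Rightarrow> real \<Rightarrow> real \<Rightarrow> real \<Rightarrow> (real \<Rightarrow> 'a::real_normed_vector) \<Rightarrow> bool"
  where "bielecki T \<alpha> \<mu> D f \<longleftrightarrow>
    (\<forall>s t. 0 \<le> s \<longrightarrow> s < t \<longrightarrow> t \<le> T \<longrightarrow> norm (f t - f s) \<le> D * exp (\<mu> * t) * (t - s) powr \<alpha>)"

lemma bielecki_imp_holder_on:
  assumes "bielecki T \<alpha> \<mu> D f" "0 \<le> D" "0 \<le> \<mu>" "u \<le> T"
  shows "holder_on 0 u \<alpha> (D * exp (\<mu> * u)) f"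
  unfolding holder_on_def
proof (intro allI impI)
  fix s t assume st: "0 \<le> s" "s < t" "t \<le> u"
  have "norm (f t - f s) \<le> D * exp (\<mu> * t) * (t - s) powr \<alpha>"
    using assms st unfolding bielecki_def by auto
  also have "\<dots> \<le> D * exp (\<mu> * u) * (t - s) powr \<alpha>"
    using assms st by (intro mult_right_mono mult_left_mono) (auto intro: mult_left_mono)
  finally show "norm (f t - f s) \<le> D * exp (\<mu> * u) * (t - s) powr \<alpha>" .
qed

lemma holder_on_imp_bielecki:
  assumes "holder_on 0 T \<alpha> D f" "0 \<le> D" "0 \<le> \<mu>"
  shows "bielecki T \<alpha> \<mu> D f"
  unfolding bielecki_def
proof (intro allI impI)
  fix s t assume st: "0 \<le> s" "s < t" "t \<le> T"
  have "norm (f t - f s) \<le> D * 1 * (t - s) powr \<alpha>"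
    using assms st unfolding holder_on_def by auto
  also have "\<dots> \<le> D * exp (\<mu> * t) * (t - s) powr \<alpha>"
    using assms st by (intro mult_right_mono mult_left_mono) auto
  finally show "norm (f t - f s) \<le> D * exp (\<mu> * t) * (t - s) powr \<alpha>" .
qed

lemma bielecki_mono:
  assumes "bielecki T \<alpha> \<mu> D f" "D \<le> D'"
  shows "bielecki T \<alpha> \<mu> D' f"
  unfolding bielecki_def
proof (intro allI impI)
  fix s t assume st: "0 \<le> s" "s < t" "t \<le> T"
  have "norm (f t - f s) \<le> D * exp (\<mu> * t) * (t - s) powr \<alpha>"
    using assms st unfolding bielecki_def by auto
  also have "\<dots> \<le> D' * exp (\<mu> * t) * (t - s) powr \<alpha>"
    using assms by (intro mult_right_mono) auto
  finally show "norm (f t - f s) \<le> D' * exp (\<mu> * t) * (t - s) powr \<alpha>" .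
qed

lemma bielecki_add:
  assumes "bielecki T \<alpha> \<mu> D f" "bielecki T \<alpha> \<mu> E g"
  shows "bielecki T \<alpha> \<mu> (D + E) (\<lambda>t. f t + g t)"
  unfolding bielecki_def
proof (intro allI impI)
  fix s t assume st: "0 \<le> s" "s < t" "t \<le> T"
  have "norm (f t + g t - (f s + g s)) \<le> norm (f t - f s) + norm (g t - g s)"
    by (rule order_trans[OF eq_refl norm_triangle_ineq]) (simp add: algebra_simps)
  also have "\<dots> \<le> D * exp (\<mu> * t) * (t - s) powr \<alpha> + E * exp (\<mu> * t) * (t - s) powr \<alpha>"
    using assms st unfolding bielecki_def by (intro add_mono) auto
  finally show "norm (f t + g t - (f s + g s)) \<le> (D + E) * exp (\<mu> * t) * (t - s) powr \<alpha>"
    by (simp add: algebra_simps)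
qed

lemma bielecki_limit:
  assumes "\<And>n. bielecki T \<alpha> \<mu> (D n) (f n)" "D \<longlonglongrightarrow> D'"
    and "\<And>t. 0 \<le> t \<Longrightarrow> t \<le> T \<Longrightarrow> (\<lambda>n. f n t) \<longlonglongrightarrow> f' t"
  shows "bielecki T \<alpha> \<mu> D' f'"
  unfolding bielecki_def
proof (intro allI impI)
  fix s t assume st: "0 \<le> s" "s < t" "t \<le> T"
  have 1: "(\<lambda>n. norm (f n t - f n s)) \<longlonglongrightarrow> norm (f' t - f' s)"
    using st by (intro tendsto_intros assms) auto
  have 2: "(\<lambda>n. D n * exp (\<mu> * t) * (t - s) powr \<alpha>) \<longlonglongrightarrow> D' * exp (\<mu> * t) * (t - s) powr \<alpha>"
    by (intro tendsto_intros assms)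
  show "norm (f' t - f' s) \<le> D' * exp (\<mu> * t) * (t - s) powr \<alpha>"
    by (rule LIMSEQ_le[OF 1 2]) (use assms(1) st in \<open>auto simp: bielecki_def\<close>)
qed

lemma tendsto_div_two_power: "(\<lambda>n. c / 2 ^ n :: real) \<longlonglongrightarrow> 0"
proof -
  have "(\<lambda>n. c * (1 / 2) ^ n) \<longlonglongrightarrow> c * 0"
    by (intro tendsto_intros LIMSEQ_power_zero) auto
  then show ?thesis by (simp add: power_divide)
qed

text \<open>Replaces a Gronwall argument.\<close>

lemma bielecki_halving:
  assumes "bielecki T \<alpha> \<mu> D0 f" "0 \<le> D0" "0 \<le> e"
    and half: "\<And>D. 0 \<le> D \<Longrightarrow> bielecki T \<alpha> \<mu> D f \<Longrightarrow> bielecki T \<alpha> \<mu> (D / 2 + e) f"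
  shows "bielecki T \<alpha> \<mu> (2 * e) f"
proof (rule bielecki_limit[where D = "\<lambda>n. D0 / 2 ^ n + 2 * e" and f = "\<lambda>_. f"])
  fix n show "bielecki T \<alpha> \<mu> (D0 / 2 ^ n + 2 * e) f"
  proof (induction n)
    case 0
    then show ?case by (rule bielecki_mono[OF assms(1)]) (use assms in auto)
  next
    case (Suc n)
    have "bielecki T \<alpha> \<mu> ((D0 / 2 ^ n + 2 * e) / 2 + e) f"
      by (rule half[OF _ Suc]) (use assms in auto)
    then show ?case by (simp add: field_simps)
  qed
next
  have "(\<lambda>n. D0 / 2 ^ n + 2 * e) \<longlonglongrightarrow> 0 + 2 * e"
    by (intro tendsto_intros tendsto_div_two_power)
  then show "(\<lambda>n. D0 / 2 ^ n + 2 * e) \<longlonglongrightarrow> 2 * e" by simp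
qed auto

text \<open>The left side is at most the minimum of a and 1, and that minimum lies below
  \<open>a powr \<alpha>\<close> when \<alpha> is between 0 and 1.\<close>

lemma one_minus_exp_le_powr:
  fixes a \<alpha> :: real
  assumes "0 \<le> a" "0 \<le> \<alpha>" "\<alpha> \<le> 1"
  shows "1 - exp (- a) \<le> a powr \<alpha>"
proof (cases "a \<le> 1")
  case True
  have "1 - exp (- a) \<le> a powr 1"
    using exp_ge_add_one_self[of "- a"] assms by simp
  also have "\<dots> \<le> a powr \<alpha>" using True assms by (intro powr_mono') auto
  finally show ?thesis .
next
  case False
  then have "1 \<le> a powr \<alpha>" using assms by (intro ge_one_powr_ge_zero) auto
  then show ?thesis by (smt (verit) exp_gt_zero)
qed

lemma has_rs_integral_exp:
  assumes "0 < \<mu>" "s \<le> t"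
  shows "has_rs_integral (\<lambda>u. exp (\<mu> * u)) (\<lambda>u. u) s t (exp (\<mu> * t) / \<mu> - exp (\<mu> * s) / \<mu>)"
proof (rule has_rs_integral_germ_powr[OF assms(2), where \<theta> = 2 and C = "\<mu> * exp (\<mu> * t)"])
  fix p u q assume u: "s \<le> p" "p \<le> u" "u \<le> q" "q \<le> t"
  define d where "d = q - p"
  have d: "0 \<le> d" using u by (simp add: d_def)
  define Ep where "Ep = exp (\<mu> * p)"
  define Eq where "Eq = exp (\<mu> * q)"
  have up: "Eq - Ep \<le> \<mu> * d * Eq"
  proof -
    have "Ep = Eq * exp (- (\<mu> * d))" by (simp add: Ep_def Eq_def d_def algebra_simps flip: exp_add)
    moreover have "Eq * (1 - \<mu> * d) \<le> Eq * exp (- (\<mu> * d))"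
      using exp_ge_add_one_self[of "- (\<mu> * d)"] by (intro mult_left_mono) (auto simp: Eq_def)
    ultimately show ?thesis by (simp add: algebra_simps)
  qed
  have lo: "\<mu> * d * Ep \<le> Eq - Ep"
  proof -
    have "Eq = Ep * exp (\<mu> * d)" by (simp add: Ep_def Eq_def d_def algebra_simps flip: exp_add)
    moreover have "Ep * (1 + \<mu> * d) \<le> Ep * exp (\<mu> * d)"
      using exp_ge_add_one_self[of "\<mu> * d"] by (intro mult_left_mono) (auto simp: Ep_def)
    ultimately show ?thesis by (simp add: algebra_simps)
  qed
  define X where "X = Eq / \<mu> - Ep / \<mu>"
  \<comment> \<open>The increment of the primitive and its germ both lie between d * Ep and d * Eq,
    so they differ by at most d * (Eq - Ep), which is of second order in d.\<close>
  have X: "d * Ep \<le> X" "X \<le> d * Eq"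
    using up lo assms(1) by (simp_all add: X_def field_simps)
  have Eu: "d * Ep \<le> d * exp (\<mu> * u)" "d * exp (\<mu> * u) \<le> d * Eq"
    using u d assms(1) by (auto simp: Ep_def Eq_def intro!: mult_left_mono)
  have "\<bar>X - d * exp (\<mu> * u)\<bar> \<le> d * (Eq - Ep)"
    using X Eu by (simp add: right_diff_distrib abs_le_iff)
  also have "\<dots> \<le> d * (\<mu> * d * Eq)" by (intro mult_left_mono up d)
  also have "\<dots> = \<mu> * Eq * d powr 2" using d by (simp add: power2_eq_square algebra_simps)
  also have "\<dots> \<le> \<mu> * exp (\<mu> * t) * d powr 2"
    using u assms(1) by (intro mult_right_mono mult_left_mono) (auto simp: Eq_def)
  finally show "\<bar>exp (\<mu> * q) / \<mu> - exp (\<mu> * p) / \<mu> - exp (\<mu> * u) * (q - p)\<bar>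
      \<le> \<mu> * exp (\<mu> * t) * (q - p) powr 2"
    by (simp add: X_def Eq_def Ep_def d_def algebra_simps)
qed auto

text \<open>Source of the contraction: integrating the weight gains
  \<open>\<mu> powr (\<alpha> - 1)\<close>, which tends to 0 for large \<mu> when \<alpha> < 1, at
  the price of measuring the result with exponent \<alpha> although it is Lipschitz.\<close>

lemma exp_increment_le:
  fixes \<mu> \<alpha> :: real
  assumes "0 < \<mu>" "s \<le> t" "0 \<le> \<alpha>" "\<alpha> \<le> 1"
  shows "exp (\<mu> * t) / \<mu> - exp (\<mu> * s) / \<mu> \<le> \<mu> powr (\<alpha> - 1) * exp (\<mu> * t) * (t - s) powr \<alpha>"
proof -
  have "exp (\<mu> * t) / \<mu> - exp (\<mu> * s) / \<mu> = exp (\<mu> * t) * (1 - exp (- (\<mu> * (t - s)))) / \<mu>"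
    by (simp add: algebra_simps diff_divide_distrib flip: exp_add)
  also have "\<dots> \<le> exp (\<mu> * t) * (\<mu> * (t - s)) powr \<alpha> / \<mu>"
    using assms by (intro divide_right_mono mult_left_mono one_minus_exp_le_powr) auto
  also have "\<dots> = (\<mu> powr \<alpha> / \<mu> powr 1) * exp (\<mu> * t) * (t - s) powr \<alpha>"
    using assms by (simp add: powr_mult)
  also have "\<mu> powr \<alpha> / \<mu> powr 1 = \<mu> powr (\<alpha> - 1)" by (simp add: powr_diff)
  finally show ?thesis .
qed

lemma contraction_rate_exists:
  fixes C \<alpha> :: real
  assumes "\<alpha> < 1"
  shows "\<exists>\<mu>\<ge>1. C * \<mu> powr (\<alpha> - 1) \<le> 1 / 2"
proof -
  define \<mu> where "\<mu> = max 1 ((2 * \<bar>C\<bar>) powr (1 / (1 - \<alpha>)))"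
  have \<mu>: "1 \<le> \<mu>" by (simp add: \<mu>_def)
  have "2 * \<bar>C\<bar> \<le> \<mu> powr (1 - \<alpha>)"
  proof -
    have "2 * \<bar>C\<bar> = ((2 * \<bar>C\<bar>) powr (1 / (1 - \<alpha>))) powr (1 - \<alpha>)"
      using assms by (simp add: powr_powr)
    also have "\<dots> \<le> \<mu> powr (1 - \<alpha>)" using assms by (intro powr_mono2) (auto simp: \<mu>_def)
    finally show ?thesis .
  qed
  then have "2 * \<bar>C\<bar> * \<mu> powr (\<alpha> - 1) \<le> \<mu> powr (1 - \<alpha>) * \<mu> powr (\<alpha> - 1)"
    by (intro mult_right_mono) auto
  also have "\<dots> = 1" using \<mu> by (simp flip: powr_add)
  finally have "\<bar>C\<bar> * \<mu> powr (\<alpha> - 1) \<le> 1 / 2" by simp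
  moreover have "C * \<mu> powr (\<alpha> - 1) \<le> \<bar>C\<bar> * \<mu> powr (\<alpha> - 1)" by (intro mult_right_mono) auto
  ultimately have "C * \<mu> powr (\<alpha> - 1) \<le> 1 / 2" by (rule order_trans[rotated])
  then show ?thesis using \<mu> by blast
qed

section \<open>Path-dependent coefficients and the paths they drive\<close>

definition driver :: "real \<Rightarrow> real \<Rightarrow> (real \<Rightarrow> real ^ 'd) \<Rightarrow> bool"
  where "driver T K x \<longleftrightarrow> 0 \<le> K \<and> (\<forall>j. holder_on 0 T 1 K (\<lambda>s. x s $ j))"

text \<open>Deliberately qualitative: it guarantees that the integrals exist. Its constant may
  depend on the path and never enters an estimate, because sizes are controlled through
  \<open>has_rs_integral_abs_le\<close>.\<close>

definition entries_holder :: "real \<Rightarrow> real \<Rightarrow> (real \<Rightarrow> real ^ 'd ^ 'm) \<Rightarrow> bool"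
  where "entries_holder T \<gamma> g \<longleftrightarrow> (\<exists>C\<ge>0. \<forall>i j. holder_on 0 T \<gamma> C (\<lambda>s. g s $ i $ j))"

text \<open>Here \<gamma> is the time regularity of coefficients along a path. The drivers are
  Lipschitz, so every positive \<gamma> satisfies Young's condition \<gamma> + 1 > 1.\<close>

locale history =
  fixes T0 T1 \<alpha> \<gamma> Bw :: real and w :: "real \<Rightarrow> real ^ 'm"
  assumes T: "0 \<le> T0" "T0 < T1" and \<alpha>: "1 / 2 < \<alpha>" "\<alpha> < 1" and \<gamma>: "0 < \<gamma>" "\<gamma> \<le> 1"
    and Bw: "0 \<le> Bw" and w: "holder_on 0 T0 \<alpha> Bw w"
begin

definition continuations :: "(real \<Rightarrow> real ^ 'm) set"
  where "continuations = {y \<in> holder_paths \<alpha> T1. \<forall>t\<in>{0..T0}. y t = w t}"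

text \<open>The distance of the paths is measured on [0,s] only, which encodes that the coefficient
  at time s depends on the past. No term for the starting values occurs, as all continuations start
  at w 0.\<close>

definition lipschitz_on_ball :: "real \<Rightarrow> real \<Rightarrow> ((real \<Rightarrow> real ^ 'm) \<Rightarrow> real \<Rightarrow> real ^ 'd ^ 'm) \<Rightarrow> bool"
  where "lipschitz_on_ball M L G \<longleftrightarrow>
    (\<forall>y\<in>continuations. \<forall>z\<in>continuations. holder_on 0 T1 \<alpha> M y \<longrightarrow> holder_on 0 T1 \<alpha> M z \<longrightarrow>
      (\<forall>s\<in>{0..T1}. \<forall>D\<ge>0. holder_on 0 s \<alpha> D (\<lambda>t. y t - z t) \<longrightarrow>
        (\<forall>i j. \<bar>G y s $ i $ j - G z s $ i $ j\<bar> \<le> L * D)))"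

text \<open>Lipschitz constants are existential and local, since those of the signature grow with
  the ball. The growth constant A is a parameter, since the a priori bounds have to be uniform over
  all coefficients with the same A.\<close>

definition coefficient :: "real \<Rightarrow> ((real \<Rightarrow> real ^ 'm) \<Rightarrow> real \<Rightarrow> real ^ 'd ^ 'm) \<Rightarrow> bool"
  where "coefficient A G \<longleftrightarrow>
    (\<forall>y\<in>continuations. entries_holder T1 \<gamma> (G y)) \<and>
    (\<forall>M. \<exists>L\<ge>0. lipschitz_on_ball M L G) \<and>
    (\<forall>y\<in>continuations. \<forall>s\<in>{0..T1}. \<forall>D\<ge>0. holder_on 0 s \<alpha> D y \<longrightarrow>
      (\<forall>i j. \<bar>G y s $ i $ j\<bar> \<le> A * (1 + D)))"

lemma young_pair_driver:
  assumes "entries_holder T1 \<gamma> g" "driver T1 K x"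
  obtains C where "young_pair T0 T1 \<gamma> 1 C K (\<lambda>s. g s $ i $ j) (\<lambda>s. x s $ j)"
proof -
  obtain C where "0 \<le> C" "\<And>i j. holder_on 0 T1 \<gamma> C (\<lambda>s. g s $ i $ j)"
    using assms unfolding entries_holder_def by blast
  then have "young_pair T0 T1 \<gamma> 1 C K (\<lambda>s. g s $ i $ j) (\<lambda>s. x s $ j)"
    using assms(2) T \<gamma> by unfold_locales (auto simp: driver_def intro: holder_on_subinterval)
  then show ?thesis by (rule that)
qed

lemma drive_start:
  fixes g :: "real \<Rightarrow> real ^ 'd ^ 'm"
  assumes "entries_holder T1 \<gamma> g" "driver T1 K x"
  shows "rs_drive g x T0 T0 = 0"
proof -
  have "rs_integral (\<lambda>s. g s $ i $ j) (\<lambda>s. x s $ j) T0 T0 = 0" for i j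
    using young_pair_driver[OF assms, of i j] young_pair.integral_self by metis
  then show ?thesis by (simp add: rs_drive_def vec_eq_iff)
qed

lemma drive_diff:
  fixes g g' :: "real \<Rightarrow> real ^ 'd ^ 'm"
  assumes g: "entries_holder T1 \<gamma> g" and g': "entries_holder T1 \<gamma> g'" and x: "driver T1 K x" and t: "t \<in> {T0..T1}"
  shows "rs_drive g x T0 t - rs_drive g' x T0 t = rs_drive (\<lambda>s. g s - g' s) x T0 t"
proof -
  have "rs_integral (\<lambda>s. g s $ i $ j) (\<lambda>s. x s $ j) T0 t - rs_integral (\<lambda>s. g' s $ i $ j) (\<lambda>s. x s $ j) T0 t =
      rs_integral (\<lambda>s. g s $ i $ j - g' s $ i $ j) (\<lambda>s. x s $ j) T0 t" for i j
  proof -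
    obtain C where C: "young_pair T0 T1 \<gamma> 1 C K (\<lambda>s. g s $ i $ j) (\<lambda>s. x s $ j)"
      using young_pair_driver[OF g x] by blast
    obtain C' where C': "young_pair T0 T1 \<gamma> 1 C' K (\<lambda>s. g' s $ i $ j) (\<lambda>s. x s $ j)"
      using young_pair_driver[OF g' x] by blast
    show ?thesis
      by (rule rs_integral_eqI[symmetric], rule has_rs_integral_diff_left)
        (use young_pair.has_integral_from_start[OF C t] young_pair.has_integral_from_start[OF C' t] in auto)
  qed
  then show ?thesis by (simp add: rs_drive_def vec_eq_iff flip: sum_subtractf)
qed

lemma entries_holder_diff:
  assumes "entries_holder T1 \<gamma> g" "entries_holder T1 \<gamma> g'"
  shows "entries_holder T1 \<gamma> (\<lambda>s. g s - g' s)"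
proof -
  obtain C where "0 \<le> C" "\<And>i j. holder_on 0 T1 \<gamma> C (\<lambda>s. g s $ i $ j)"
    using assms unfolding entries_holder_def by blast
  moreover obtain D where "0 \<le> D" "\<And>i j. holder_on 0 T1 \<gamma> D (\<lambda>s. g' s $ i $ j)"
    using assms unfolding entries_holder_def by blast
  ultimately show ?thesis
    unfolding entries_holder_def by (intro exI[of _ "C + D"]) (auto intro: holder_on_diff)
qed

lemma entries_holder_zero: "entries_holder T1 \<gamma> (\<lambda>_. 0)"
  unfolding entries_holder_def by (intro exI[of _ 0]) (auto intro: holder_on_const)

text \<open>The exponential majorant is integrated exactly and then converted by
  \<open>exp_increment_le\<close>. The cardinalities come from bounding the Euclidean norm by the
  sum of the components, each a sum over the drivers.\<close>

lemma drive_increment_bound: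
  fixes g :: "real \<Rightarrow> real ^ 'd ^ 'm"
  assumes g: "entries_holder T1 \<gamma> g" and x: "driver T1 K x" and \<mu>: "0 < \<mu>" and "0 \<le> B"
    and bound: "\<And>u i j. u \<in> {T0..T1} \<Longrightarrow> \<bar>g u $ i $ j\<bar> \<le> B * exp (\<mu> * u)"
    and st: "T0 \<le> s" "s \<le> t" "t \<le> T1"
  shows "norm (rs_drive g x T0 t - rs_drive g x T0 s)
    \<le> real CARD('m) * real CARD('d) * K * B * \<mu> powr (\<alpha> - 1) * exp (\<mu> * t) * (t - s) powr \<alpha>"
proof -
  define X where "X = \<mu> powr (\<alpha> - 1) * exp (\<mu> * t) * (t - s) powr \<alpha>"
  have K: "0 \<le> K" using x by (simp add: driver_def)
  have entry: "\<bar>rs_integral (\<lambda>s. g s $ i $ j) (\<lambda>s. x s $ j) T0 t - rs_integral (\<lambda>s. g s $ i $ j) (\<lambda>s. x s $ j) T0 s\<bar>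
      \<le> K * (B * X)" for i j
  proof -
    obtain C where C: "young_pair T0 T1 \<gamma> 1 C K (\<lambda>s. g s $ i $ j) (\<lambda>s. x s $ j)"
      using young_pair_driver[OF g x] by blast
    have J: "has_rs_integral (\<lambda>u. B * exp (\<mu> * u)) (\<lambda>u. u) s t (B * (exp (\<mu> * t) / \<mu> - exp (\<mu> * s) / \<mu>))"
      using has_rs_integral_linear_left[OF has_rs_integral_exp[OF \<mu> st(2)] has_rs_integral_exp[OF \<mu> st(2)], of B 0]
      by simp
    have "\<bar>rs_integral (\<lambda>s. g s $ i $ j) (\<lambda>s. x s $ j) T0 t - rs_integral (\<lambda>s. g s $ i $ j) (\<lambda>s. x s $ j) T0 s\<bar>
        \<le> K * (B * (exp (\<mu> * t) / \<mu> - exp (\<mu> * s) / \<mu>))"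
    proof (rule has_rs_integral_abs_le[OF young_pair.has_integral[OF C st] J _ _ K])
      fix u assume "u \<in> {s..t}"
      then show "\<bar>g u $ i $ j\<bar> \<le> B * exp (\<mu> * u)" using bound st by auto
    next
      fix p q assume pq: "s \<le> p" "p \<le> q" "q \<le> t"
      have h: "holder_on 0 T1 1 K (\<lambda>s. x s $ j)" using x by (simp add: driver_def)
      show "\<bar>x q $ j - x p $ j\<bar> \<le> K * (q - p)"
        using holder_onD[OF h, of p q] pq st T by simp
    qed
    also have "\<dots> \<le> K * (B * X)"
      unfolding X_def using K \<open>0 \<le> B\<close> st \<alpha> by (intro mult_left_mono exp_increment_le \<mu>) auto
    finally show ?thesis .
  qed
  have "norm (rs_drive g x T0 t - rs_drive g x T0 s) \<le>
      (\<Sum>i\<in>UNIV. \<bar>(rs_drive g x T0 t - rs_drive g x T0 s) $ i\<bar>)" by (rule norm_le_l1_cart)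
  also have "\<dots> \<le> (\<Sum>i\<in>(UNIV::'m set). real CARD('d) * (K * (B * X)))"
  proof (rule sum_mono)
    fix i :: 'm
    have "\<bar>(rs_drive g x T0 t - rs_drive g x T0 s) $ i\<bar> =
        \<bar>\<Sum>j\<in>UNIV. rs_integral (\<lambda>s. g s $ i $ j) (\<lambda>s. x s $ j) T0 t - rs_integral (\<lambda>s. g s $ i $ j) (\<lambda>s. x s $ j) T0 s\<bar>"
      by (simp add: rs_drive_def sum_subtractf)
    also have "\<dots> \<le> (\<Sum>j\<in>(UNIV::'d set). K * (B * X))"
      by (rule order_trans[OF sum_abs], rule sum_mono, rule entry)
    finally show "\<bar>(rs_drive g x T0 t - rs_drive g x T0 s) $ i\<bar> \<le> real CARD('d) * (K * (B * X))" by simp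
  qed
  finally show ?thesis by (simp add: X_def algebra_simps)
qed

text \<open>The difference vanishes up to T0 and is driven by g - g' afterwards. For an interval
  that straddles T0 the left end point may be moved to T0 without changing the increment, and this
  only shortens the interval.\<close>

lemma driven_paths_diff:
  fixes g g' :: "real \<Rightarrow> real ^ 'd ^ 'm"
  assumes g: "entries_holder T1 \<gamma> g" and g': "entries_holder T1 \<gamma> g'" and x: "driver T1 K x"
    and \<mu>: "0 < \<mu>" and B: "0 \<le> B"
    and bound: "\<And>u i j. u \<in> {T0..T1} \<Longrightarrow> \<bar>g u $ i $ j - g' u $ i $ j\<bar> \<le> B * exp (\<mu> * u)"
    and past: "\<And>t. t \<in> {0..T0} \<Longrightarrow> p t = q t"
    and p: "\<And>t. t \<in> {T0..T1} \<Longrightarrow> p t = v + rs_drive g x T0 t"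
    and q: "\<And>t. t \<in> {T0..T1} \<Longrightarrow> q t = v + rs_drive g' x T0 t"
  shows "bielecki T1 \<alpha> \<mu> (real CARD('m) * real CARD('d) * K * B * \<mu> powr (\<alpha> - 1)) (\<lambda>t. p t - q t)"
  unfolding bielecki_def
proof (intro allI impI)
  fix s t assume st: "0 \<le> s" "s < t" "t \<le> T1"
  define C where "C = real CARD('m) * real CARD('d) * K * B * \<mu> powr (\<alpha> - 1)"
  have C: "0 \<le> C" using x B by (simp add: C_def driver_def)
  have d: "p u - q u = rs_drive (\<lambda>s. g s - g' s) x T0 u" if "u \<in> {T0..T1}" for u
    using drive_diff[OF g g' x that] p[OF that] q[OF that] by simp
  have after: "norm ((p t - q t) - (p s - q s)) \<le> C * exp (\<mu> * t) * (t - s) powr \<alpha>"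
    if "T0 \<le> s" "s \<le> t" "t \<le> T1" for s t
  proof -
    have "norm (rs_drive (\<lambda>s. g s - g' s) x T0 t - rs_drive (\<lambda>s. g s - g' s) x T0 s)
      \<le> real CARD('m) * real CARD('d) * K * B * \<mu> powr (\<alpha> - 1) * exp (\<mu> * t) * (t - s) powr \<alpha>"
      by (rule drive_increment_bound[OF entries_holder_diff[OF g g'] x \<mu> B _ that]) (use bound in auto)
    then show ?thesis using that by (simp add: d C_def)
  qed
  consider "t \<le> T0" | "T0 \<le> s" | "s < T0" "T0 < t" by linarith
  then have "norm ((p t - q t) - (p s - q s)) \<le> C * exp (\<mu> * t) * (t - s) powr \<alpha>"
  proof cases
    case 1
    then show ?thesis using past[of s] past[of t] st C by simp
  next
    case 2
    then show ?thesis using after st by simp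
  next
    case 3
    have "norm ((p t - q t) - (p s - q s)) = norm ((p t - q t) - (p T0 - q T0))"
      using past[of s] past[of T0] st 3 T by simp
    also have "\<dots> \<le> C * exp (\<mu> * t) * (t - T0) powr \<alpha>" using 3 st by (intro after) auto
    also have "\<dots> \<le> C * exp (\<mu> * t) * (t - s) powr \<alpha>"
      using 3 C \<alpha> by (intro mult_left_mono powr_mono2) auto
    finally show ?thesis .
  qed
  then show "norm ((p t - q t) - (p s - q s))
      \<le> real CARD('m) * real CARD('d) * K * B * \<mu> powr (\<alpha> - 1) * exp (\<mu> * t) * (t - s) powr \<alpha>"
    by (simp add: C_def)
qed

lemma frozen_history_holder: "holder_on 0 T1 \<alpha> Bw (\<lambda>t. w (min t T0))"
  unfolding holder_on_def
proof (intro allI impI)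
  fix s t assume st: "0 \<le> s" "s < t" "t \<le> T1"
  have "norm (w (min t T0) - w (min s T0)) \<le> Bw * (min t T0 - min s T0) powr \<alpha>"
    using st T by (intro holder_onD[OF w]) auto
  also have "\<dots> \<le> Bw * (t - s) powr \<alpha>"
    using st Bw \<alpha> by (intro mult_left_mono powr_mono2) auto
  finally show "norm (w (min t T0) - w (min s T0)) \<le> Bw * (t - s) powr \<alpha>" .
qed

text \<open>Comparison with the path driven by the zero coefficient, which is the history frozen at
  time T0 and has Hoelder constant Bw.\<close>

lemma driven_path_bound:
  fixes g :: "real \<Rightarrow> real ^ 'd ^ 'm"
  assumes g: "entries_holder T1 \<gamma> g" and x: "driver T1 K x" and \<mu>: "0 < \<mu>" and B: "0 \<le> B"
    and bound: "\<And>u i j. u \<in> {T0..T1} \<Longrightarrow> \<bar>g u $ i $ j\<bar> \<le> B * exp (\<mu> * u)"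
    and past: "\<And>t. t \<in> {0..T0} \<Longrightarrow> p t = w t"
    and p: "\<And>t. t \<in> {T0..T1} \<Longrightarrow> p t = w T0 + rs_drive g x T0 t"
  shows "bielecki T1 \<alpha> \<mu> (real CARD('m) * real CARD('d) * K * B * \<mu> powr (\<alpha> - 1) + Bw) p"
proof -
  have z: "rs_drive (\<lambda>_. 0 :: real ^ 'd ^ 'm) x T0 t = 0" if "t \<in> {T0..T1}" for t
    using drive_diff[OF entries_holder_zero entries_holder_zero x that] by simp
  have "bielecki T1 \<alpha> \<mu> (real CARD('m) * real CARD('d) * K * B * \<mu> powr (\<alpha> - 1)) (\<lambda>t. p t - w (min t T0))"
    by (rule driven_paths_diff[OF g entries_holder_zero x \<mu> B _ _ p])
      (use bound past z in \<open>auto simp: min_def\<close>)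
  from bielecki_add[OF this holder_on_imp_bielecki[OF frozen_history_holder Bw]] \<mu>
  show ?thesis by simp
qed

lemma coefficient_entries_holder:
  "coefficient A G \<Longrightarrow> y \<in> continuations \<Longrightarrow> entries_holder T1 \<gamma> (G y)"
  by (simp add: coefficient_def)

lemma lipschitz_on_ballD:
  assumes "lipschitz_on_ball M L G" "y \<in> continuations" "z \<in> continuations"
    "holder_on 0 T1 \<alpha> M y" "holder_on 0 T1 \<alpha> M z" "s \<in> {0..T1}" "0 \<le> D"
    "holder_on 0 s \<alpha> D (\<lambda>t. y t - z t)"
  shows "\<bar>G y s $ i $ j - G z s $ i $ j\<bar> \<le> L * D"
  using assms by (simp add: lipschitz_on_ball_def)

lemma coefficient_lipschitz:
  assumes "coefficient A G"
  obtains L where "0 \<le> L" "lipschitz_on_ball M L G"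
proof -
  have "\<exists>L\<ge>0. lipschitz_on_ball M L G" using assms by (simp add: coefficient_def)
  then show ?thesis using that by blast
qed

lemma coefficient_growth:
  assumes "coefficient A G" "y \<in> continuations" "s \<in> {0..T1}" "0 \<le> D" "holder_on 0 s \<alpha> D y"
  shows "\<bar>G y s $ i $ j\<bar> \<le> A * (1 + D)"
  using assms by (simp add: coefficient_def)

text \<open>Hoelder entries make all the integrals exist, so the notion of solution reduces to a
  fixed-point equation, the form in which Picard iteration and the estimates use it.\<close>

lemma is_solution_iff:
  fixes G :: "(real \<Rightarrow> real ^ 'm) \<Rightarrow> real \<Rightarrow> real ^ 'd ^ 'm"
  assumes "coefficient A G" "driver T1 K x"
  shows "is_solution T0 T1 \<alpha> w G x y \<longleftrightarrow>
    y \<in> continuations \<and> (\<forall>t\<in>{T0..T1}. y t = w T0 + rs_drive (G y) x T0 t)" (is "?L \<longleftrightarrow> ?R")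
proof
  assume ?L then show ?R
    by (auto simp: is_solution_def continuations_def rs_drive_def vec_eq_iff)
next
  assume R: ?R
  have "rs_integrable (\<lambda>s. G y s $ i $ j) (\<lambda>s. x s $ j) T0 t" if "t \<in> {T0..T1}" for t i j
  proof -
    obtain C where C: "young_pair T0 T1 \<gamma> 1 C K (\<lambda>s. G y s $ i $ j) (\<lambda>s. x s $ j)"
      using young_pair_driver[OF coefficient_entries_holder[OF assms(1)] assms(2)] R by blast
    show ?thesis using young_pair.integrable[OF C] that by auto
  qed
  with R show ?L
    by (auto simp: is_solution_def continuations_def rs_drive_def vec_eq_iff)
qed

end

section \<open>A priori bound, stability and well-posedness\<close>

context history
begin

text \<open>p is the Picard image of y. The map D -> D / 2 + (1 / 2 + Bw) has the fixed point 1 + 2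
  * Bw, so the weighted ball of that radius is invariant; \<mu> is tied to A and K but to no
  Lipschitz constant. The constant part of the growth is absorbed by 1 \<le> exp (\<mu> *
  u).\<close>

lemma a_priori_bound:
  fixes G :: "(real \<Rightarrow> real ^ 'm) \<Rightarrow> real \<Rightarrow> real ^ 'd ^ 'm"
  assumes \<mu>: "0 < \<mu>" and rate: "real CARD('m) * real CARD('d) * K * A * \<mu> powr (\<alpha> - 1) \<le> 1 / 2" and "0 \<le> A"
    and G: "coefficient A G" and x: "driver T1 K x" and y: "y \<in> continuations"
    and D: "0 \<le> D" "bielecki T1 \<alpha> \<mu> D y"
    and past: "\<And>t. t \<in> {0..T0} \<Longrightarrow> p t = w t"
    and p: "\<And>t. t \<in> {T0..T1} \<Longrightarrow> p t = w T0 + rs_drive (G y) x T0 t"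
  shows "bielecki T1 \<alpha> \<mu> (D / 2 + (1 / 2 + Bw)) p"
proof -
  have bound: "\<bar>G y u $ i $ j\<bar> \<le> (A * (1 + D)) * exp (\<mu> * u)" if u: "u \<in> {T0..T1}" for u i j
  proof -
    have "holder_on 0 u \<alpha> (D * exp (\<mu> * u)) y"
      using bielecki_imp_holder_on[OF D(2,1)] \<mu> u by auto
    then have "\<bar>G y u $ i $ j\<bar> \<le> A * (1 + D * exp (\<mu> * u))"
      using coefficient_growth[OF G y] u T D by auto
    also have "\<dots> \<le> A * (exp (\<mu> * u) + D * exp (\<mu> * u))"
      using \<open>0 \<le> A\<close> \<mu> u T by (intro mult_left_mono add_right_mono) auto
    finally show ?thesis by (simp add: algebra_simps)
  qed
  have "bielecki T1 \<alpha> \<mu> (real CARD('m) * real CARD('d) * K * (A * (1 + D)) * \<mu> powr (\<alpha> - 1) + Bw) p"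
    by (rule driven_path_bound[OF coefficient_entries_holder[OF G y] x \<mu> _ bound past p])
      (use \<open>0 \<le> A\<close> D in auto)
  moreover have "(real CARD('m) * real CARD('d) * K * A * \<mu> powr (\<alpha> - 1)) * (1 + D) \<le> 1 / 2 * (1 + D)"
    using rate D by (intro mult_right_mono) auto
  then have "real CARD('m) * real CARD('d) * K * (A * (1 + D)) * \<mu> powr (\<alpha> - 1) \<le> 1 / 2 * (1 + D)"
    by (simp only: ac_simps)
  ultimately show ?thesis by (elim bielecki_mono) (simp add: field_simps)
qed

text \<open>Split at G z: the Lipschitz property of G controls G y - G z and costs D / 2, while
  \<epsilon> controls G z - H z. With H = G and \<epsilon> = 0 this is the Picard contraction, with
  p = y and q = z it is stability of solutions under a change of the coefficient.\<close>

lemma contraction: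
  fixes G :: "(real \<Rightarrow> real ^ 'm) \<Rightarrow> real \<Rightarrow> real ^ 'd ^ 'm"
  assumes \<mu>: "1 \<le> \<mu>" and rate: "real CARD('m) * real CARD('d) * K * L * \<mu> powr (\<alpha> - 1) \<le> 1 / 2"
    and L: "0 \<le> L" "lipschitz_on_ball M L G"
    and gy: "entries_holder T1 \<gamma> (G y)" and hz: "entries_holder T1 \<gamma> (H z)"
    and x: "driver T1 K x" and y: "y \<in> continuations" "holder_on 0 T1 \<alpha> M y"
    and z: "z \<in> continuations" "holder_on 0 T1 \<alpha> M z"
    and D: "0 \<le> D" "bielecki T1 \<alpha> \<mu> D (\<lambda>t. y t - z t)" and "0 \<le> \<epsilon>"
    and GH: "\<And>u i j. u \<in> {T0..T1} \<Longrightarrow> \<bar>G z u $ i $ j - H z u $ i $ j\<bar> \<le> \<epsilon>"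
    and past: "\<And>t. t \<in> {0..T0} \<Longrightarrow> p t = q t"
    and p: "\<And>t. t \<in> {T0..T1} \<Longrightarrow> p t = v + rs_drive (G y) x T0 t"
    and q: "\<And>t. t \<in> {T0..T1} \<Longrightarrow> q t = v + rs_drive (H z) x T0 t"
  shows "bielecki T1 \<alpha> \<mu> (D / 2 + real CARD('m) * real CARD('d) * K * \<epsilon>) (\<lambda>t. p t - q t)"
proof -
  have K: "0 \<le> K" using x by (simp add: driver_def)
  have bound: "\<bar>G y u $ i $ j - H z u $ i $ j\<bar> \<le> (L * D + \<epsilon>) * exp (\<mu> * u)" if u: "u \<in> {T0..T1}" for u i j
  proof -
    have "holder_on 0 u \<alpha> (D * exp (\<mu> * u)) (\<lambda>t. y t - z t)"
      using bielecki_imp_holder_on[OF D(2,1)] \<mu> u by auto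
    then have "\<bar>G y u $ i $ j - G z u $ i $ j\<bar> \<le> L * (D * exp (\<mu> * u))"
      using u T D by (intro lipschitz_on_ballD[OF L(2) y(1) z(1) y(2) z(2)]) auto
    moreover have "\<bar>G z u $ i $ j - H z u $ i $ j\<bar> \<le> \<epsilon> * 1" using GH[OF u] by simp
    moreover have "\<epsilon> * 1 \<le> \<epsilon> * exp (\<mu> * u)"
      using \<open>0 \<le> \<epsilon>\<close> \<mu> u T by (intro mult_left_mono) auto
    ultimately have "\<bar>G y u $ i $ j - H z u $ i $ j\<bar> \<le> L * (D * exp (\<mu> * u)) + \<epsilon> * exp (\<mu> * u)"
      by linarith
    then show ?thesis by (simp add: algebra_simps)
  qed
  have "bielecki T1 \<alpha> \<mu> (real CARD('m) * real CARD('d) * K * (L * D + \<epsilon>) * \<mu> powr (\<alpha> - 1)) (\<lambda>t. p t - q t)"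
    by (rule driven_paths_diff[OF gy hz x _ _ bound past p q]) (use \<mu> L(1) D \<open>0 \<le> \<epsilon>\<close> in auto)
  moreover have "real CARD('m) * real CARD('d) * K * (L * D + \<epsilon>) * \<mu> powr (\<alpha> - 1) =
      (real CARD('m) * real CARD('d) * K * L * \<mu> powr (\<alpha> - 1)) * D + real CARD('m) * real CARD('d) * K * \<epsilon> * \<mu> powr (\<alpha> - 1)"
    by (simp add: algebra_simps)
  moreover have "(real CARD('m) * real CARD('d) * K * L * \<mu> powr (\<alpha> - 1)) * D \<le> 1 / 2 * D"
    using rate D by (intro mult_right_mono) auto
  moreover have "real CARD('m) * real CARD('d) * K * \<epsilon> * \<mu> powr (\<alpha> - 1) \<le> real CARD('m) * real CARD('d) * K * \<epsilon> * 1"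
  proof (intro mult_left_mono)
    have "\<mu> powr (\<alpha> - 1) \<le> \<mu> powr 0" using \<mu> \<alpha> by (intro powr_mono) auto
    then show "\<mu> powr (\<alpha> - 1) \<le> 1" using \<mu> by simp
  qed (use K \<open>0 \<le> \<epsilon>\<close> in auto)
  ultimately show ?thesis by (elim bielecki_mono) linarith
qed

lemma continuation_start: "y \<in> continuations \<Longrightarrow> y 0 = w 0"
  using T by (simp add: continuations_def)

lemma bielecki_zero_imp_eq:
  assumes "bielecki T1 \<alpha> \<mu> 0 (\<lambda>t. y t - z t)" "y \<in> continuations" "z \<in> continuations"
  shows "y = z"
proof -
  have "y t = z t" if t: "t \<in> {0..T1}" for t
  proof (cases "t = 0")
    case False
    then have "norm ((y t - z t) - (y 0 - z 0)) \<le> 0 * exp (\<mu> * t) * (t - 0) powr \<alpha>"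
      using assms(1) t unfolding bielecki_def by auto
    then show ?thesis using continuation_start[OF assms(2)] continuation_start[OF assms(3)] by simp
  qed (use continuation_start[OF assms(2)] continuation_start[OF assms(3)] in simp)
  then show ?thesis
    using assms(2,3) by (auto simp: continuations_def holder_paths_def intro: extensionalityI)
qed

lemma continuation_holderE:
  assumes "y \<in> continuations"
  obtains C where "0 \<le> C" "holder_on 0 T1 \<alpha> C y"
proof -
  have "y \<in> holder_paths \<alpha> T1" using assms by (simp add: continuations_def)
  then show ?thesis by (rule holder_pathsE) (rule that)
qed

text \<open>Only the growth constant enters the choice of \<mu>, so M depends on G through A alone.
  This uniformity allows the ball to be fixed before the signature coefficient is known.\<close>

lemma solution_bound:
  assumes "0 \<le> A" "0 \<le> K"
  shows "\<exists>M\<ge>0. \<forall>(G :: (real \<Rightarrow> real ^ 'm) \<Rightarrow> real \<Rightarrow> real ^ 'd ^ 'm) x y.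
    coefficient A G \<longrightarrow> driver T1 K x \<longrightarrow> is_solution T0 T1 \<alpha> w G x y \<longrightarrow> holder_on 0 T1 \<alpha> M y"
proof -
  obtain \<mu> where \<mu>: "1 \<le> \<mu>" "real CARD('m) * real CARD('d) * K * A * \<mu> powr (\<alpha> - 1) \<le> 1 / 2"
    using contraction_rate_exists[OF \<alpha>(2)] by blast
  define M where "M = 2 * (1 / 2 + Bw) * exp (\<mu> * T1)"
  have "holder_on 0 T1 \<alpha> M y"
    if G: "coefficient A G" and x: "driver T1 K x" and sol: "is_solution T0 T1 \<alpha> w G x y"
    for G :: "(real \<Rightarrow> real ^ 'm) \<Rightarrow> real \<Rightarrow> real ^ 'd ^ 'm" and x y
  proof -
    have y: "y \<in> continuations" and eq: "\<And>t. t \<in> {T0..T1} \<Longrightarrow> y t = w T0 + rs_drive (G y) x T0 t"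
      using sol is_solution_iff[OF G x] by auto
    obtain C where C: "0 \<le> C" "holder_on 0 T1 \<alpha> C y" using continuation_holderE[OF y] .
    have "bielecki T1 \<alpha> \<mu> (2 * (1 / 2 + Bw)) y"
    proof (rule bielecki_halving[OF holder_on_imp_bielecki[OF C(2,1)] C(1)])
      fix D assume D: "0 \<le> D" "bielecki T1 \<alpha> \<mu> D y"
      show "bielecki T1 \<alpha> \<mu> (D / 2 + (1 / 2 + Bw)) y"
        by (rule a_priori_bound[where p = y, OF _ \<mu>(2) assms(1) G x y D _ eq])
          (use \<mu> y in \<open>auto simp: continuations_def\<close>)
    qed (use \<mu> Bw in auto)
    from bielecki_imp_holder_on[OF this] show ?thesis
      using Bw \<mu> by (simp add: M_def)
  qed
  then show ?thesis using Bw by (intro exI[of _ M]) (auto simp: M_def)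
qed

text \<open>C is fixed before H: the Lipschitz constant used is that of G, and the two coefficients
  are compared along the solution z of the H-equation alone.\<close>

lemma solution_comparison:
  fixes G :: "(real \<Rightarrow> real ^ 'm) \<Rightarrow> real \<Rightarrow> real ^ 'd ^ 'm"
  assumes G: "coefficient A G" and K: "0 \<le> K"
  shows "\<exists>C\<ge>0. \<forall>A' (H :: (real \<Rightarrow> real ^ 'm) \<Rightarrow> real \<Rightarrow> real ^ 'd ^ 'm) x y z \<epsilon>. coefficient A' H \<longrightarrow>
    driver T1 K x \<longrightarrow> is_solution T0 T1 \<alpha> w G x y \<longrightarrow> is_solution T0 T1 \<alpha> w H x z \<longrightarrow>
    holder_on 0 T1 \<alpha> M y \<longrightarrow> holder_on 0 T1 \<alpha> M z \<longrightarrow> 0 \<le> \<epsilon> \<longrightarrow>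
    (\<forall>u\<in>{T0..T1}. \<forall>i j. \<bar>G z u $ i $ j - H z u $ i $ j\<bar> \<le> \<epsilon>) \<longrightarrow>
    holder_on 0 T1 \<alpha> (C * \<epsilon>) (\<lambda>t. y t - z t)"
proof -
  obtain L where L: "0 \<le> L" "lipschitz_on_ball M L G"
    by (rule coefficient_lipschitz[OF G, of M]) (rule that)
  obtain \<mu> where \<mu>: "1 \<le> \<mu>" "real CARD('m) * real CARD('d) * K * L * \<mu> powr (\<alpha> - 1) \<le> 1 / 2"
    using contraction_rate_exists[OF \<alpha>(2)] by blast
  define C where "C = 2 * (real CARD('m) * real CARD('d) * K) * exp (\<mu> * T1)"
  have "holder_on 0 T1 \<alpha> (C * \<epsilon>) (\<lambda>t. y t - z t)"
    if H: "coefficient A' H" and x: "driver T1 K x" and y: "is_solution T0 T1 \<alpha> w G x y"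
      and z: "is_solution T0 T1 \<alpha> w H x z" and yM: "holder_on 0 T1 \<alpha> M y" and zM: "holder_on 0 T1 \<alpha> M z"
      and \<epsilon>: "0 \<le> \<epsilon>" and GH: "\<forall>u\<in>{T0..T1}. \<forall>i j. \<bar>G z u $ i $ j - H z u $ i $ j\<bar> \<le> \<epsilon>"
    for A' x y z \<epsilon> and H :: "(real \<Rightarrow> real ^ 'm) \<Rightarrow> real \<Rightarrow> real ^ 'd ^ 'm"
  proof -
    have y': "y \<in> continuations" and yeq: "\<And>t. t \<in> {T0..T1} \<Longrightarrow> y t = w T0 + rs_drive (G y) x T0 t"
      using y is_solution_iff[OF G x] by auto
    have z': "z \<in> continuations" and zeq: "\<And>t. t \<in> {T0..T1} \<Longrightarrow> z t = w T0 + rs_drive (H z) x T0 t"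
      using z is_solution_iff[OF H x] by auto
    define e where "e = real CARD('m) * real CARD('d) * K * \<epsilon>"
    have e: "0 \<le> e" using K \<epsilon> by (simp add: e_def)
    have GH': "\<And>u i j. u \<in> {T0..T1} \<Longrightarrow> \<bar>G z u $ i $ j - H z u $ i $ j\<bar> \<le> \<epsilon>" using GH by blast
    have past: "\<And>t. t \<in> {0..T0} \<Longrightarrow> y t = z t" using y' z' by (simp add: continuations_def)
    obtain C1 where C1: "0 \<le> C1" "holder_on 0 T1 \<alpha> C1 y" using continuation_holderE[OF y'] .
    obtain C2 where C2: "0 \<le> C2" "holder_on 0 T1 \<alpha> C2 z" using continuation_holderE[OF z'] .
    have 0: "bielecki T1 \<alpha> \<mu> (C1 + C2) (\<lambda>t. y t - z t)"
      by (rule holder_on_imp_bielecki[OF holder_on_diff[OF C1(2) C2(2)]]) (use C1 C2 \<mu> in auto)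
    have "bielecki T1 \<alpha> \<mu> (2 * e) (\<lambda>t. y t - z t)"
    proof (rule bielecki_halving[OF 0 _ e])
      show "0 \<le> C1 + C2" using C1 C2 by simp
      fix D assume D: "0 \<le> D" "bielecki T1 \<alpha> \<mu> D (\<lambda>t. y t - z t)"
      show "bielecki T1 \<alpha> \<mu> (D / 2 + e) (\<lambda>t. y t - z t)"
        unfolding e_def
        by (rule contraction[where G = G and H = H and y = y and z = z and p = y and q = z and v = "w T0", OF \<mu> L coefficient_entries_holder[OF G y'] coefficient_entries_holder[OF H z']
              x y' yM z' zM D \<epsilon> GH' past yeq zeq])
    qed
    from bielecki_imp_holder_on[OF this, of T1] show ?thesis
      using e \<mu> by (simp add: C_def e_def algebra_simps)
  qed
  moreover have "0 \<le> C" using K by (simp add: C_def)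
  ultimately show ?thesis by blast
qed

text \<open>Stability with H = G and \<epsilon> = 0, on a ball large enough for both
  solutions.\<close>

lemma solution_unique:
  fixes G :: "(real \<Rightarrow> real ^ 'm) \<Rightarrow> real \<Rightarrow> real ^ 'd ^ 'm"
  assumes G: "coefficient A G" and x: "driver T1 K x"
    and y: "is_solution T0 T1 \<alpha> w G x y" and z: "is_solution T0 T1 \<alpha> w G x z"
  shows "y = z"
proof -
  have W: "y \<in> continuations" "z \<in> continuations" using y z is_solution_iff[OF G x] by auto
  obtain C1 where C1: "0 \<le> C1" "holder_on 0 T1 \<alpha> C1 y" using continuation_holderE[OF W(1)] .
  obtain C2 where C2: "0 \<le> C2" "holder_on 0 T1 \<alpha> C2 z" using continuation_holderE[OF W(2)] .
  have yM: "holder_on 0 T1 \<alpha> (max C1 C2) y" by (rule holder_on_mono[OF C1(2)]) auto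
  have zM: "holder_on 0 T1 \<alpha> (max C1 C2) z" by (rule holder_on_mono[OF C2(2)]) auto
  have "0 \<le> K" using x by (simp add: driver_def)
  from solution_comparison[OF G this, of "max C1 C2"]
  obtain C where "0 \<le> C" and C: "\<forall>A' (H :: (real \<Rightarrow> real ^ 'm) \<Rightarrow> real \<Rightarrow> real ^ 'd ^ 'm) x y z \<epsilon>. coefficient A' H \<longrightarrow>
    driver T1 K x \<longrightarrow> is_solution T0 T1 \<alpha> w G x y \<longrightarrow> is_solution T0 T1 \<alpha> w H x z \<longrightarrow>
    holder_on 0 T1 \<alpha> (max C1 C2) y \<longrightarrow> holder_on 0 T1 \<alpha> (max C1 C2) z \<longrightarrow> 0 \<le> \<epsilon> \<longrightarrow>
    (\<forall>u\<in>{T0..T1}. \<forall>i j. \<bar>G z u $ i $ j - H z u $ i $ j\<bar> \<le> \<epsilon>) \<longrightarrow>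
    holder_on 0 T1 \<alpha> (C * \<epsilon>) (\<lambda>t. y t - z t)" by blast
  have "holder_on 0 T1 \<alpha> (C * 0) (\<lambda>t. y t - z t)"
    by (rule C[rule_format, OF G x y z yM zM]) auto
  then have "bielecki T1 \<alpha> 0 0 (\<lambda>t. y t - z t)"
    by (intro holder_on_imp_bielecki) auto
  then show ?thesis using bielecki_zero_imp_eq W by blast
qed

lemma convergent_geometric:
  fixes X :: "nat \<Rightarrow> 'a::banach"
  assumes "\<And>n. norm (X (Suc n) - X n) \<le> C / 2 ^ n"
  shows "convergent X"
proof -
  have "summable (\<lambda>n. X (Suc n) - X n)"
  proof (rule summable_comparison_test)
    show "\<exists>N. \<forall>n\<ge>N. norm (X (Suc n) - X n) \<le> C * (1 / 2) ^ n"
      using assms by (simp add: power_divide)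
    show "summable (\<lambda>n. C * (1 / 2) ^ n)"
      by (intro summable_mult summable_geometric) auto
  qed
  then have "(\<lambda>n. X n - X 0) \<longlonglongrightarrow> suminf (\<lambda>k. X (Suc k) - X k)"
    using summable_LIMSEQ[of "\<lambda>n. X (Suc n) - X n"] by (simp add: sum_lessThan_telescope)
  from tendsto_add[OF this tendsto_const[of "X 0"]] show ?thesis
    by (auto simp: convergent_def)
qed

text \<open>Two weights are needed in succession. \<mu> makes a ball invariant and thereby fixes the
  radius M; only then is the Lipschitz constant L on that ball known, and \<nu> is chosen to make
  the iteration contract on it.\<close>

lemma solution_exists:
  fixes G :: "(real \<Rightarrow> real ^ 'm) \<Rightarrow> real \<Rightarrow> real ^ 'd ^ 'm"
  assumes G: "coefficient A G" and A: "0 \<le> A" and x: "driver T1 K x"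
  shows "\<exists>y. is_solution T0 T1 \<alpha> w G x y"
proof -
  obtain \<mu> where \<mu>: "1 \<le> \<mu>" "real CARD('m) * real CARD('d) * K * A * \<mu> powr (\<alpha> - 1) \<le> 1 / 2"
    using contraction_rate_exists[OF \<alpha>(2)] by blast
  define R where "R = 2 * (1 / 2 + Bw)"
  have R: "0 \<le> R" "Bw \<le> R" "R / 2 + (1 / 2 + Bw) = R" using Bw by (auto simp: R_def field_simps)
  define M where "M = R * exp (\<mu> * T1)"
  define P where "P = (\<lambda>y. y \<in> continuations \<and> bielecki T1 \<alpha> \<mu> R y)"
  have PM: "holder_on 0 T1 \<alpha> M y" if "P y" for y
    using bielecki_imp_holder_on[of T1 \<alpha> \<mu> R y T1] that R \<mu> by (simp add: P_def M_def)
  \<comment> \<open>The Picard map, restricted so as to be extensional. At T0 both branches agree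
    because the integral over a point vanishes.\<close>
  define \<Phi> where "\<Phi> = (\<lambda>y. restrict (\<lambda>t. if t \<le> T0 then w t else w T0 + rs_drive (G y) x T0 t) {0..T1})"
  have past: "\<Phi> y t = w t" if "t \<in> {0..T0}" for y t using that T by (simp add: \<Phi>_def)
  have eq: "\<Phi> y t = w T0 + rs_drive (G y) x T0 t" if "y \<in> continuations" "t \<in> {T0..T1}" for y t
    using that T drive_start[OF coefficient_entries_holder[OF G that(1)] x] by (cases "t = T0") (auto simp: \<Phi>_def)
  have P\<Phi>: "P (\<Phi> y)" if y: "P y" for y
  proof -
    have yc: "y \<in> continuations" and yb: "bielecki T1 \<alpha> \<mu> R y" using y by (auto simp: P_def)
    have b: "bielecki T1 \<alpha> \<mu> R (\<Phi> y)"
      using a_priori_bound[OF _ \<mu>(2) A G x yc R(1) yb past eq[OF yc]] \<mu> R(3) by simp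
    have "holder_on 0 T1 \<alpha> (R * exp (\<mu> * T1)) (\<Phi> y)"
      using b R \<mu> by (intro bielecki_imp_holder_on) auto
    then have "\<Phi> y \<in> holder_paths \<alpha> T1"
      by (rule holder_pathsI[rotated]) (use R in \<open>auto simp: \<Phi>_def\<close>)
    then show ?thesis using b past by (simp add: P_def continuations_def)
  qed
  define y0 where "y0 = restrict (\<lambda>t. w (min t T0)) {0..T1}"
  have P0: "P y0"
  proof -
    have h: "holder_on 0 T1 \<alpha> Bw y0"
      using frozen_history_holder unfolding holder_on_def y0_def by auto
    have "y0 \<in> holder_paths \<alpha> T1"
      by (rule holder_pathsI[OF _ h Bw]) (simp add: y0_def)
    moreover have "bielecki T1 \<alpha> \<mu> R y0"
      by (rule bielecki_mono[OF holder_on_imp_bielecki[OF h Bw]]) (use \<mu> R in auto)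
    ultimately show ?thesis using T by (auto simp: P_def continuations_def y0_def min_def)
  qed
  define Y where "Y = (\<lambda>n. (\<Phi> ^^ n) y0)"
  have YS: "Y (Suc n) = \<Phi> (Y n)" for n by (simp add: Y_def)
  have PY: "P (Y n)" for n by (induction n) (auto simp: Y_def P0 P\<Phi>)
  obtain L where L: "0 \<le> L" "lipschitz_on_ball M L G"
    by (rule coefficient_lipschitz[OF G, of M]) (rule that)
  obtain \<nu> where \<nu>: "1 \<le> \<nu>" "real CARD('m) * real CARD('d) * K * L * \<nu> powr (\<alpha> - 1) \<le> 1 / 2"
    using contraction_rate_exists[OF \<alpha>(2)] by blast
  have contr: "bielecki T1 \<alpha> \<nu> (D / 2) (\<lambda>t. \<Phi> y t - \<Phi> z t)"
    if y: "P y" and z: "P z" and D: "0 \<le> D" "bielecki T1 \<alpha> \<nu> D (\<lambda>t. y t - z t)" for y z D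
  proof -
    have c: "y \<in> continuations" "z \<in> continuations" using y z by (auto simp: P_def)
    have pz: "\<Phi> y t = \<Phi> z t" if "t \<in> {0..T0}" for t using past that by simp
    have "bielecki T1 \<alpha> \<nu> (D / 2 + real CARD('m) * real CARD('d) * K * 0) (\<lambda>t. \<Phi> y t - \<Phi> z t)"
      by (rule contraction[where G = G and H = G and y = y and z = z and p = "\<Phi> y" and q = "\<Phi> z" and v = "w T0", OF \<nu> L coefficient_entries_holder[OF G c(1)] coefficient_entries_holder[OF G c(2)]
              x c(1) PM[OF y] c(2) PM[OF z] D _ _ pz eq[OF c(1)] eq[OF c(2)]]) auto
    then show ?thesis by simp
  qed
  have M0: "0 \<le> M" using R by (simp add: M_def)
  have step: "bielecki T1 \<alpha> \<nu> (2 * M / 2 ^ n) (\<lambda>t. Y (Suc n) t - Y n t)" for n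
  proof (induction n)
    case 0
    have "holder_on 0 T1 \<alpha> (M + M) (\<lambda>t. Y (Suc 0) t - Y 0 t)" by (intro holder_on_diff PM PY)
    then have "bielecki T1 \<alpha> \<nu> (M + M) (\<lambda>t. Y (Suc 0) t - Y 0 t)"
      by (rule holder_on_imp_bielecki) (use M0 \<nu> in auto)
    then show ?case by simp
  next
    case (Suc n)
    have "bielecki T1 \<alpha> \<nu> ((2 * M / 2 ^ n) / 2) (\<lambda>t. \<Phi> (Y (Suc n)) t - \<Phi> (Y n) t)"
      by (rule contr[OF PY PY _ Suc]) (use M0 in auto)
    then show ?case by (simp add: YS field_simps)
  qed
  \<comment> \<open>The exact partial sum of the geometric series from \<open>step\<close>; keeping
    the subtracted term lets the induction on k close without loss.\<close>
  have tail: "bielecki T1 \<alpha> \<nu> (4 * M / 2 ^ n - 4 * M / 2 ^ (n + k)) (\<lambda>t. Y (n + k) t - Y n t)" for n k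
  proof (induction k)
    case 0 then show ?case by (simp add: bielecki_def)
  next
    case (Suc k)
    from bielecki_add[OF step[of "n + k"] Suc] show ?case
      by (simp add: field_simps)
  qed
  have conv: "convergent (\<lambda>n. Y n t)" if t: "t \<in> {0..T1}" for t
  proof (cases "t = 0")
    case True
    have "Y n 0 = w 0" for n using PY continuation_start by (auto simp: P_def)
    then show ?thesis using True by (simp add: convergent_const)
  next
    case False
    show ?thesis
    proof (rule convergent_geometric)
      fix n
      have Y0: "Y n 0 = w 0" for n using PY continuation_start by (auto simp: P_def)
      have "norm ((Y (Suc n) t - Y n t) - (Y (Suc n) 0 - Y n 0)) \<le> 2 * M / 2 ^ n * exp (\<nu> * t) * (t - 0) powr \<alpha>"
        by (rule step[of n, unfolded bielecki_def, rule_format]) (use t False in auto)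
      then have "norm (Y (Suc n) t - Y n t) \<le> 2 * M / 2 ^ n * exp (\<nu> * t) * (t - 0) powr \<alpha>"
        by (simp only: Y0) simp
      then show "norm (Y (Suc n) t - Y n t) \<le> (2 * M * exp (\<nu> * t) * (t - 0) powr \<alpha>) / 2 ^ n"
        by simp
    qed
  qed
  define y where "y = restrict (\<lambda>t. lim (\<lambda>n. Y n t)) {0..T1}"
  have lim: "(\<lambda>n. Y n t) \<longlonglongrightarrow> y t" if "t \<in> {0..T1}" for t
    using conv[OF that] that by (simp add: y_def convergent_LIMSEQ_iff)
  have Py: "P y"
  proof -
    have b: "bielecki T1 \<alpha> \<mu> R y"
      by (rule bielecki_limit[where D = "\<lambda>_. R" and f = Y]) (use PY lim in \<open>auto simp: P_def\<close>)
    have "holder_on 0 T1 \<alpha> (R * exp (\<mu> * T1)) y"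
      using b R \<mu> by (intro bielecki_imp_holder_on) auto
    then have "y \<in> holder_paths \<alpha> T1"
      by (rule holder_pathsI[rotated]) (use R in \<open>auto simp: y_def\<close>)
    moreover have "y t = w t" if t: "t \<in> {0..T0}" for t
    proof -
      have "Y n t = w t" for n using PY[of n] t by (simp add: P_def continuations_def)
      then have "(\<lambda>_. w t) \<longlonglongrightarrow> y t" using lim[of t] t T by simp
      then show ?thesis using LIMSEQ_unique[OF tendsto_const] by metis
    qed
    ultimately show ?thesis using b by (simp add: P_def continuations_def)
  qed
  have close: "bielecki T1 \<alpha> \<nu> (4 * M / 2 ^ n) (\<lambda>t. y t - Y n t)" for n
  proof (rule bielecki_limit[where f = "\<lambda>k t. Y (n + k) t - Y n t", OF tail])
    have "(\<lambda>k. 4 * M / 2 ^ n - (4 * M / 2 ^ n) / 2 ^ k) \<longlonglongrightarrow> 4 * M / 2 ^ n - 0"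
      by (intro tendsto_intros tendsto_div_two_power)
    then show "(\<lambda>k. 4 * M / 2 ^ n - 4 * M / 2 ^ (n + k)) \<longlonglongrightarrow> 4 * M / 2 ^ n"
      by (simp add: power_add)
    fix t assume "0 \<le> t" "t \<le> T1"
    then have "(\<lambda>k. Y (k + n) t) \<longlonglongrightarrow> y t" by (intro LIMSEQ_ignore_initial_segment lim) auto
    then show "(\<lambda>k. Y (n + k) t - Y n t) \<longlonglongrightarrow> y t - Y n t"
      by (intro tendsto_intros) (simp add: add.commute)
  qed
  \<comment> \<open>\<Phi> y - Y (n + 1) is small by contraction from \<open>close\<close>, and Y (n
    + 1) tends to y; so \<Phi> y - y has vanishing seminorm.\<close>
  have "bielecki T1 \<alpha> \<nu> 0 (\<lambda>t. \<Phi> y t - y t)"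
  proof (rule bielecki_limit[where f = "\<lambda>n t. \<Phi> y t - Y (Suc n) t"])
    fix n
    have "bielecki T1 \<alpha> \<nu> ((4 * M / 2 ^ n) / 2) (\<lambda>t. \<Phi> y t - \<Phi> (Y n) t)"
      by (rule contr[OF Py PY _ close]) (use M0 in auto)
    then show "bielecki T1 \<alpha> \<nu> (2 * M / 2 ^ n) (\<lambda>t. \<Phi> y t - Y (Suc n) t)"
      by (simp add: YS)
  next
    fix t assume "0 \<le> t" "t \<le> T1"
    then show "(\<lambda>n. \<Phi> y t - Y (Suc n) t) \<longlonglongrightarrow> \<Phi> y t - y t"
      using LIMSEQ_Suc[OF lim[of t]] by (intro tendsto_intros) auto
  qed (rule tendsto_div_two_power)
  then have "\<Phi> y = y"
    using bielecki_zero_imp_eq Py P\<Phi>[OF Py] by (auto simp: P_def)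
  then have "is_solution T0 T1 \<alpha> w G x y"
    using is_solution_iff[OF G x, of y] eq[of y] Py by (auto simp: P_def)
  then show ?thesis by blast
qed

text \<open>The coefficients are compared along two different solutions by a crude uniform bound B,
  so no fixed-point argument intervenes and the estimate stays linear in K. This is what a
  superlinear weight can beat. The weight parameter \<mu> is simply 1.\<close>

lemma bounded_solutions_diff:
  fixes G H :: "(real \<Rightarrow> real ^ 'm) \<Rightarrow> real \<Rightarrow> real ^ 'd ^ 'm"
  assumes G: "coefficient A G" and H: "coefficient A' H" and x: "driver T1 K x"
    and y: "is_solution T0 T1 \<alpha> w G x y" and z: "is_solution T0 T1 \<alpha> w H x z" and "0 \<le> B"
    and bound: "\<And>u i j. u \<in> {T0..T1} \<Longrightarrow> \<bar>G y u $ i $ j - H z u $ i $ j\<bar> \<le> B"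
  shows "holder_on 0 T1 \<alpha> (real CARD('m) * real CARD('d) * K * B * exp T1) (\<lambda>t. y t - z t)"
proof -
  have y': "y \<in> continuations" and yeq: "\<And>t. t \<in> {T0..T1} \<Longrightarrow> y t = w T0 + rs_drive (G y) x T0 t"
    using y is_solution_iff[OF G x] by auto
  have z': "z \<in> continuations" and zeq: "\<And>t. t \<in> {T0..T1} \<Longrightarrow> z t = w T0 + rs_drive (H z) x T0 t"
    using z is_solution_iff[OF H x] by auto
  have past: "\<And>t. t \<in> {0..T0} \<Longrightarrow> y t = z t" using y' z' by (simp add: continuations_def)
  have bound': "\<bar>G y u $ i $ j - H z u $ i $ j\<bar> \<le> B * exp (1 * u)" if u: "u \<in> {T0..T1}" for u i j
  proof -
    have "B * 1 \<le> B * exp (1 * u)" using \<open>0 \<le> B\<close> u T by (intro mult_left_mono) auto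
    then show ?thesis using bound[OF u, of i j] by linarith
  qed
  have "bielecki T1 \<alpha> 1 (real CARD('m) * real CARD('d) * K * B * 1 powr (\<alpha> - 1)) (\<lambda>t. y t - z t)"
    by (rule driven_paths_diff[OF coefficient_entries_holder[OF G y'] coefficient_entries_holder[OF H z']
          x _ \<open>0 \<le> B\<close> bound' past yeq zeq]) auto
  from bielecki_imp_holder_on[OF this, of T1] show ?thesis
    using x \<open>0 \<le> B\<close> by (simp add: driver_def)
qed

end

section \<open>Signature coordinates\<close>

lemma holder_on_zero_start_bound:
  fixes f :: "real \<Rightarrow> real"
  assumes "holder_on 0 s \<alpha> C f" "f 0 = 0" "t \<in> {0..s}" "s \<le> T" "0 \<le> \<alpha>" "0 \<le> C"
  shows "\<bar>f t\<bar> \<le> C * T powr \<alpha>"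
proof -
  have "norm (f t - f 0) \<le> C * (t - 0) powr \<alpha>" using assms by (intro holder_onD[OF assms(1)]) auto
  also have "\<dots> \<le> C * T powr \<alpha>" using assms by (intro mult_left_mono powr_mono2) auto
  finally show ?thesis using assms by simp
qed

lemma has_rs_integral_zero: "a \<le> b \<Longrightarrow> has_rs_integral (\<lambda>_. 0) h a b 0"
  using has_rs_integral_germ_powr[of a b 2 "\<lambda>_. 0" "\<lambda>_. 0" h 0] by simp

text \<open>Y is a primitive for the germ 0, and the integral of 0 is unique.\<close>

lemma constant_if_superlinear_increments:
  fixes Y :: "real \<Rightarrow> real"
  assumes "a \<le> b" "1 < \<theta>"
    and "\<And>s t. a \<le> s \<Longrightarrow> s \<le> t \<Longrightarrow> t \<le> b \<Longrightarrow> \<bar>Y t - Y s\<bar> \<le> C * (t - s) powr \<theta>"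
  shows "Y b = Y a"
proof -
  have "has_rs_integral (\<lambda>_. 0) (\<lambda>_. 0) a b (Y b - Y a)"
    by (rule has_rs_integral_germ_powr[OF assms(1,2), where C = C]) (use assms(3) in auto)
  then show ?thesis using has_rs_integral_unique[OF _ has_rs_integral_zero[OF assms(1)]] by fastforce
qed

section \<open>Path functionals of polynomial growth\<close>

locale signature_paths =
  fixes T \<alpha> :: real
  assumes T0: "0 \<le> T" and \<alpha>: "1 / 2 < \<alpha>" "\<alpha> < 1"
begin

definition path_bound :: "real \<Rightarrow> real \<Rightarrow> (real \<Rightarrow> real ^ 'k) \<Rightarrow> bool"
  where "path_bound s N z \<longleftrightarrow> (\<forall>k. holder_on 0 s \<alpha> N (\<lambda>u. z u $ k))"

text \<open>The class is built to be stable under f -> integral of f against a coordinate: Young's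
  estimate needs f and the differences f z - f z' bounded both uniformly and in Hoelder seminorm.
  Everything is stated on [0,s] for each s, so that the bounds are non-anticipative, and N \<ge> 1
  makes powers of N comparable.\<close>

definition tame_with :: "real \<Rightarrow> nat \<Rightarrow> ((real \<Rightarrow> real ^ 'k) \<Rightarrow> real \<Rightarrow> real) \<Rightarrow> bool"
  where "tame_with c n f \<longleftrightarrow> 0 \<le> c \<and> (\<forall>s\<in>{0..T}. \<forall>N\<ge>1.
    (\<forall>z. path_bound s N z \<longrightarrow>
      (\<forall>t\<in>{0..s}. \<bar>f z t\<bar> \<le> c * N ^ n) \<and> holder_on 0 s \<alpha> (c * N ^ n) (f z)) \<and>
    (\<forall>z z'. \<forall>D\<ge>0. path_bound s N z \<longrightarrow> path_bound s N z' \<longrightarrow> path_bound s D (\<lambda>u. z u - z' u) \<longrightarrow>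
      (\<forall>t\<in>{0..s}. \<bar>f z t - f z' t\<bar> \<le> c * N ^ n * D) \<and>
      holder_on 0 s \<alpha> (c * N ^ n * D) (\<lambda>t. f z t - f z' t)))"

definition tame :: "((real \<Rightarrow> real ^ 'k) \<Rightarrow> real \<Rightarrow> real) \<Rightarrow> bool"
  where "tame f \<longleftrightarrow> (\<exists>c n. tame_with c n f)"

lemma tameI:
  fixes f :: "(real \<Rightarrow> real ^ 'k) \<Rightarrow> real \<Rightarrow> real"
  assumes "0 \<le> c"
    and "\<And>s N z t. s \<in> {0..T} \<Longrightarrow> 1 \<le> N \<Longrightarrow> path_bound s N z \<Longrightarrow> t \<in> {0..s} \<Longrightarrow> \<bar>f z t\<bar> \<le> c * N ^ n"
    and "\<And>s N z. s \<in> {0..T} \<Longrightarrow> 1 \<le> N \<Longrightarrow> path_bound s N z \<Longrightarrow> holder_on 0 s \<alpha> (c * N ^ n) (f z)"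
    and "\<And>s N z z' D t. s \<in> {0..T} \<Longrightarrow> 1 \<le> N \<Longrightarrow> 0 \<le> D \<Longrightarrow> path_bound s N z \<Longrightarrow> path_bound s N z' \<Longrightarrow>
      path_bound s D (\<lambda>u. z u - z' u) \<Longrightarrow> t \<in> {0..s} \<Longrightarrow> \<bar>f z t - f z' t\<bar> \<le> c * N ^ n * D"
    and "\<And>s N z z' D. s \<in> {0..T} \<Longrightarrow> 1 \<le> N \<Longrightarrow> 0 \<le> D \<Longrightarrow> path_bound s N z \<Longrightarrow> path_bound s N z' \<Longrightarrow>
      path_bound s D (\<lambda>u. z u - z' u) \<Longrightarrow> holder_on 0 s \<alpha> (c * N ^ n * D) (\<lambda>t. f z t - f z' t)"
  shows "tame f"
  unfolding tame_def tame_with_def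
  by (intro exI[of _ c] exI[of _ n] conjI allI ballI impI) (use assms in auto)

lemma tame_withD:
  fixes f :: "(real \<Rightarrow> real ^ 'k) \<Rightarrow> real \<Rightarrow> real"
  assumes "tame_with c n f"
  shows "0 \<le> c"
    and "\<And>s N z t. s \<in> {0..T} \<Longrightarrow> 1 \<le> N \<Longrightarrow> path_bound s N z \<Longrightarrow> t \<in> {0..s} \<Longrightarrow> \<bar>f z t\<bar> \<le> c * N ^ n"
    and "\<And>s N z. s \<in> {0..T} \<Longrightarrow> 1 \<le> N \<Longrightarrow> path_bound s N z \<Longrightarrow> holder_on 0 s \<alpha> (c * N ^ n) (f z)"
    and "\<And>s N z z' D t. s \<in> {0..T} \<Longrightarrow> 1 \<le> N \<Longrightarrow> 0 \<le> D \<Longrightarrow> path_bound s N z \<Longrightarrow> path_bound s N z' \<Longrightarrow>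
      path_bound s D (\<lambda>u. z u - z' u) \<Longrightarrow> t \<in> {0..s} \<Longrightarrow> \<bar>f z t - f z' t\<bar> \<le> c * N ^ n * D"
    and "\<And>s N z z' D. s \<in> {0..T} \<Longrightarrow> 1 \<le> N \<Longrightarrow> 0 \<le> D \<Longrightarrow> path_bound s N z \<Longrightarrow> path_bound s N z' \<Longrightarrow>
      path_bound s D (\<lambda>u. z u - z' u) \<Longrightarrow> holder_on 0 s \<alpha> (c * N ^ n * D) (\<lambda>t. f z t - f z' t)"
  using assms unfolding tame_with_def by blast+

lemma tame_add:
  fixes f g :: "(real \<Rightarrow> real ^ 'k) \<Rightarrow> real \<Rightarrow> real"
  assumes "tame f" "tame g"
  shows "tame (\<lambda>z t. f z t + g z t)"
proof -
  from assms(1) obtain c n where f': "tame_with c n f"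
    by (auto simp: tame_def)
  note f = tame_withD[OF f']
  from assms(2) obtain d m where g': "tame_with d m g"
    by (auto simp: tame_def)
  note g = tame_withD[OF g']
  \<comment> \<open>The exponent n + m serves as a common upper bound for n and m, since N \<ge>
    1.\<close>
  have le: "c * N ^ n + d * N ^ m \<le> (c + d) * N ^ (n + m)" if "1 \<le> N" for N :: real
  proof -
    have "N ^ n \<le> N ^ (n + m)" "N ^ m \<le> N ^ (n + m)" using that by (auto intro: power_increasing)
    then have "c * N ^ n + d * N ^ m \<le> c * N ^ (n + m) + d * N ^ (n + m)"
      using f(1) g(1) by (intro add_mono mult_left_mono) auto
    then show ?thesis by (simp add: algebra_simps)
  qed
  have leD: "c * N ^ n * D + d * N ^ m * D \<le> (c + d) * N ^ (n + m) * D" if "1 \<le> N" "0 \<le> D" for N D :: real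
    using mult_right_mono[OF le[OF that(1)] that(2)] by (simp only: algebra_simps)
  show ?thesis
  proof (rule tameI[where c = "c + d" and n = "n + m"])
    show "0 \<le> c + d" using f g by simp
  next
    fix s N :: real and z :: "real \<Rightarrow> real ^ 'k" and t
    assume a: "s \<in> {0..T}" "1 \<le> N" "path_bound s N z" "t \<in> {0..s}"
    show "\<bar>f z t + g z t\<bar> \<le> (c + d) * N ^ (n + m)"
      using f(2)[OF a] g(2)[OF a] le[OF a(2)] by linarith
  next
    fix s N :: real and z :: "real \<Rightarrow> real ^ 'k"
    assume a: "s \<in> {0..T}" "1 \<le> N" "path_bound s N z"
    show "holder_on 0 s \<alpha> ((c + d) * N ^ (n + m)) (\<lambda>t. f z t + g z t)"
      by (rule holder_on_mono[OF holder_on_add[OF f(3)[OF a] g(3)[OF a]] le[OF a(2)]])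
  next
    fix s N :: real and z z' :: "real \<Rightarrow> real ^ 'k" and D t
    assume a: "s \<in> {0..T}" "1 \<le> N" "0 \<le> D" "path_bound s N z" "path_bound s N z'"
      "path_bound s D (\<lambda>u. z u - z' u)" "t \<in> {0..s}"
    show "\<bar>f z t + g z t - (f z' t + g z' t)\<bar> \<le> (c + d) * N ^ (n + m) * D"
      using f(4)[OF a] g(4)[OF a] leD[OF a(2,3)] by linarith
  next
    fix s N :: real and z z' :: "real \<Rightarrow> real ^ 'k" and D
    assume a: "s \<in> {0..T}" "1 \<le> N" "0 \<le> D" "path_bound s N z" "path_bound s N z'"
      "path_bound s D (\<lambda>u. z u - z' u)"
    have "holder_on 0 s \<alpha> ((c + d) * N ^ (n + m) * D) (\<lambda>t. (f z t - f z' t) + (g z t - g z' t))"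
      by (rule holder_on_mono[OF holder_on_add[OF f(5)[OF a] g(5)[OF a]] leD[OF a(2,3)]])
    then show "holder_on 0 s \<alpha> ((c + d) * N ^ (n + m) * D) (\<lambda>t. f z t + g z t - (f z' t + g z' t))"
      by (simp add: algebra_simps)
  qed
qed

lemma tame_cmult:
  fixes f :: "(real \<Rightarrow> real ^ 'k) \<Rightarrow> real \<Rightarrow> real"
  assumes "tame f"
  shows "tame (\<lambda>z t. r * f z t)"
proof -
  from assms obtain c n where f': "tame_with c n f"
    by (auto simp: tame_def)
  note f = tame_withD[OF f']
  have cm: "\<bar>r * x\<bar> \<le> \<bar>r\<bar> * y" if "\<bar>x\<bar> \<le> y" for x y
    using that by (simp add: abs_mult mult_left_mono)
  show ?thesis
  proof (rule tameI[where c = "\<bar>r\<bar> * c" and n = n])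
    show "0 \<le> \<bar>r\<bar> * c" using f by simp
  next
    fix s N :: real and z :: "real \<Rightarrow> real ^ 'k" and t
    assume a: "s \<in> {0..T}" "1 \<le> N" "path_bound s N z" "t \<in> {0..s}"
    show "\<bar>r * f z t\<bar> \<le> \<bar>r\<bar> * c * N ^ n"
      using cm[OF f(2)[OF a]] by (simp add: mult.assoc)
  next
    fix s N :: real and z :: "real \<Rightarrow> real ^ 'k"
    assume a: "s \<in> {0..T}" "1 \<le> N" "path_bound s N z"
    show "holder_on 0 s \<alpha> (\<bar>r\<bar> * c * N ^ n) (\<lambda>t. r * f z t)"
      using holder_on_cmult[OF f(3)[OF a], of r] by (simp add: mult.assoc)
  next
    fix s N :: real and z z' :: "real \<Rightarrow> real ^ 'k" and D t
    assume a: "s \<in> {0..T}" "1 \<le> N" "0 \<le> D" "path_bound s N z" "path_bound s N z'"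
      "path_bound s D (\<lambda>u. z u - z' u)" "t \<in> {0..s}"
    show "\<bar>r * f z t - r * f z' t\<bar> \<le> \<bar>r\<bar> * c * N ^ n * D"
      using cm[OF f(4)[OF a]] by (simp add: mult.assoc right_diff_distrib)
  next
    fix s N :: real and z z' :: "real \<Rightarrow> real ^ 'k" and D
    assume a: "s \<in> {0..T}" "1 \<le> N" "0 \<le> D" "path_bound s N z" "path_bound s N z'"
      "path_bound s D (\<lambda>u. z u - z' u)"
    show "holder_on 0 s \<alpha> (\<bar>r\<bar> * c * N ^ n * D) (\<lambda>t. r * f z t - r * f z' t)"
      using holder_on_cmult[OF f(5)[OF a], of r] by (simp add: mult.assoc right_diff_distrib)
  qed
qed

lemma young_pair_letter:
  assumes "0 \<le> s" "holder_on 0 s \<alpha> C g" "0 \<le> C" "path_bound s N z" "0 \<le> N"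
  shows "young_pair 0 s \<alpha> \<alpha> C N g (\<lambda>u. z u $ k)"
  using assms \<alpha> by unfold_locales (auto simp: path_bound_def)

text \<open>The bilinear split \<open>\<integral>g dz - \<integral>g' dz' = \<integral>(g - g') dz + \<integral>g' d(z - z')\<close> drives the induction.\<close>

lemma tame_integral:
  fixes f :: "(real \<Rightarrow> real ^ 'k) \<Rightarrow> real \<Rightarrow> real"
  assumes "tame f"
  shows "tame (\<lambda>z t. rs_integral (f z) (\<lambda>u. z u $ k) 0 t)"
proof -
  from assms obtain c n where f': "tame_with c n f"
    by (auto simp: tame_def)
  note f = tame_withD[OF f']
  define q where "q = 1 + young_const (\<alpha> + \<alpha>) * T powr \<alpha>"
  have q: "0 \<le> q" using young_const_nonneg[of "\<alpha> + \<alpha>"] \<alpha> by (simp add: q_def)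
  \<comment> \<open>Dominates both 1 and \<open>T powr \<alpha>\<close>, so that one constant covers
    the Hoelder bound and the uniform bound derived from it for an integral that starts at
    0.\<close>
  define e where "e = 1 + T powr \<alpha>"
  have e: "1 \<le> e" "T powr \<alpha> \<le> e" by (auto simp: e_def)
  have grow: "x \<le> x * e" if "0 \<le> x" for x using mult_left_mono[OF e(1) that] by simp
  have growT: "x * T powr \<alpha> \<le> x * e" if "0 \<le> x" for x using mult_left_mono[OF e(2) that] .
  define c' where "c' = 2 * c * q * e"
  have c': "0 \<le> c'" using f q e by (simp add: c'_def)
  let ?J = "\<lambda>z t. rs_integral (f z) (\<lambda>u. z u $ k) 0 t"
  have hol: "holder_on 0 s \<alpha> (c * q * N ^ Suc n) (?J z)" and start: "?J z 0 = 0"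
    if a: "s \<in> {0..T}" "1 \<le> N" "path_bound s N z" for s N z
  proof -
    have Y: "young_pair 0 s \<alpha> \<alpha> (c * N ^ n) N (f z) (\<lambda>u. z u $ k)"
      using a f(1) by (intro young_pair_letter f(3)) auto
    have "holder_on 0 s \<alpha> ((c * N ^ n + young_const (\<alpha> + \<alpha>) * (c * N ^ n) * T powr \<alpha>) * N) (?J z)"
      using a by (intro young_pair.integral_holder[OF Y] f(2)) auto
    then show "holder_on 0 s \<alpha> (c * q * N ^ Suc n) (?J z)" by (simp add: q_def algebra_simps)
    show "?J z 0 = 0" using young_pair.integral_self[OF Y] .
  qed
  have dhol: "holder_on 0 s \<alpha> (2 * c * q * N ^ Suc n * D) (\<lambda>t. ?J z t - ?J z' t)"
    if a: "s \<in> {0..T}" "1 \<le> N" "0 \<le> D" "path_bound s N z" "path_bound s N z'"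
      "path_bound s D (\<lambda>u. z u - z' u)" for s N z z' D
  proof -
    have nn: "0 \<le> c * N ^ n" using f a by simp
    have f3: "holder_on 0 s \<alpha> (c * N ^ n) (f z)" "holder_on 0 s \<alpha> (c * N ^ n) (f z')"
      using f(3) a by blast+
    have Y1: "young_pair 0 s \<alpha> \<alpha> (c * N ^ n) N (f z) (\<lambda>u. z u $ k)"
      and Y2: "young_pair 0 s \<alpha> \<alpha> (c * N ^ n) N (f z') (\<lambda>u. z u $ k)"
      and Y3: "young_pair 0 s \<alpha> \<alpha> (c * N ^ n) N (f z') (\<lambda>u. z' u $ k)"
      using a nn f3 by (auto intro!: young_pair_letter)
    have Z1: "young_pair 0 s \<alpha> \<alpha> (c * N ^ n * D) N (\<lambda>u. f z u - f z' u) (\<lambda>u. z u $ k)"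
      using a nn f(5)[OF a] by (intro young_pair_letter) auto
    have Z2: "young_pair 0 s \<alpha> \<alpha> (c * N ^ n) D (f z') (\<lambda>u. (z u - z' u) $ k)"
      using a nn f3 by (intro young_pair_letter) auto
    have split: "?J z t - ?J z' t = rs_integral (\<lambda>u. f z u - f z' u) (\<lambda>u. z u $ k) 0 t +
        rs_integral (f z') (\<lambda>u. (z u - z' u) $ k) 0 t" if t: "t \<in> {0..s}" for t
    proof -
      note I = young_pair.has_integral_from_start
      have "rs_integral (\<lambda>u. f z u - f z' u) (\<lambda>u. z u $ k) 0 t =
          ?J z t - rs_integral (f z') (\<lambda>u. z u $ k) 0 t"
        by (rule rs_integral_eqI[OF has_rs_integral_diff_left[OF I[OF Y1 t] I[OF Y2 t]]])
      moreover have "rs_integral (f z') (\<lambda>u. z u $ k - z' u $ k) 0 t =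
          rs_integral (f z') (\<lambda>u. z u $ k) 0 t - ?J z' t"
        by (rule rs_integral_eqI[OF has_rs_integral_diff_right[OF I[OF Y2 t] I[OF Y3 t]]])
      ultimately show ?thesis by simp
    qed
    have h1: "holder_on 0 s \<alpha> ((c * N ^ n * D + young_const (\<alpha> + \<alpha>) * (c * N ^ n * D) * T powr \<alpha>) * N)
        (\<lambda>t. rs_integral (\<lambda>u. f z u - f z' u) (\<lambda>u. z u $ k) 0 t)"
      using a f(4)[OF a] by (intro young_pair.integral_holder[OF Z1]) auto
    have h2: "holder_on 0 s \<alpha> ((c * N ^ n + young_const (\<alpha> + \<alpha>) * (c * N ^ n) * T powr \<alpha>) * D)
        (\<lambda>t. rs_integral (f z') (\<lambda>u. (z u - z' u) $ k) 0 t)"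
      using a f(2) by (intro young_pair.integral_holder[OF Z2]) auto
    have "holder_on 0 s \<alpha> (c * N ^ Suc n * D * q + c * N ^ n * D * q)
        (\<lambda>t. rs_integral (\<lambda>u. f z u - f z' u) (\<lambda>u. z u $ k) 0 t +
          rs_integral (f z') (\<lambda>u. (z u - z' u) $ k) 0 t)"
      using holder_on_add[OF h1 h2] by (simp add: q_def algebra_simps)
    then have "holder_on 0 s \<alpha> (c * N ^ Suc n * D * q + c * N ^ n * D * q) (\<lambda>t. ?J z t - ?J z' t)"
      unfolding holder_on_def using split by simp
    moreover have "c * N ^ n * D * q \<le> c * N ^ Suc n * D * q"
      using f(1) a q by (intro mult_right_mono mult_left_mono power_increasing) auto
    ultimately show ?thesis by (elim holder_on_mono) (simp add: algebra_simps)
  qed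
  show ?thesis
  proof (rule tameI[where c = c' and n = "Suc n"])
    show "0 \<le> c'" by fact
  next
    fix s N :: real and z :: "real \<Rightarrow> real ^ 'k" and t
    assume a: "s \<in> {0..T}" "1 \<le> N" "path_bound s N z" "t \<in> {0..s}"
    have p: "0 \<le> c * q * N ^ Suc n" using f q a by simp
    have "\<bar>?J z t\<bar> \<le> c * q * N ^ Suc n * T powr \<alpha>"
      using a \<alpha> p by (intro holder_on_zero_start_bound[OF hol[OF a(1-3)] start[OF a(1-3)]]) auto
    also have "\<dots> \<le> c * q * N ^ Suc n * e" by (rule growT[OF p])
    also have "\<dots> \<le> 2 * (c * q * N ^ Suc n * e)"
      using mult_nonneg_nonneg[OF p, of e] e by linarith
    finally show "\<bar>?J z t\<bar> \<le> c' * N ^ Suc n" by (simp add: c'_def mult_ac)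
  next
    fix s N :: real and z :: "real \<Rightarrow> real ^ 'k"
    assume a: "s \<in> {0..T}" "1 \<le> N" "path_bound s N z"
    have p: "0 \<le> c * q * N ^ Suc n" using f q a by simp
    have "c * q * N ^ Suc n \<le> c * q * N ^ Suc n * e" by (rule grow[OF p])
    also have "\<dots> \<le> 2 * (c * q * N ^ Suc n * e)"
      using mult_nonneg_nonneg[OF p, of e] e by linarith
    finally show "holder_on 0 s \<alpha> (c' * N ^ Suc n) (?J z)"
      by (intro holder_on_mono[OF hol[OF a]]) (simp add: c'_def mult_ac)
  next
    fix s N :: real and z z' :: "real \<Rightarrow> real ^ 'k" and D t
    assume a: "s \<in> {0..T}" "1 \<le> N" "0 \<le> D" "path_bound s N z" "path_bound s N z'"
      "path_bound s D (\<lambda>u. z u - z' u)" "t \<in> {0..s}"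
    have p: "0 \<le> 2 * c * q * N ^ Suc n * D" using f q a by simp
    have "\<bar>?J z t - ?J z' t\<bar> \<le> 2 * c * q * N ^ Suc n * D * T powr \<alpha>"
      using a \<alpha> p start[OF a(1,2,4)] start[OF a(1,2,5)]
      by (intro holder_on_zero_start_bound[OF dhol[OF a(1-6)]]) auto
    also have "\<dots> \<le> 2 * c * q * N ^ Suc n * D * e" by (rule growT[OF p])
    finally show "\<bar>?J z t - ?J z' t\<bar> \<le> c' * N ^ Suc n * D" by (simp add: c'_def mult_ac)
  next
    fix s N :: real and z z' :: "real \<Rightarrow> real ^ 'k" and D
    assume a: "s \<in> {0..T}" "1 \<le> N" "0 \<le> D" "path_bound s N z" "path_bound s N z'"
      "path_bound s D (\<lambda>u. z u - z' u)"
    have p: "0 \<le> 2 * c * q * N ^ Suc n * D" using f q a by simp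
    show "holder_on 0 s \<alpha> (c' * N ^ Suc n * D) (\<lambda>t. ?J z t - ?J z' t)"
      by (rule holder_on_mono[OF dhol[OF a] order_trans[OF grow[OF p]]]) (simp add: c'_def mult_ac)
  qed
qed

lemma tame_word: "tame (\<lambda>z. iterated_integral_rev z v)"
proof (induction v)
  case Nil
  show ?case
    by (rule tameI[where c = 1 and n = 0]) (auto intro: holder_on_const)
next
  case (Cons k v)
  from tame_integral[OF this, of k] show ?case by simp
qed

lemma tame_const: "tame (\<lambda>_ _. r)"
  using tame_cmult[OF tame_word[of "[]"], of r] by simp

lemma tame_sum:
  assumes "finite A" "\<And>v. v \<in> A \<Longrightarrow> tame (f v)"
  shows "tame (\<lambda>z t. \<Sum>v\<in>A. f v z t)"
  using assms by (induction A rule: finite_induct) (auto intro: tame_const tame_add)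

lemma tame_pairing: "tame (\<lambda>z t. tensor_pairing l (signature z t))"
  unfolding tensor_pairing_def signature_def by (intro tame_sum tame_cmult tame_word) simp

definition regular_paths :: "(real \<Rightarrow> real ^ 'k) set"
  where "regular_paths = {z. \<exists>N\<ge>1. path_bound T N z}"

lemma tame_holder:
  assumes "tame f" "z \<in> regular_paths"
  obtains C where "0 \<le> C" "holder_on 0 T \<alpha> C (f z)" "\<And>t. t \<in> {0..T} \<Longrightarrow> \<bar>f z t\<bar> \<le> C"
proof -
  from assms(2) obtain N where N: "1 \<le> N" "path_bound T N z" by (auto simp: regular_paths_def)
  from assms(1) obtain c n where f': "tame_with c n f"
    by (auto simp: tame_def)
  note f = tame_withD[OF f']
  show ?thesis
    by (rule that[of "c * N ^ n"]) (use f N T0 in auto)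
qed

lemma young_pair_tame:
  assumes "tame f" "z \<in> regular_paths"
  obtains C N where "young_pair 0 T \<alpha> \<alpha> C N (f z) (\<lambda>u. z u $ k)"
proof -
  from assms(2) obtain N where N: "1 \<le> N" "path_bound T N z" by (auto simp: regular_paths_def)
  obtain C where C: "0 \<le> C" "holder_on 0 T \<alpha> C (f z)" "\<And>t. t \<in> {0..T} \<Longrightarrow> \<bar>f z t\<bar> \<le> C"
    by (rule tame_holder[OF assms]) (rule that)
  show ?thesis by (rule that[OF young_pair_letter[OF T0 C(2,1) N(2)]]) (use N in auto)
qed

end

section \<open>The algebra of linear functionals of the signature\<close>

lemma tensor_pairing_superset:
  assumes "finite A" "Poly_Mapping.keys l \<subseteq> A"
  shows "tensor_pairing l S = (\<Sum>v\<in>A. Poly_Mapping.lookup l v * S v)"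
  unfolding tensor_pairing_def
  by (rule sum.mono_neutral_left) (use assms in \<open>auto simp: in_keys_iff\<close>)

lemma tensor_pairing_add: "tensor_pairing (l + l') S = tensor_pairing l S + tensor_pairing l' S"
proof -
  let ?A = "Poly_Mapping.keys l \<union> Poly_Mapping.keys l'"
  have "Poly_Mapping.keys (l + l') \<subseteq> ?A" by (rule Poly_Mapping.keys_add)
  then have "tensor_pairing (l + l') S = (\<Sum>v\<in>?A. Poly_Mapping.lookup (l + l') v * S v)"
    by (intro tensor_pairing_superset) auto
  moreover have "tensor_pairing l S = (\<Sum>v\<in>?A. Poly_Mapping.lookup l v * S v)"
    by (intro tensor_pairing_superset) auto
  moreover have "tensor_pairing l' S = (\<Sum>v\<in>?A. Poly_Mapping.lookup l' v * S v)"
    by (intro tensor_pairing_superset) auto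
  ultimately show ?thesis by (simp add: lookup_add algebra_simps sum.distrib)
qed

lemma tensor_pairing_single: "tensor_pairing (Poly_Mapping.single v c) S = c * S v"
  by (simp add: tensor_pairing_def)

lemma iterated_integral_rev_cong:
  fixes z z' :: "real \<Rightarrow> real ^ 'k"
  assumes "\<And>u. u \<in> {0..t} \<Longrightarrow> z u = z' u" "s \<in> {0..t}"
  shows "iterated_integral_rev z v s = iterated_integral_rev z' v s"
  using assms(2)
proof (induction v arbitrary: s)
  case (Cons k v)
  show ?case
    unfolding iterated_integral_rev.simps
    by (rule rs_integral_cong) (use Cons assms(1) in auto)
qed simp

lemma signature_cong:
  fixes z z' :: "real \<Rightarrow> real ^ 'k"
  assumes "\<And>u. u \<in> {0..t} \<Longrightarrow> z u = z' u" "0 \<le> t"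
  shows "signature z t = signature z' t"
  unfolding signature_def using iterated_integral_rev_cong[OF assms(1)] assms(2) by auto

lemma has_rs_integral_one: "a \<le> b \<Longrightarrow> has_rs_integral (\<lambda>_. 1) h a b (h b - h a)"
  by (rule has_rs_integral_germ_powr[where \<theta> = 2 and C = 0]) auto

lemma holder_on_mult:
  fixes f g :: "real \<Rightarrow> real"
  assumes f: "holder_on a b \<gamma> C f" "\<And>t. t \<in> {a..b} \<Longrightarrow> \<bar>f t\<bar> \<le> A"
    and g: "holder_on a b \<gamma> D g" "\<And>t. t \<in> {a..b} \<Longrightarrow> \<bar>g t\<bar> \<le> B" and "0 \<le> C" "0 \<le> D"
  shows "holder_on a b \<gamma> (A * D + B * C) (\<lambda>t. f t * g t)"
  unfolding holder_on_def
proof (intro allI impI)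
  fix s t assume st: "a \<le> s" "s < t" "t \<le> b"
  have "\<bar>f t * (g t - g s)\<bar> \<le> A * (D * (t - s) powr \<gamma>)"
    unfolding abs_mult using st f(2)[of t] \<open>0 \<le> D\<close>
    by (intro mult_mono holder_onD[OF g(1), unfolded real_norm_def]) auto
  moreover have "\<bar>g s * (f t - f s)\<bar> \<le> B * (C * (t - s) powr \<gamma>)"
    unfolding abs_mult using st g(2)[of s] \<open>0 \<le> C\<close>
    by (intro mult_mono holder_onD[OF f(1), unfolded real_norm_def]) auto
  moreover have "f t * g t - f s * g s = f t * (g t - g s) + g s * (f t - f s)" by (simp add: algebra_simps)
  ultimately have "\<bar>f t * g t - f s * g s\<bar> \<le> A * (D * (t - s) powr \<gamma>) + B * (C * (t - s) powr \<gamma>)"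
    by linarith
  then show "norm (f t * g t - f s * g s) \<le> (A * D + B * C) * (t - s) powr \<gamma>"
    by (simp add: algebra_simps)
qed

context signature_paths
begin

lemma tame_pair_holder:
  assumes "tame f" "tame g" "z \<in> regular_paths"
  obtains C where "0 \<le> C" "holder_on 0 T \<alpha> C (\<lambda>t. f z t * g z t)"
proof -
  obtain A where A: "0 \<le> A" "holder_on 0 T \<alpha> A (f z)" "\<And>t. t \<in> {0..T} \<Longrightarrow> \<bar>f z t\<bar> \<le> A"
    by (rule tame_holder[OF assms(1,3)]) (rule that)
  obtain B where B: "0 \<le> B" "holder_on 0 T \<alpha> B (g z)" "\<And>t. t \<in> {0..T} \<Longrightarrow> \<bar>g z t\<bar> \<le> B"
    by (rule tame_holder[OF assms(2,3)]) (rule that)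
  show ?thesis
    by (rule that[OF _ holder_on_mult[OF A(2,3) B(2,3) A(1) B(1)]]) (use A B in auto)
qed

text \<open>Both sides have the same germ \<open>F\<^sub>s g\<^sub>s \<delta>z\<^sup>b + G\<^sub>s f\<^sub>s \<delta>z\<^sup>a\<close> up to \<open>(t - s) powr (2 * \<alpha>)\<close>.\<close>

lemma product_of_integrals:
  fixes f g :: "(real \<Rightarrow> real ^ 'k) \<Rightarrow> real \<Rightarrow> real" and a b :: 'k
  assumes f: "tame f" and g: "tame g" and z: "z \<in> regular_paths" and t: "t \<in> {0..T}"
  defines "F \<equiv> \<lambda>z t. rs_integral (f z) (\<lambda>u. z u $ a) 0 t"
    and "G \<equiv> \<lambda>z t. rs_integral (g z) (\<lambda>u. z u $ b) 0 t"
  shows "F z t * G z t = rs_integral (\<lambda>u. F z u * g z u) (\<lambda>u. z u $ b) 0 t +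
    rs_integral (\<lambda>u. G z u * f z u) (\<lambda>u. z u $ a) 0 t"
proof -
  define q where "q = young_const (\<alpha> + \<alpha>)"
  have \<theta>: "1 < \<alpha> + \<alpha>" using \<alpha> by simp
  have tF: "tame F" and tG: "tame G" unfolding F_def G_def by (intro tame_integral f g)+
  from z obtain N where N: "1 \<le> N" "path_bound T N z" by (auto simp: regular_paths_def)
  then have N0: "0 \<le> N" by simp
  obtain Cf where Cf: "0 \<le> Cf" "holder_on 0 T \<alpha> Cf (f z)" "\<And>t. t \<in> {0..T} \<Longrightarrow> \<bar>f z t\<bar> \<le> Cf"
    by (rule tame_holder[OF f z]) (rule that)
  obtain Cg where Cg: "0 \<le> Cg" "holder_on 0 T \<alpha> Cg (g z)" "\<And>t. t \<in> {0..T} \<Longrightarrow> \<bar>g z t\<bar> \<le> Cg"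
    by (rule tame_holder[OF g z]) (rule that)
  obtain CF where CF: "0 \<le> CF" "holder_on 0 T \<alpha> CF (F z)" "\<And>t. t \<in> {0..T} \<Longrightarrow> \<bar>F z t\<bar> \<le> CF"
    by (rule tame_holder[OF tF z]) (rule that)
  obtain CG where CG: "0 \<le> CG" "holder_on 0 T \<alpha> CG (G z)" "\<And>t. t \<in> {0..T} \<Longrightarrow> \<bar>G z t\<bar> \<le> CG"
    by (rule tame_holder[OF tG z]) (rule that)
  obtain C1 where C1: "0 \<le> C1" "holder_on 0 T \<alpha> C1 (\<lambda>u. F z u * g z u)"
    by (rule tame_pair_holder[OF tF g z]) (rule that)
  obtain C2 where C2: "0 \<le> C2" "holder_on 0 T \<alpha> C2 (\<lambda>u. G z u * f z u)"
    by (rule tame_pair_holder[OF tG f z]) (rule that)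
  note Y = young_pair_letter[OF T0 _ _ N(2) N0]
  note Yf = Y[OF Cf(2,1), of a] and Yg = Y[OF Cg(2,1), of b] and Y1 = Y[OF C1(2,1), of b] and Y2 = Y[OF C2(2,1), of a]
  define J1 where "J1 = rs_integral (\<lambda>u. F z u * g z u) (\<lambda>u. z u $ b) 0"
  define J2 where "J2 = rs_integral (\<lambda>u. G z u * f z u) (\<lambda>u. z u $ a) 0"
  define Z where "Z = (\<lambda>t. F z t * G z t - J1 t - J2 t)"
  define C where "C = CF * (q * (Cg * N)) + CG * (q * (Cf * N)) + CF * CG + q * (C1 * N) + q * (C2 * N)"
  have "Z t = Z 0"
  proof (rule constant_if_superlinear_increments[where Y = Z and a = 0 and b = t and C = C, OF _ \<theta>])
    show "0 \<le> t" using t by simp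
    fix s r assume sr: "0 \<le> s" "s \<le> r" "r \<le> t"
    then have sr': "0 \<le> s" "s \<le> r" "r \<le> T" using t by auto
    define X where "X = (r - s) powr (\<alpha> + \<alpha>)"
    have X: "0 \<le> X" by (simp add: X_def)
    define dF where "dF = F z r - F z s"
    define dG where "dG = G z r - G z s"
    have rF: "\<bar>dF - f z s * (z r $ a - z s $ a)\<bar> \<le> q * (Cf * N) * X"
      using young_pair.integral_germ[OF Yf sr'] by (simp add: dF_def F_def q_def X_def)
    have rG: "\<bar>dG - g z s * (z r $ b - z s $ b)\<bar> \<le> q * (Cg * N) * X"
      using young_pair.integral_germ[OF Yg sr'] by (simp add: dG_def G_def q_def X_def)
    have r1: "\<bar>J1 r - J1 s - F z s * g z s * (z r $ b - z s $ b)\<bar> \<le> q * (C1 * N) * X"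
      using young_pair.integral_germ[OF Y1 sr'] by (simp add: J1_def q_def X_def)
    have r2: "\<bar>J2 r - J2 s - G z s * f z s * (z r $ a - z s $ a)\<bar> \<le> q * (C2 * N) * X"
      using young_pair.integral_germ[OF Y2 sr'] by (simp add: J2_def q_def X_def)
    have 1: "\<bar>F z s * (dG - g z s * (z r $ b - z s $ b))\<bar> \<le> CF * (q * (Cg * N) * X)"
      unfolding abs_mult using CF sr' rG by (intro mult_mono) auto
    have 2: "\<bar>G z s * (dF - f z s * (z r $ a - z s $ a))\<bar> \<le> CG * (q * (Cf * N) * X)"
      unfolding abs_mult using CG sr' rF by (intro mult_mono) auto
    have 3: "\<bar>dF * dG\<bar> \<le> CF * CG * X"
    proof -
      have "\<bar>dF * dG\<bar> \<le> (CF * (r - s) powr \<alpha>) * (CG * (r - s) powr \<alpha>)"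
        unfolding abs_mult dF_def dG_def using CF CG sr'
        by (intro mult_mono holder_onD[OF CF(2), unfolded real_norm_def] holder_onD[OF CG(2), unfolded real_norm_def]) auto
      then show ?thesis unfolding X_def powr_add by (simp add: mult_ac)
    qed
    have "Z r - Z s = F z s * (dG - g z s * (z r $ b - z s $ b)) + G z s * (dF - f z s * (z r $ a - z s $ a))
        + dF * dG - (J1 r - J1 s - F z s * g z s * (z r $ b - z s $ b))
        - (J2 r - J2 s - G z s * f z s * (z r $ a - z s $ a))"
      by (simp add: Z_def dF_def dG_def algebra_simps)
    then have "\<bar>Z r - Z s\<bar> \<le> CF * (q * (Cg * N) * X) + CG * (q * (Cf * N) * X) + CF * CG * X
        + q * (C1 * N) * X + q * (C2 * N) * X"
      using 1 2 3 r1 r2 by linarith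
    then show "\<bar>Z r - Z s\<bar> \<le> C * (r - s) powr (\<alpha> + \<alpha>)"
      by (simp add: C_def X_def algebra_simps)
  qed
  moreover have "Z 0 = 0"
    using young_pair.integral_self[OF Yf] young_pair.integral_self[OF Y1] young_pair.integral_self[OF Y2]
    by (simp add: Z_def F_def J1_def J2_def)
  ultimately show ?thesis by (simp add: Z_def J1_def J2_def)
qed

definition linear_on_signature :: "((real \<Rightarrow> real ^ 'k) \<Rightarrow> real \<Rightarrow> real) \<Rightarrow> bool"
  where "linear_on_signature P \<longleftrightarrow>
    (\<exists>l. \<forall>z\<in>regular_paths. \<forall>t\<in>{0..T}. P z t = tensor_pairing l (signature z t))"

lemma linear_on_signature_cong:
  assumes "linear_on_signature P" "\<And>z t. z \<in> regular_paths \<Longrightarrow> t \<in> {0..T} \<Longrightarrow> Q z t = P z t"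
  shows "linear_on_signature Q"
  using assms unfolding linear_on_signature_def by metis

lemma linear_on_signature_word: "linear_on_signature (\<lambda>z t. c * iterated_integral_rev z v t)"
  unfolding linear_on_signature_def
  by (intro exI[of _ "Poly_Mapping.single (rev v) c"]) (simp add: tensor_pairing_single signature_def)

lemma linear_on_signature_const: "linear_on_signature (\<lambda>_ _. c)"
  using linear_on_signature_word[of c "[]"] by simp

lemma linear_on_signature_add:
  assumes "linear_on_signature P" "linear_on_signature Q"
  shows "linear_on_signature (\<lambda>z t. P z t + Q z t)"
proof -
  obtain l where l: "\<forall>z\<in>regular_paths. \<forall>t\<in>{0..T}. P z t = tensor_pairing l (signature z t)"
    using assms(1) unfolding linear_on_signature_def by blast
  obtain l' where l': "\<forall>z\<in>regular_paths. \<forall>t\<in>{0..T}. Q z t = tensor_pairing l' (signature z t)"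
    using assms(2) unfolding linear_on_signature_def by blast
  show ?thesis
    unfolding linear_on_signature_def
    by (intro exI[of _ "l + l'"]) (use l l' in \<open>simp add: tensor_pairing_add\<close>)
qed

lemma linear_on_signature_sum:
  assumes "finite A" "\<And>v. v \<in> A \<Longrightarrow> linear_on_signature (P v)"
  shows "linear_on_signature (\<lambda>z t. \<Sum>v\<in>A. P v z t)"
  using assms
  by (induction A rule: finite_induct) (auto intro: linear_on_signature_const linear_on_signature_add)

lemma linear_on_signature_expand:
  assumes "linear_on_signature P"
  obtains A c where "finite A" "\<And>z t. z \<in> regular_paths \<Longrightarrow> t \<in> {0..T} \<Longrightarrow>
    P z t = (\<Sum>v\<in>A. c v * iterated_integral_rev z (rev v) t)"
proof -
  obtain l where l: "\<forall>z\<in>regular_paths. \<forall>t\<in>{0..T}. P z t = tensor_pairing l (signature z t)"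
    using assms unfolding linear_on_signature_def by blast
  show ?thesis
    by (rule that[of "Poly_Mapping.keys l" "Poly_Mapping.lookup l"])
      (use l in \<open>auto simp: tensor_pairing_def signature_def\<close>)
qed

lemma linear_on_signature_cmult:
  assumes "linear_on_signature P"
  shows "linear_on_signature (\<lambda>z t. r * P z t)"
proof -
  obtain A c where A: "finite A" "\<And>z t. z \<in> regular_paths \<Longrightarrow> t \<in> {0..T} \<Longrightarrow>
    P z t = (\<Sum>v\<in>A. c v * iterated_integral_rev z (rev v) t)"
    by (rule linear_on_signature_expand[OF assms]) (rule that)
  have "linear_on_signature (\<lambda>z t. \<Sum>v\<in>A. (r * c v) * iterated_integral_rev z (rev v) t)"
    by (intro linear_on_signature_sum linear_on_signature_word A)
  then show ?thesis
    by (rule linear_on_signature_cong) (simp add: A sum_distrib_left mult.assoc)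
qed

text \<open>Integration against the k-th coordinate appends the letter k to every word, at the head
  of the reversed word. Both the product rule for words and the separation of points rest on
  this.\<close>

lemma linear_on_signature_integral:
  fixes P :: "(real \<Rightarrow> real ^ 'k) \<Rightarrow> real \<Rightarrow> real"
  assumes "linear_on_signature P"
  shows "linear_on_signature (\<lambda>z t. rs_integral (P z) (\<lambda>u. z u $ k) 0 t)"
proof -
  obtain A c where A: "finite A" "\<And>z t. z \<in> regular_paths \<Longrightarrow> t \<in> {0..T} \<Longrightarrow>
    P z t = (\<Sum>v\<in>A. c v * iterated_integral_rev z (rev v) t)"
    by (rule linear_on_signature_expand[OF assms]) (rule that)
  have I: "has_rs_integral (\<lambda>u. \<Sum>v\<in>A. c v * iterated_integral_rev z (rev v) u) (\<lambda>u. z u $ k) 0 t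
      (\<Sum>v\<in>A. c v * iterated_integral_rev z (k # rev v) t)"
    if z: "z \<in> regular_paths" and t: "t \<in> {0..T}" for z t
    using A(1)
  proof (induction A rule: finite_induct)
    case empty
    show ?case using has_rs_integral_zero t by simp
  next
    case (insert v A)
    obtain C N where "young_pair 0 T \<alpha> \<alpha> C N (iterated_integral_rev z (rev v)) (\<lambda>u. z u $ k)"
      using young_pair_tame[OF tame_word z] by metis
    from young_pair.has_integral_from_start[OF this t]
    have "has_rs_integral (iterated_integral_rev z (rev v)) (\<lambda>u. z u $ k) 0 t (iterated_integral_rev z (k # rev v) t)"
      by simp
    from has_rs_integral_linear_left[OF this insert.IH, of "c v" 1] show ?case
      using insert.hyps by simp
  qed
  have "linear_on_signature (\<lambda>z t. \<Sum>v\<in>A. c v * iterated_integral_rev z (k # rev v) t)"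
    by (intro linear_on_signature_sum linear_on_signature_word A)
  then show ?thesis
  proof (rule linear_on_signature_cong)
    fix z :: "real \<Rightarrow> real ^ 'k" and t assume z: "z \<in> regular_paths" and t: "t \<in> {0..T}"
    have "rs_integral (P z) (\<lambda>u. z u $ k) 0 t =
        rs_integral (\<lambda>u. \<Sum>v\<in>A. c v * iterated_integral_rev z (rev v) u) (\<lambda>u. z u $ k) 0 t"
      by (rule rs_integral_cong) (use A(2)[OF z] t in auto)
    also have "\<dots> = (\<Sum>v\<in>A. c v * iterated_integral_rev z (k # rev v) t)"
      by (rule rs_integral_eqI[OF I[OF z t]])
    finally show "rs_integral (P z) (\<lambda>u. z u $ k) 0 t = (\<Sum>v\<in>A. c v * iterated_integral_rev z (k # rev v) t)" .
  qed
qed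

text \<open>The shuffle identity without an explicit shuffle product: integration by parts writes
  the product as the integral of v times w' against the letter b, plus that of w times v' against
  the letter a. Both products have smaller total length.\<close>

lemma linear_on_signature_word_mult:
  "linear_on_signature (\<lambda>z t. iterated_integral_rev z v t * iterated_integral_rev z w t)"
proof (induction "length v + length w" arbitrary: v w rule: less_induct)
  case less
  show ?case
  proof (cases v)
    case Nil
    then show ?thesis using linear_on_signature_word[of 1 w] by simp
  next
    case v: (Cons a v')
    show ?thesis
    proof (cases w)
      case Nil
      then show ?thesis using linear_on_signature_word[of 1 v] by simp
    next
      case w: (Cons b w')
      have 1: "linear_on_signature (\<lambda>z t. iterated_integral_rev z v t * iterated_integral_rev z w' t)"
        by (rule less) (simp add: w)
      have 2: "linear_on_signature (\<lambda>z t. iterated_integral_rev z w t * iterated_integral_rev z v' t)"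
        by (rule less) (simp add: v)
      show ?thesis
        by (rule linear_on_signature_cong[OF linear_on_signature_add[OF
              linear_on_signature_integral[OF 1, of b] linear_on_signature_integral[OF 2, of a]]])
          (use product_of_integrals[OF tame_word[of v'] tame_word[of w'], of _ _ a b] in \<open>simp add: v w\<close>)
    qed
  qed
qed

lemma linear_on_signature_mult:
  assumes "linear_on_signature P" "linear_on_signature Q"
  shows "linear_on_signature (\<lambda>z t. P z t * Q z t)"
proof -
  obtain A c where A: "finite A" "\<And>z t. z \<in> regular_paths \<Longrightarrow> t \<in> {0..T} \<Longrightarrow>
    P z t = (\<Sum>v\<in>A. c v * iterated_integral_rev z (rev v) t)"
    by (rule linear_on_signature_expand[OF assms(1)]) (rule that)
  obtain B d where B: "finite B" "\<And>z t. z \<in> regular_paths \<Longrightarrow> t \<in> {0..T} \<Longrightarrow>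
    Q z t = (\<Sum>v\<in>B. d v * iterated_integral_rev z (rev v) t)"
    by (rule linear_on_signature_expand[OF assms(2)]) (rule that)
  have "linear_on_signature (\<lambda>z t. \<Sum>v\<in>A. \<Sum>w\<in>B. (c v * d w) *
      (iterated_integral_rev z (rev v) t * iterated_integral_rev z (rev w) t))"
    by (intro linear_on_signature_sum linear_on_signature_cmult linear_on_signature_word_mult A B)
  then show ?thesis
    by (rule linear_on_signature_cong) (simp add: A B sum_product mult_ac)
qed

end

section \<open>Compact sets of Hoelder paths in the product topology\<close>

lemma open_coordinate_vimage:
  fixes U :: "'b::topological_space set"
  assumes "open U" shows "open ((\<lambda>f::'a \<Rightarrow> 'b. f i) -` U)"
  using assms continuous_on_product_coordinates[of i] by (intro open_vimage) auto

instance "fun" :: (type, t0_space) t0_space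
proof
  fix x y :: "'a \<Rightarrow> 'b" assume "x \<noteq> y"
  then obtain i where "x i \<noteq> y i" by auto
  then obtain U where "open U" "\<not> (x i \<in> U \<longleftrightarrow> y i \<in> U)" using separation_t0 by blast
  then show "\<exists>U. open U \<and> \<not> (x \<in> U \<longleftrightarrow> y \<in> U)"
    by (intro exI[of _ "(\<lambda>f. f i) -` U"] conjI open_coordinate_vimage) auto
qed

instance "fun" :: (type, t1_space) t1_space
proof
  fix x y :: "'a \<Rightarrow> 'b" assume "x \<noteq> y"
  then obtain i where "x i \<noteq> y i" by auto
  then obtain U where "open U" "x i \<in> U" "y i \<notin> U" using t1_space[OF \<open>x i \<noteq> y i\<close>] by blast
  then show "\<exists>U. open U \<and> x \<in> U \<and> y \<notin> U"
    by (intro exI[of _ "(\<lambda>f. f i) -` U"] conjI open_coordinate_vimage) auto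
qed

text \<open>Stone--Weierstrass will be applied to sets of pairs of a time and a path, viewed as
  points of a Hausdorff type. Different functions are separated in a coordinate in which they
  differ.\<close>

instance "fun" :: (type, t2_space) t2_space
proof
  fix x y :: "'a \<Rightarrow> 'b" assume "x \<noteq> y"
  then obtain i where "x i \<noteq> y i" by auto
  then obtain U V where UV: "open U" "open V" "x i \<in> U" "y i \<in> V" "U \<inter> V = {}"
    using hausdorff[OF \<open>x i \<noteq> y i\<close>] by blast
  then show "\<exists>U V. open U \<and> open V \<and> x \<in> U \<and> y \<in> V \<and> U \<inter> V = {}"
    by (intro exI[of _ "(\<lambda>f. f i) -` U"] exI[of _ "(\<lambda>f. f i) -` V"] conjI open_coordinate_vimage) auto
qed

definition holder_ball :: "real \<Rightarrow> real \<Rightarrow> real \<Rightarrow> 'a set \<Rightarrow> (real \<Rightarrow> 'a::real_normed_vector) set"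
  where "holder_ball T \<gamma> M V = {y \<in> extensional {0..T}. holder_on 0 T \<gamma> M y \<and> y 0 \<in> V}"

text \<open>Each of the inequalities involves only two coordinates, so pointwise limits preserve
  it.\<close>

lemma closed_holder_on: "closed {y :: real \<Rightarrow> 'a::real_normed_vector. holder_on 0 T \<gamma> M y}"
  unfolding holder_on_def
  by (intro closed_Collect_all closed_Collect_imp closed_Collect_le open_Collect_const continuous_intros
      continuous_on_product_coordinates)

text \<open>Tychonoff's theorem in place of Arzela--Ascoli: the Hoelder bound confines every
  coordinate to a compact set, and the ball is closed in the resulting product.\<close>

lemma compact_holder_ball:
  fixes V :: "'a::euclidean_space set"
  assumes V: "compact V" and "0 \<le> T" "0 \<le> M" "0 \<le> \<gamma>"
  shows "compact (holder_ball T \<gamma> M V)"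
proof -
  obtain B where B: "\<And>v. v \<in> V \<Longrightarrow> norm v \<le> B"
    using compact_imp_bounded[OF V] by (auto simp: bounded_iff)
  \<comment> \<open>Outside [0,T] the singleton of \<open>undefined\<close> encodes extensionality,
    so the product can be taken over all of the reals.\<close>
  define S where "S = (\<lambda>r. if r \<in> {0..T} then cball 0 (B + M * T powr \<gamma>) else {undefined :: 'a})"
  have "compactin (product_topology (\<lambda>_. euclidean) UNIV) (PiE UNIV S)"
    unfolding compactin_PiE by (auto simp: S_def)
  then have c: "compact (PiE UNIV S)"
    by (simp add: euclidean_product_topology)
  have "closed {y :: real \<Rightarrow> 'a. y 0 \<in> V}"
    using closed_vimage[OF compact_imp_closed[OF V] continuous_on_product_coordinates[of 0]]
    by (simp add: vimage_def)
  then have cl: "closed ({y :: real \<Rightarrow> 'a. holder_on 0 T \<gamma> M y} \<inter> {y. y 0 \<in> V})"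
    by (intro closed_Int closed_holder_on)
  have "holder_ball T \<gamma> M V = PiE UNIV S \<inter> ({y. holder_on 0 T \<gamma> M y} \<inter> {y. y 0 \<in> V})"
  proof (intro equalityI subsetI)
    fix y assume y: "y \<in> holder_ball T \<gamma> M V"
    have "y r \<in> S r" for r
    proof (cases "r \<in> {0..T}")
      case True
      have "norm (y r - y 0) \<le> M * (r - 0) powr \<gamma>"
        using y True unfolding holder_ball_def by (intro holder_onD[of 0 T]) auto
      also have "\<dots> \<le> M * T powr \<gamma>" using True assms by (intro mult_left_mono powr_mono2) auto
      finally have "norm (y r) \<le> norm (y 0) + M * T powr \<gamma>"
        using norm_triangle_sub[of "y r" "y 0"] by linarith
      then show ?thesis using True B[of "y 0"] y by (auto simp: S_def holder_ball_def)
    next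
      case False
      then show ?thesis using y by (auto simp: S_def holder_ball_def extensional_def)
    qed
    then show "y \<in> PiE UNIV S \<inter> ({y. holder_on 0 T \<gamma> M y} \<inter> {y. y 0 \<in> V})"
      using y by (auto simp: holder_ball_def)
  next
    fix y assume y: "y \<in> PiE UNIV S \<inter> ({y. holder_on 0 T \<gamma> M y} \<inter> {y. y 0 \<in> V})"
    have "y r = undefined" if "r \<notin> {0..T}" for r
    proof -
      have "y r \<in> S r" using y by auto
      then show ?thesis using that by (simp add: S_def del: atLeastAtMost_iff)
    qed
    then show "y \<in> holder_ball T \<gamma> M V" using y by (auto simp: holder_ball_def extensional_def)
  qed
  then show ?thesis using compact_Int_closed[OF c cl] by simp
qed

text \<open>On an equicontinuous set the product topology is as fine as that of uniform convergence, because
  finitely many coordinates control all of them.\<close>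

lemma holder_ball_finite_control:
  fixes V :: "'a::real_normed_vector set"
  assumes "0 \<le> T" "0 < \<gamma>" "0 \<le> M" "0 < \<delta>"
  shows "\<exists>Q. finite Q \<and> (\<forall>y\<in>holder_ball T \<gamma> M V. \<forall>z\<in>holder_ball T \<gamma> M V.
    (\<forall>q\<in>Q. norm (y q - z q) < \<delta> / 3) \<longrightarrow> (\<forall>r\<in>{0..T}. norm (y r - z r) < \<delta>))"
proof -
  define d where "d = (\<delta> / (3 * (M + 1))) powr (1 / \<gamma>)"
  have d: "0 < d" using assms by (simp add: d_def)
  have Md: "M * d powr \<gamma> \<le> \<delta> / 3"
  proof -
    have "d powr \<gamma> = \<delta> / (3 * (M + 1))" using assms by (simp add: d_def powr_powr)
    then have "M * d powr \<gamma> = (M / (M + 1)) * (\<delta> / 3)" by simp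
    also have "\<dots> \<le> 1 * (\<delta> / 3)" using assms by (intro mult_right_mono) auto
    finally show ?thesis by simp
  qed
  obtain Q where Q: "finite Q" "Q \<subseteq> {0..T}" "{0..T} \<subseteq> (\<Union>q\<in>Q. ball q d)"
    by (rule compactE_image[of "{0..T}" "{0..T}" "\<lambda>q. ball q d"]) (use d in auto)
  have osc: "norm (y r - y q) \<le> \<delta> / 3"
    if y: "y \<in> holder_ball T \<gamma> M V" and q: "q \<in> {0..T}" "r \<in> {0..T}" "\<bar>r - q\<bar> \<le> d" for y q r
  proof -
    have "norm (y (max q r) - y (min q r)) \<le> M * (max q r - min q r) powr \<gamma>"
      using y q unfolding holder_ball_def by (intro holder_onD[of 0 T]) auto
    also have "\<dots> \<le> M * d powr \<gamma>" using q assms by (intro mult_left_mono powr_mono2) auto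
    finally show ?thesis using Md by (cases "q \<le> r") (auto simp: max_def min_def norm_minus_commute)
  qed
  show ?thesis
  proof (intro exI[of _ Q] conjI Q(1) ballI impI)
    fix y z r
    assume y: "y \<in> holder_ball T \<gamma> M V" and z: "z \<in> holder_ball T \<gamma> M V"
      and yz: "\<forall>q\<in>Q. norm (y q - z q) < \<delta> / 3" and r: "r \<in> {0..T}"
    obtain q where q: "q \<in> Q" "dist q r < d" using Q(3) r by auto
    have q': "q \<in> {0..T}" "\<bar>r - q\<bar> \<le> d" using q Q(2) by (auto simp: dist_real_def)
    have 1: "norm (y r - y q) \<le> \<delta> / 3" by (rule osc[OF y q'(1) r q'(2)])
    have 2: "norm (z r - z q) \<le> \<delta> / 3" by (rule osc[OF z q'(1) r q'(2)])
    have "norm (y r - z r) = norm ((y r - y q) + (y q - z q) - (z r - z q))" by (simp add: algebra_simps)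
    also have "\<dots> \<le> norm (y r - y q) + norm (y q - z q) + norm (z r - z q)"
      by (meson norm_triangle_ineq norm_triangle_ineq4 order_trans add_right_mono)
    finally show "norm (y r - z r) < \<delta>" using 1 2 yz[rule_format, OF q(1)] by linarith
  qed
qed

text \<open>All continuity claims on path space pass through this criterion: estimates are naturally
  uniform in time, and by \<open>holder_ball_finite_control\<close> a neighbourhood in finitely many
  coordinates is enough to enforce them.\<close>

lemma continuous_on_holder_ball:
  fixes V :: "'a::real_normed_vector set" and F :: "real \<times> (real \<Rightarrow> 'a) \<Rightarrow> 'b::metric_space"
  assumes "0 \<le> T" "0 < \<gamma>" "0 \<le> M" and S: "S \<subseteq> UNIV \<times> holder_ball T \<gamma> M V"
    and unif: "\<And>\<epsilon>. 0 < \<epsilon> \<Longrightarrow> \<exists>\<delta>>0. \<forall>t y s z. (t, y) \<in> S \<longrightarrow> (s, z) \<in> S \<longrightarrow> \<bar>t - s\<bar> < \<delta> \<longrightarrow>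
      (\<forall>r\<in>{0..T}. norm (y r - z r) < \<delta>) \<longrightarrow> dist (F (t, y)) (F (s, z)) < \<epsilon>"
  shows "continuous_on S F"
  unfolding continuous_on_topological
proof (intro ballI allI impI)
  fix x B assume x: "x \<in> S" and B: "open B" "F x \<in> B"
  obtain s z where sz: "x = (s, z)" by (cases x)
  obtain \<epsilon> where \<epsilon>: "0 < \<epsilon>" "\<And>b. dist b (F x) < \<epsilon> \<Longrightarrow> b \<in> B" using B open_dist by metis
  obtain \<delta> where \<delta>: "0 < \<delta>" "\<forall>t y s z. (t, y) \<in> S \<longrightarrow> (s, z) \<in> S \<longrightarrow> \<bar>t - s\<bar> < \<delta> \<longrightarrow>
      (\<forall>r\<in>{0..T}. norm (y r - z r) < \<delta>) \<longrightarrow> dist (F (t, y)) (F (s, z)) < \<epsilon>"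
    using unif[OF \<epsilon>(1)] by blast
  obtain Q where Q: "finite Q" "\<forall>y\<in>holder_ball T \<gamma> M V. \<forall>z\<in>holder_ball T \<gamma> M V.
    (\<forall>q\<in>Q. norm (y q - z q) < \<delta> / 3) \<longrightarrow> (\<forall>r\<in>{0..T}. norm (y r - z r) < \<delta>)"
    using holder_ball_finite_control[where V = V, OF assms(1-3) \<delta>(1)] by blast
  define A where "A = ball s \<delta> \<times> (\<Inter>q\<in>Q. (\<lambda>y. y q) -` ball (z q) (\<delta> / 3))"
  have "open A"
    unfolding A_def using Q(1) by (intro open_Times open_INT ballI open_coordinate_vimage) auto
  moreover have "x \<in> A" using \<delta>(1) by (simp add: sz A_def)
  moreover have "F p \<in> B" if p: "p \<in> S" "p \<in> A" for p
  proof -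
    obtain t y where ty: "p = (t, y)" by (cases p)
    have "\<bar>t - s\<bar> < \<delta>" and near: "\<forall>q\<in>Q. norm (y q - z q) < \<delta> / 3"
      using p by (auto simp: A_def ty dist_norm norm_minus_commute)
    moreover have "norm (y r - z r) < \<delta>" if "r \<in> {0..T}" for r
      by (rule Q(2)[rule_format, OF _ _ near[rule_format] that]) (use p x S in \<open>auto simp: ty sz\<close>)
    ultimately have "dist (F p) (F x) < \<epsilon>" using \<delta>(2) p x unfolding ty sz by blast
    then show ?thesis by (rule \<epsilon>(2))
  qed
  ultimately show "\<exists>A. open A \<and> x \<in> A \<and> (\<forall>y\<in>S. y \<in> A \<longrightarrow> F y \<in> B)" by blast
qed

text \<open>The increments are at most 2 * \<delta> and at most C *
  \<open>(t - s) powr \<gamma>\<close>; interpolating between the two with weight \<gamma>' /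
  \<gamma> makes uniform smallness visible in the weaker Hoelder seminorm.\<close>

lemma holder_on_interpolate:
  fixes d :: "real \<Rightarrow> 'a::real_normed_vector"
  assumes d: "holder_on a b \<gamma> C d" and small: "\<And>r. r \<in> {a..b} \<Longrightarrow> norm (d r) \<le> \<delta>"
    and "0 \<le> C" "0 < \<gamma>'" "\<gamma>' \<le> \<gamma>"
  shows "holder_on a b \<gamma>' (C powr (\<gamma>' / \<gamma>) * (2 * \<delta>) powr (1 - \<gamma>' / \<gamma>)) d"
  unfolding holder_on_def
proof (intro allI impI)
  fix s t assume st: "a \<le> s" "s < t" "t \<le> b"
  have "norm (d t - d s) \<le> norm (d t) + norm (d s)" by (rule norm_triangle_ineq4)
  then have 1: "norm (d t - d s) \<le> 2 * \<delta>" using small[of t] small[of s] st by auto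
  have "norm (d t - d s) \<le> C powr (\<gamma>' / \<gamma>) * (2 * \<delta>) powr (1 - \<gamma>' / \<gamma>) * ((t - s) powr \<gamma>) powr (\<gamma>' / \<gamma>)"
    using assms st 1 holder_onD[OF d, of s t] by (intro powr_interpolation) auto
  then show "norm (d t - d s) \<le> C powr (\<gamma>' / \<gamma>) * (2 * \<delta>) powr (1 - \<gamma>' / \<gamma>) * (t - s) powr \<gamma>'"
    using assms by (simp add: powr_powr)
qed

lemma small_interpolation_constant:
  fixes C \<gamma> \<gamma>' \<epsilon> :: real
  assumes "0 \<le> C" "0 < \<gamma>'" "\<gamma>' < \<gamma>" "0 < \<epsilon>"
  shows "\<exists>\<delta>>0. C powr (\<gamma>' / \<gamma>) * (2 * \<delta>) powr (1 - \<gamma>' / \<gamma>) \<le> \<epsilon> \<and> \<delta> \<le> \<epsilon>"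
proof -
  define \<theta> where "\<theta> = 1 - \<gamma>' / \<gamma>"
  have \<theta>: "0 < \<theta>" using assms by (simp add: \<theta>_def)
  define D where "D = C powr (\<gamma>' / \<gamma>)"
  have D: "0 \<le> D" by (simp add: D_def)
  define \<delta> where "\<delta> = min \<epsilon> ((\<epsilon> / (D + 1)) powr (1 / \<theta>) / 2)"
  have \<delta>: "0 < \<delta>" "\<delta> \<le> \<epsilon>" using assms D by (auto simp: \<delta>_def)
  have "(2 * \<delta>) powr \<theta> \<le> ((\<epsilon> / (D + 1)) powr (1 / \<theta>)) powr \<theta>"
    using \<theta> \<delta> by (intro powr_mono2) (auto simp: \<delta>_def)
  also have "\<dots> = \<epsilon> / (D + 1)" using \<theta> assms D by (simp add: powr_powr)
  finally have "D * (2 * \<delta>) powr \<theta> \<le> D * (\<epsilon> / (D + 1))" using D by (intro mult_left_mono) auto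
  also have "\<dots> \<le> \<epsilon>" using D assms by (simp add: field_simps)
  finally show ?thesis using \<delta> by (auto simp: D_def \<theta>_def)
qed

section \<open>Compact balls of Lipschitz paths and admissible weights\<close>

lemma holder_dist_le:
  assumes "holder_on 0 T \<gamma> C (\<lambda>t. y t - z t)" "0 \<le> C"
  shows "holder_dist \<gamma> T y z \<le> norm (y 0 - z 0) + C"
proof -
  have "holder_seminorm \<gamma> T (\<lambda>t. y t - z t) \<le> ennreal C"
    using holder_seminorm_le_holder_on[OF assms(2)] assms(1) by blast
  then show ?thesis by (simp add: holder_dist_def holder_norm_def enn2real_leI assms(2))
qed

lemma holder_norm_le_iff:
  fixes x :: "real \<Rightarrow> 'a::real_normed_vector"
  assumes "x \<in> holder_paths \<gamma> T"
  shows "holder_norm \<gamma> T x \<le> R \<longleftrightarrow> norm (x 0) \<le> R \<and> holder_on 0 T \<gamma> (R - norm (x 0)) x"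
proof -
  have fin: "holder_seminorm \<gamma> T x < \<infinity>" using assms by (simp add: holder_paths_def)
  show ?thesis
  proof
    assume R: "holder_norm \<gamma> T x \<le> R"
    then have 1: "enn2real (holder_seminorm \<gamma> T x) \<le> R - norm (x 0)" by (simp add: holder_norm_def)
    then have 0: "norm (x 0) \<le> R" using enn2real_nonneg[of "holder_seminorm \<gamma> T x"] by linarith
    have "holder_seminorm \<gamma> T x = ennreal (enn2real (holder_seminorm \<gamma> T x))" using fin by simp
    also have "\<dots> \<le> ennreal (R - norm (x 0))" using 1 by (rule ennreal_leI)
    finally show "norm (x 0) \<le> R \<and> holder_on 0 T \<gamma> (R - norm (x 0)) x"
      using holder_seminorm_le_holder_on[of "R - norm (x 0)" \<gamma> T x] 0 by simp
  next
    assume R: "norm (x 0) \<le> R \<and> holder_on 0 T \<gamma> (R - norm (x 0)) x"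
    then have "holder_seminorm \<gamma> T x \<le> ennreal (R - norm (x 0))"
      using holder_seminorm_le_holder_on[of "R - norm (x 0)" \<gamma> T x] by simp
    then show "holder_norm \<gamma> T x \<le> R"
      using R enn2real_leI[of "R - norm (x 0)" "holder_seminorm \<gamma> T x"] by (simp add: holder_norm_def)
  qed
qed

text \<open>A Lipschitz bound lets uniform closeness control the \<eta>-Hoelder distance for \<eta>
  < 1, so on the ball the product topology is at least as fine as the metric one, and compactness
  passes from the former to the latter.\<close>

lemma compact_holder_norm_ball:
  assumes "0 \<le> T" "0 < \<eta>" "\<eta> < 1"
  shows "compactin (lipschitz_path_topology \<eta> T)
    {x \<in> holder_paths 1 T. holder_norm 1 T (x :: real \<Rightarrow> 'a::euclidean_space) \<le> R}"
proof (cases "0 \<le> R")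
  case True
  interpret Metric_space "holder_paths 1 T :: (real \<Rightarrow> 'a) set" "holder_dist \<eta> T"
    by (rule Metric_space_lipschitz_paths) (use assms in auto)
  define B where "B = {x \<in> holder_paths 1 T. holder_norm 1 T (x :: real \<Rightarrow> 'a) \<le> R}"
  define H where "H = holder_ball T 1 R (cball 0 R :: 'a set)"
  \<comment> \<open>The norm couples the starting value with the Lipschitz constant, so B is not of
    the form \<open>holder_ball\<close> but a closed part of the larger ball H.\<close>
  have Beq: "B = H \<inter> {x. \<forall>s t. 0 \<le> s \<longrightarrow> s < t \<longrightarrow> t \<le> T \<longrightarrow> norm (x t - x s) \<le> (R - norm (x 0)) * (t - s) powr 1}"
  proof (intro equalityI subsetI)
    fix x assume x: "x \<in> B"
    then have p: "x \<in> holder_paths 1 T" by (simp add: B_def)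
    with x have n: "norm (x 0) \<le> R" "holder_on 0 T 1 (R - norm (x 0)) x"
      using holder_norm_le_iff[OF p] by (auto simp: B_def)
    have "holder_on 0 T 1 R x" by (rule holder_on_mono[OF n(2)]) simp
    then show "x \<in> H \<inter> {x. \<forall>s t. 0 \<le> s \<longrightarrow> s < t \<longrightarrow> t \<le> T \<longrightarrow> norm (x t - x s) \<le> (R - norm (x 0)) * (t - s) powr 1}"
      using p n by (auto simp: H_def holder_ball_def holder_paths_def holder_on_def)
  next
    fix x assume x: "x \<in> H \<inter> {x. \<forall>s t. 0 \<le> s \<longrightarrow> s < t \<longrightarrow> t \<le> T \<longrightarrow> norm (x t - x s) \<le> (R - norm (x 0)) * (t - s) powr 1}"
    then have "x \<in> holder_paths 1 T"
      using True by (intro holder_pathsI[of _ _ _ R]) (auto simp: H_def holder_ball_def)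
    moreover have "holder_on 0 T 1 (R - norm (x 0)) x" "norm (x 0) \<le> R"
      using x by (auto simp: holder_on_def H_def holder_ball_def)
    ultimately show "x \<in> B" using holder_norm_le_iff by (auto simp: B_def)
  qed
  have "closed {x :: real \<Rightarrow> 'a. \<forall>s t. 0 \<le> s \<longrightarrow> s < t \<longrightarrow> t \<le> T \<longrightarrow> norm (x t - x s) \<le> (R - norm (x 0)) * (t - s) powr 1}"
    by (intro closed_Collect_all closed_Collect_imp closed_Collect_le open_Collect_const continuous_intros
        continuous_on_product_coordinates)
  then have "compact B"
    unfolding Beq H_def using assms True by (intro compact_Int_closed compact_holder_ball) auto
  \<comment> \<open>Continuity of the identity from the product topology to the metric topology; B
    is then compact as its own image.\<close>
  have "continuous_map (top_of_set B) mtopology (\<lambda>x. x)"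
    unfolding continuous_map_to_metric
  proof (intro ballI allI impI)
    fix x and \<epsilon> :: real assume x: "x \<in> topspace (top_of_set B)" and \<epsilon>: "0 < \<epsilon>"
    have xB: "x \<in> B" using x by simp
    have BH: "B \<subseteq> H" using Beq by auto
    obtain \<delta> where \<delta>: "0 < \<delta>" "(R + R) powr (\<eta> / 1) * (2 * \<delta>) powr (1 - \<eta> / 1) \<le> \<epsilon> / 3" "\<delta> \<le> \<epsilon> / 3"
      using small_interpolation_constant[of "R + R" \<eta> 1 "\<epsilon> / 3"] True assms \<epsilon> by auto
    obtain Q where Q: "finite Q" "\<forall>y\<in>H. \<forall>z\<in>H.
      (\<forall>q\<in>Q. norm (y q - z q) < \<delta> / 3) \<longrightarrow> (\<forall>r\<in>{0..T}. norm (y r - z r) < \<delta>)"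
      using holder_ball_finite_control[where V = "cball 0 R :: 'a set", OF assms(1) zero_less_one True \<delta>(1)]
      unfolding H_def by blast
    define A where "A = (\<Inter>q\<in>Q. (\<lambda>y. y q) -` ball (x q) (\<delta> / 3))"
    have "open A" unfolding A_def using Q(1) by (intro open_INT ballI open_coordinate_vimage) auto
    then have "openin (top_of_set B) (B \<inter> A)" by (rule openin_open_Int)
    moreover have "x \<in> B \<inter> A" using xB \<delta>(1) by (simp add: A_def)
    moreover have "z \<in> mball x \<epsilon>" if z: "z \<in> B \<inter> A" for z
    proof -
      have near: "norm (x r - z r) < \<delta>" if "r \<in> {0..T}" for r
        by (rule Q(2)[rule_format, OF _ _ _ that]) (use z xB BH in \<open>auto simp: A_def dist_norm\<close>)
      have "holder_on 0 T 1 (R + R) (\<lambda>t. x t - z t)"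
        using xB z BH by (intro holder_on_diff) (auto simp: H_def holder_ball_def)
      then have "holder_on 0 T \<eta> ((R + R) powr (\<eta> / 1) * (2 * \<delta>) powr (1 - \<eta> / 1)) (\<lambda>t. x t - z t)"
        by (rule holder_on_interpolate) (use near True assms in \<open>auto intro: less_imp_le\<close>)
      from holder_dist_le[OF this] have "holder_dist \<eta> T x z \<le> norm (x 0 - z 0) +
          (R + R) powr (\<eta> / 1) * (2 * \<delta>) powr (1 - \<eta> / 1)" by simp
      then have "holder_dist \<eta> T x z < \<epsilon>" using \<delta> near[of 0] assms \<epsilon> by auto
      then show ?thesis using xB z by (auto simp: B_def mball_def)
    qed
    ultimately show "\<exists>U. openin (top_of_set B) U \<and> x \<in> U \<and> (\<forall>y\<in>U. y \<in> mball x \<epsilon>)" by blast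
  qed
  then have "compactin mtopology ((\<lambda>x. x) ` B)"
    by (rule image_compactin[rotated]) (use \<open>compact B\<close> in \<open>simp add: compactin_subtopology\<close>)
  then show ?thesis by (simp add: B_def lipschitz_path_topology_def)
next
  case False
  have "0 \<le> holder_norm 1 T x" for x :: "real \<Rightarrow> 'a" by (simp add: holder_norm_def)
  then have e: "{x \<in> holder_paths 1 T. holder_norm 1 T (x :: real \<Rightarrow> 'a) \<le> R} = {}"
  proof -
    have "\<not> holder_norm 1 T x \<le> R" for x :: "real \<Rightarrow> 'a"
      using False \<open>\<And>x :: real \<Rightarrow> 'a. 0 \<le> holder_norm 1 T x\<close>[of x] by linarith
    then show ?thesis by simp
  qed
  show ?thesis unfolding e by simp
qed

text \<open>The hypothesis \<open>sub\<close> makes every sublevel set of b on [0, \<infinity>) a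
  closed initial segment (with r < 0 for the empty one), so the sublevel sets of the weight are norm
  balls, which are compact. Suitable step functions qualify as well as continuous ones.\<close>

lemma admissible_weight_norm:
  fixes b :: "real \<Rightarrow> real"
  assumes "0 \<le> T" "0 < \<eta>" "\<eta> < 1" and pos: "\<And>s. 0 \<le> s \<Longrightarrow> 0 < b s"
    and sub: "\<And>R. \<exists>r. \<forall>s\<ge>0. b s \<le> R \<longleftrightarrow> s \<le> r"
  shows "admissible_weight (lipschitz_path_topology \<eta> T) (\<lambda>x. b (holder_norm 1 T (x :: real \<Rightarrow> 'a::euclidean_space)))"
proof -
  interpret Metric_space "holder_paths 1 T :: (real \<Rightarrow> 'a) set" "holder_dist \<eta> T"
    by (rule Metric_space_lipschitz_paths) (use assms in auto)
  have n: "0 \<le> holder_norm 1 T x" for x :: "real \<Rightarrow> 'a" by (simp add: holder_norm_def)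
  have top: "lipschitz_path_topology \<eta> T = mtopology" by (simp add: lipschitz_path_topology_def)
  show ?thesis
    unfolding admissible_weight_def
  proof (intro conjI ballI allI impI)
    show "completely_regular_space (lipschitz_path_topology \<eta> T :: (real \<Rightarrow> 'a) topology)"
      unfolding top by (intro metrizable_imp_completely_regular_space metrizable_space_mtopology)
    show "Hausdorff_space (lipschitz_path_topology \<eta> T :: (real \<Rightarrow> 'a) topology)" unfolding top by (rule Hausdorff_space_mtopology)
    fix R :: real
    obtain r where "\<forall>s\<ge>0. b s \<le> R \<longleftrightarrow> s \<le> r" using sub by blast
    then have "{x \<in> topspace (lipschitz_path_topology \<eta> T). b (holder_norm 1 T (x :: real \<Rightarrow> 'a)) \<le> R} =
        {x \<in> holder_paths 1 T. holder_norm 1 T (x :: real \<Rightarrow> 'a) \<le> r}"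
      unfolding top using n by auto
    then show "compactin (lipschitz_path_topology \<eta> T) {x \<in> topspace (lipschitz_path_topology \<eta> T). b (holder_norm 1 T (x :: real \<Rightarrow> 'a)) \<le> R}"
      using compact_holder_norm_ball[OF assms(1-3)] by simp
  qed (use n pos in auto)
qed

section \<open>Density of linear functionals of the signature\<close>

lemma time_augmented_None [simp]: "time_augmented y t $ None = t"
  and time_augmented_Some [simp]: "time_augmented y t $ Some i = y t $ i"
  by (simp_all add: time_augmented_def)

text \<open>The bridge from signature words ending in the time letter to ordinary integrals, where
  orthogonality to polynomials can be exploited.\<close>

lemma has_rs_integral_id:
  assumes "a \<le> b" and g: "continuous_on {a..b} g"
  shows "has_rs_integral g (\<lambda>u. u) a b (integral {a..b} g)"
proof -
  have "has_rs_integral g (\<lambda>u. u) a b (integral {a..b} g - integral {a..a} g)"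
  proof (rule has_rs_integral_germ[OF assms(1)])
    fix \<epsilon> :: real assume \<epsilon>: "0 < \<epsilon>"
    have "uniformly_continuous_on {a..b} g"
      using g by (intro compact_uniformly_continuous) auto
    then obtain \<delta> where \<delta>: "\<delta> > 0" "\<And>x y. x \<in> {a..b} \<Longrightarrow> y \<in> {a..b} \<Longrightarrow> dist y x < \<delta> \<Longrightarrow> dist (g y) (g x) < \<epsilon>"
      using \<epsilon> unfolding uniformly_continuous_on_def by metis
    have "\<bar>integral {a..t} g - integral {a..s} g - g u * (t - s)\<bar> \<le> \<epsilon> * (t - s)"
      if u: "a \<le> s \<and> s \<le> u \<and> u \<le> t \<and> t \<le> b \<and> t - s < \<delta>" for s u t
    proof -
      have st: "s \<le> t" using u by linarith
      have sub: "{s..t} \<subseteq> {a..b}" using u by auto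
      have "integral {a..s} g + integral {s..t} g = integral {a..t} g"
      proof (rule Henstock_Kurzweil_Integration.integral_combine)
        show "g integrable_on {a..t}"
          by (rule integrable_continuous_real[OF continuous_on_subset[OF g]]) (use u in auto)
      qed (use u in auto)
      moreover have gi: "g integrable_on {s..t}"
        by (rule integrable_continuous_real[OF continuous_on_subset[OF g sub]])
      have "integral {s..t} (\<lambda>r. g r - g u) = integral {s..t} g - g u * (t - s)"
        using integral_diff[OF gi integrable_const_ivl[of "g u" s t]] st by simp
      moreover have "norm (integral {s..t} (\<lambda>r. g r - g u)) \<le> \<epsilon> * (t - s)"
      proof (rule integral_bound[OF st])
        show "continuous_on {s..t} (\<lambda>r. g r - g u)"
          by (intro continuous_intros continuous_on_subset[OF g sub])
        fix r assume "r \<in> {s..t}"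
        then have "dist (g r) (g u) < \<epsilon>" using u by (intro \<delta>(2)) (auto simp: dist_real_def)
        then show "norm (g r - g u) \<le> \<epsilon>" by (simp add: dist_norm)
      qed
      ultimately show ?thesis by simp
    qed
    then show "\<exists>\<delta>>0. \<forall>s u t. a \<le> s \<and> s \<le> u \<and> u \<le> t \<and> t \<le> b \<and> t - s < \<delta> \<longrightarrow>
        \<bar>integral {a..t} g - integral {a..s} g - g u * (t - s)\<bar> \<le> \<epsilon> * (t - s)"
      using \<delta>(1) by blast
  qed
  then show ?thesis by simp
qed

text \<open>For a polynomial p uniformly close to g, the integral of g * g equals that of (g - p) *
  g and is therefore arbitrarily small.\<close>

lemma continuous_orthogonal_to_polynomials:
  fixes g :: "real \<Rightarrow> real"
  assumes "0 < t" and g: "continuous_on {0..t} g"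
    and orth: "\<And>p. real_polynomial_function p \<Longrightarrow> integral {0..t} (\<lambda>u. p u * g u) = 0"
    and u: "u \<in> {0..t}"
  shows "g u = 0"
proof -
  obtain B where B: "0 \<le> B" "\<And>r. r \<in> {0..t} \<Longrightarrow> \<bar>g r\<bar> \<le> B"
  proof -
    have "bounded (g ` {0..t})" using g by (intro compact_imp_bounded compact_continuous_image) auto
    then obtain B where "\<forall>r\<in>{0..t}. norm (g r) \<le> B" by (auto simp: bounded_iff)
    then show ?thesis by (intro that[of "max B 0"]) (auto simp: le_max_iff_disj)
  qed
  have "integral {0..t} (\<lambda>u. g u * g u) \<le> 0 + e" if "0 < e" for e
  proof -
    define \<epsilon> where "\<epsilon> = e / (B * t + 1)"
    have Bt: "0 < B * t + 1" using B assms(1) by (simp add: add_nonneg_pos)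
    have \<epsilon>: "0 < \<epsilon>" using that Bt by (simp add: \<epsilon>_def)
    obtain p where p: "real_polynomial_function p" "\<And>r. r \<in> {0..t} \<Longrightarrow> \<bar>g r - p r\<bar> < \<epsilon>"
      by (rule Stone_Weierstrass_real_polynomial_function[OF compact_Icc g \<epsilon>]) (rule that)
    have pc: "continuous_on {0..t} p"
      using p(1) by (intro continuous_at_imp_continuous_on ballI continuous_real_polymonial_function)
    have i1: "(\<lambda>u. g u * g u) integrable_on {0..t}" and i2: "(\<lambda>u. p u * g u) integrable_on {0..t}"
      by (intro integrable_continuous_real continuous_intros g pc)+
    have "integral {0..t} (\<lambda>u. g u * g u) = integral {0..t} (\<lambda>u. g u * g u - p u * g u)"
      using integral_diff[OF i1 i2] orth[OF p(1)] by simp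
    also have "norm \<dots> \<le> (\<epsilon> * B) * (t - 0)"
    proof (rule integral_bound)
      show "continuous_on {0..t} (\<lambda>u. g u * g u - p u * g u)" by (intro continuous_intros g pc)
      fix r assume r: "r \<in> {0..t}"
      have "\<bar>g r - p r\<bar> * \<bar>g r\<bar> \<le> \<epsilon> * B" using p(2)[OF r] B(2)[OF r] \<epsilon> by (intro mult_mono) auto
      then show "norm (g r * g r - p r * g r) \<le> \<epsilon> * B" by (simp add: abs_mult flip: left_diff_distrib)
    qed (use assms in auto)
    also have "\<dots> \<le> \<epsilon> * (B * t + 1)" using \<epsilon> by (simp add: algebra_simps)
    also have "\<dots> = e" using Bt by (simp add: \<epsilon>_def)
    finally show ?thesis by simp
  qed
  then have "integral {0..t} (\<lambda>u. g u * g u) \<le> 0" by (rule field_le_epsilon)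
  moreover have "0 \<le> integral {0..t} (\<lambda>u. g u * g u)"
    by (intro integral_nonneg integrable_continuous_real continuous_intros g) auto
  ultimately have "integral {0..t} (\<lambda>u. g u * g u) = 0" by simp
  then have "\<forall>r\<in>{0..t}. g r * g r = 0"
    using integral_eq_0_iff[of 0 t "\<lambda>u. g u * g u"] assms(1) continuous_on_mult[OF g g] by simp
  then show ?thesis using u by simp
qed

lemma modulus_exists:
  fixes M \<alpha> \<epsilon> :: real
  assumes "0 \<le> M" "0 < \<alpha>" "0 < \<epsilon>"
  shows "\<exists>\<delta>>0. M * \<delta> powr \<alpha> + \<delta> < \<epsilon>"
proof -
  define \<delta> where "\<delta> = min (\<epsilon> / 4) ((\<epsilon> / (2 * (M + 1))) powr (1 / \<alpha>))"
  have \<delta>: "0 < \<delta>" "\<delta> \<le> \<epsilon> / 4" using assms by (auto simp: \<delta>_def)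
  have "\<delta> powr \<alpha> \<le> ((\<epsilon> / (2 * (M + 1))) powr (1 / \<alpha>)) powr \<alpha>"
    using assms \<delta> by (intro powr_mono2) (auto simp: \<delta>_def)
  also have "\<dots> = \<epsilon> / (2 * (M + 1))" using assms by (simp add: powr_powr)
  finally have "M * \<delta> powr \<alpha> \<le> M * (\<epsilon> / (2 * (M + 1)))" using assms by (intro mult_left_mono) auto
  also have "\<dots> = (M / (M + 1)) * (\<epsilon> / 2)" by simp
  also have "\<dots> \<le> 1 * (\<epsilon> / 2)" using assms by (intro mult_right_mono) auto
  finally show ?thesis using \<delta> assms by (intro exI[of _ \<delta>]) auto
qed

lemma holder_onD_abs:
  assumes "holder_on a b \<gamma> C g" "s \<in> {a..b}" "t \<in> {a..b}"
  shows "norm (g t - g s) \<le> C * \<bar>t - s\<bar> powr \<gamma>"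
proof (cases "s \<le> t")
  case True
  then show ?thesis using holder_onD[OF assms(1), of s t] assms by auto
next
  case False
  then show ?thesis using holder_onD[OF assms(1), of t s] assms by (auto simp: norm_minus_commute)
qed

section \<open>Compactness of sets of stopped paths\<close>

lemma stopped_path_in_ball:
  assumes y: "y \<in> holder_ball T \<gamma> M V" and t: "t \<in> {0..T}" and "0 \<le> M" "0 < \<gamma>"
  shows "stopped_path T y t \<in> holder_ball T \<gamma> M V"
proof -
  have "norm (stopped_path T y t r - stopped_path T y t s) \<le> M * (r - s) powr \<gamma>"
    if sr: "0 \<le> s" "s < r" "r \<le> T" for s r
  proof -
    have "norm (y (min r t) - y (min s t)) \<le> M * (min r t - min s t) powr \<gamma>"
      using y t sr unfolding holder_ball_def by (intro holder_onD[of 0 T]) auto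
    also have "\<dots> \<le> M * (r - s) powr \<gamma>"
      using sr assms by (intro mult_left_mono powr_mono2) auto
    finally show ?thesis using sr by (simp add: stopped_path_def)
  qed
  moreover have "stopped_path T y t 0 = y 0" using t by (simp add: stopped_path_def)
  ultimately show ?thesis
    using y by (auto simp: holder_ball_def holder_on_def stopped_path_def)
qed

definition stopped_ball :: "real \<Rightarrow> real \<Rightarrow> real \<Rightarrow> 'a set \<Rightarrow> (real \<times> (real \<Rightarrow> 'a::real_normed_vector)) set"
  where "stopped_ball T \<gamma> M V = (\<lambda>(t, y). (t, stopped_path T y t)) ` ({0..T} \<times> holder_ball T \<gamma> M V)"

lemma stopped_ball_subset:
  assumes "0 \<le> M" "0 < \<gamma>"
  shows "stopped_ball T \<gamma> M V \<subseteq> {0..T} \<times> holder_ball T \<gamma> M V"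
  unfolding stopped_ball_def by (auto intro!: stopped_path_in_ball assms)

lemma stopped_ball_stopped:
  assumes "(t, z) \<in> stopped_ball T \<gamma> M V" "r \<in> {0..T}"
  shows "z r = z (min r t)"
  using assms by (auto simp: stopped_ball_def stopped_path_def)

text \<open>The set is an image of a compact product, but the map needs y (min r t) to depend
  jointly continuously on t and y, which fails for arbitrary functions in the product topology. The
  common Hoelder constant of the ball controls the change of time.\<close>

lemma compact_stopped_ball:
  fixes V :: "'a::euclidean_space set"
  assumes V: "compact V" and T: "0 \<le> T" and M: "0 \<le> M" and \<gamma>: "0 < \<gamma>"
  shows "compact (stopped_ball T \<gamma> M V)"
  unfolding stopped_ball_def
proof (rule compact_continuous_image)
  let ?D = "{0..T} \<times> holder_ball T \<gamma> M V"
  show "compact ?D"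
    using compact_holder_ball[OF V T M] \<gamma> by (intro compact_Times) auto
  have "continuous_on ?D (\<lambda>p. stopped_path T (snd p) (fst p) r)" for r
  proof (cases "r \<in> {0..T}")
    case False
    then have "stopped_path T y t r = undefined" for y :: "real \<Rightarrow> 'a" and t
      by (simp add: stopped_path_def del: atLeastAtMost_iff)
    then show ?thesis by simp
  next
    case r: True
    have "continuous_on ?D (\<lambda>p. snd p (min r (fst p)))"
    proof (rule continuous_on_holder_ball[OF T \<gamma> M])
      show "?D \<subseteq> UNIV \<times> holder_ball T \<gamma> M V" by auto
      fix \<epsilon> :: real assume "0 < \<epsilon>"
      then obtain \<delta> where \<delta>: "0 < \<delta>" "M * \<delta> powr \<gamma> + \<delta> < \<epsilon>" using modulus_exists[OF M \<gamma>] by blast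
      have "dist (y (min r t)) (z (min r s)) < \<epsilon>"
        if y: "(t, y) \<in> ?D" and z: "(s, z) \<in> ?D" and ts: "\<bar>t - s\<bar> < \<delta>" and yz: "\<forall>r\<in>{0..T}. norm (y r - z r) < \<delta>"
        for t y s z
      proof -
        have h: "holder_on 0 T \<gamma> M y" using y by (simp add: holder_ball_def)
        have "norm (y (min r t) - y (min r s)) \<le> M * \<bar>min r t - min r s\<bar> powr \<gamma>"
          by (rule holder_onD_abs[OF h]) (use y z r in auto)
        also have "\<dots> \<le> M * \<delta> powr \<gamma>" using ts M \<gamma> by (intro mult_left_mono powr_mono2) auto
        finally have 1: "norm (y (min r t) - y (min r s)) \<le> M * \<delta> powr \<gamma>" .
        have 2: "norm (y (min r s) - z (min r s)) < \<delta>" by (rule yz[rule_format]) (use z r in auto)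
        have "norm (y (min r t) - z (min r s)) \<le> norm (y (min r t) - y (min r s)) + norm (y (min r s) - z (min r s))"
          using norm_triangle_ineq[of "y (min r t) - y (min r s)" "y (min r s) - z (min r s)"] by simp
        then show ?thesis using 1 2 \<delta>(2) by (simp add: dist_norm)
      qed
      then show "\<exists>\<delta>>0. \<forall>t y s z. (t, y) \<in> ?D \<longrightarrow> (s, z) \<in> ?D \<longrightarrow> \<bar>t - s\<bar> < \<delta> \<longrightarrow>
        (\<forall>r\<in>{0..T}. norm (y r - z r) < \<delta>) \<longrightarrow> dist (snd (t, y) (min r (fst (t, y)))) (snd (s, z) (min r (fst (s, z)))) < \<epsilon>"
        using \<delta>(1) by auto
    qed
    then show ?thesis using r by (simp add: stopped_path_def)
  qed
  then have "continuous_on ?D (\<lambda>p. stopped_path T (snd p) (fst p))"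
    by (rule continuous_on_coordinatewise_then_product)
  then show "continuous_on ?D (\<lambda>(t, y). (t, stopped_path T y t))"
    unfolding case_prod_unfold by (rule continuous_on_Pair[OF continuous_on_fst[OF continuous_on_id]])
qed

context signature_paths
begin

text \<open>\<open>T powr (1 - \<alpha>)\<close> is the \<alpha>-Hoelder constant of time, D that of
  the spatial coordinates, and the summand 1 ensures the bound N \<ge> 1 demanded by
  \<open>tame_with\<close>.\<close>

lemma time_augmented_path_bound:
  fixes y :: "real \<Rightarrow> real ^ 'm"
  assumes "holder_on 0 s \<alpha> D y" "0 \<le> D" "s \<le> T"
  shows "path_bound s (1 + T powr (1 - \<alpha>) + D) (time_augmented y)"
  unfolding path_bound_def
proof
  fix k :: "'m option"
  show "holder_on 0 s \<alpha> (1 + T powr (1 - \<alpha>) + D) (\<lambda>u. time_augmented y u $ k)"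
  proof (cases k)
    case None
    have "holder_on 0 s 1 1 (\<lambda>u::real. u)" by (auto simp: holder_on_def)
    from holder_on_exponent_le[OF this, of \<alpha> T]
    have "holder_on 0 s \<alpha> (T powr (1 - \<alpha>)) (\<lambda>u::real. u)" using \<alpha> assms by simp
    then have "holder_on 0 s \<alpha> (1 + T powr (1 - \<alpha>) + D) (\<lambda>u::real. u)"
      by (rule holder_on_mono) (use assms in auto)
    then show ?thesis by (simp add: None)
  next
    case (Some i)
    have "holder_on 0 s \<alpha> (1 + T powr (1 - \<alpha>) + D) (\<lambda>u. y u $ i)"
      by (rule holder_on_mono[OF holder_on_component[OF assms(1)]]) auto
    then show ?thesis by (simp add: Some)
  qed
qed

lemma time_augmented_diff_bound:
  fixes y z :: "real \<Rightarrow> real ^ 'm"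
  assumes "holder_on 0 s \<alpha> D (\<lambda>u. y u - z u)" "0 \<le> D"
  shows "path_bound s D (\<lambda>u. time_augmented y u - time_augmented z u)"
  unfolding path_bound_def
proof
  fix k :: "'m option"
  show "holder_on 0 s \<alpha> D (\<lambda>u. (time_augmented y u - time_augmented z u) $ k)"
  proof (cases k)
    case None
    then show ?thesis using assms by (simp add: holder_on_const)
  next
    case (Some i)
    then show ?thesis using holder_on_component[OF assms(1), of i] by simp
  qed
qed

lemma time_augmented_regular:
  assumes "holder_on 0 T \<alpha> D y" "0 \<le> D"
  shows "time_augmented y \<in> regular_paths"
  unfolding regular_paths_def
  using time_augmented_path_bound[OF assms order_refl] assms(2)
  by (intro CollectI exI[of _ "1 + T powr (1 - \<alpha>) + D"]) auto

lemma linear_on_signature_increment: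
  "linear_on_signature (\<lambda>z t. z t $ k - z 0 $ k)"
proof (rule linear_on_signature_cong[OF linear_on_signature_word[of 1 "[k]"]])
  fix z :: "real \<Rightarrow> real ^ 'a" and t assume "t \<in> {0..T}"
  then have "rs_integral (\<lambda>_. 1) (\<lambda>s. z s $ k) 0 t = z t $ k - z 0 $ k"
    by (intro rs_integral_eqI has_rs_integral_one) auto
  moreover have "iterated_integral_rev z [] = (\<lambda>_. 1)" by auto
  ultimately show "z t $ k - z 0 $ k = 1 * iterated_integral_rev z [k] t" by simp
qed

text \<open>With k = \<open>None\<close> these are all polynomials in time, the test functions of
  the separation argument.\<close>

lemma linear_on_signature_polynomial:
  assumes "real_polynomial_function p"
  shows "linear_on_signature (\<lambda>z t. p (z t $ k - z 0 $ k))"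
  using assms
proof (induction p rule: real_polynomial_function.induct)
  case (linear f)
  then obtain c where "f = (\<lambda>x. x * c)" using real_bounded_linear by blast
  then show ?case using linear_on_signature_cmult[OF linear_on_signature_increment, of c k] by (simp add: mult.commute)
qed (auto intro: linear_on_signature_const linear_on_signature_add linear_on_signature_mult)

text \<open>Pointwise closeness says nothing about the \<alpha>-Hoelder distance inside an
  \<alpha>-Hoelder ball, but by interpolation it controls every smaller exponent. The bounds for
  words are therefore invoked at an exponent below \<alpha> for which Young integration still
  works.\<close>

lemma continuous_on_signature:
  assumes M: "0 \<le> M" and l: "S \<subseteq> {0..T} \<times> holder_ball T \<alpha> M V"
  shows "continuous_on S (\<lambda>p. tensor_pairing l (signature (time_augmented (snd p)) (fst p)) :: real)"
proof -
  define \<alpha>' where "\<alpha>' = (\<alpha> + 1 / 2) / 2"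
  have \<alpha>': "1 / 2 < \<alpha>'" "\<alpha>' < \<alpha>" using \<alpha> by (auto simp: \<alpha>'_def)
  interpret weak: signature_paths T \<alpha>' by unfold_locales (use T0 \<alpha> \<alpha>' in auto)
  define f where "f = (\<lambda>z t. tensor_pairing l (signature z t))"
  have "weak.tame f" unfolding f_def by (rule weak.tame_pairing)
  then obtain c n where f': "weak.tame_with c n f"
    by (auto simp: weak.tame_def)
  note f = weak.tame_withD[OF f']
  define N where "N = 1 + T powr (1 - \<alpha>') + M * T powr (\<alpha> - \<alpha>')"
  have N: "1 \<le> N" using M by (simp add: N_def)
  define K where "K = c * N ^ n"
  have K: "0 \<le> K" using f(1) N by (simp add: K_def)
  have TT: "T \<in> {0..T}" using T0 by simp
  have bound: "weak.path_bound T N (time_augmented y)" if "y \<in> holder_ball T \<alpha> M V" for y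
    unfolding N_def
    by (rule weak.time_augmented_path_bound[OF holder_on_exponent_le]) (use that \<alpha>' M in \<open>auto simp: holder_ball_def\<close>)
  have "continuous_on S (\<lambda>p. f (time_augmented (snd p)) (fst p))"
  proof (rule continuous_on_holder_ball[OF T0 _ M])
    show "0 < \<alpha>" using \<alpha> by simp
    show "S \<subseteq> UNIV \<times> holder_ball T \<alpha> M V" using l by auto
    fix \<epsilon> :: real assume \<epsilon>: "0 < \<epsilon>"
    define e where "e = \<epsilon> / (3 * (K + 1))"
    have e: "0 < e" using \<epsilon> K by (simp add: e_def)
    have Ke: "K * e \<le> \<epsilon> / 3"
    proof -
      have "K * e = (K / (K + 1)) * (\<epsilon> / 3)" by (simp add: e_def)
      also have "\<dots> \<le> 1 * (\<epsilon> / 3)" using K \<epsilon> by (intro mult_right_mono) auto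
      finally show ?thesis by simp
    qed
    obtain \<delta>1 where \<delta>1: "0 < \<delta>1" "(M + M) powr (\<alpha>' / \<alpha>) * (2 * \<delta>1) powr (1 - \<alpha>' / \<alpha>) \<le> e"
      using small_interpolation_constant[of "M + M" \<alpha>' \<alpha> e] M \<alpha> \<alpha>' e by auto
    obtain \<delta>2 where \<delta>2: "0 < \<delta>2" "K * \<delta>2 powr \<alpha>' + \<delta>2 < \<epsilon> / 3"
      using modulus_exists[of K \<alpha>' "\<epsilon> / 3"] K \<alpha>' \<epsilon> by auto
    have "dist (f (time_augmented y) t) (f (time_augmented z) s) < \<epsilon>"
      if y: "(t, y) \<in> S" and z: "(s, z) \<in> S" and ts: "\<bar>t - s\<bar> < min \<delta>1 \<delta>2"
        and yz: "\<forall>r\<in>{0..T}. norm (y r - z r) < min \<delta>1 \<delta>2" for t y s z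
    proof -
      have yb: "y \<in> holder_ball T \<alpha> M V" "t \<in> {0..T}" and zb: "z \<in> holder_ball T \<alpha> M V" "s \<in> {0..T}"
        using y z l by auto
      have "\<bar>f (time_augmented y) t - f (time_augmented y) s\<bar> \<le> K * \<bar>t - s\<bar> powr \<alpha>'"
        unfolding K_def
        using holder_onD_abs[OF f(3)[OF TT N bound[OF yb(1)]] zb(2) yb(2)] by simp
      also have "\<dots> \<le> K * \<delta>2 powr \<alpha>'" using ts K \<alpha>' by (intro mult_left_mono powr_mono2) auto
      also have "\<dots> < \<epsilon> / 3" using \<delta>2 by linarith
      finally have 1: "\<bar>f (time_augmented y) t - f (time_augmented y) s\<bar> < \<epsilon> / 3" .
      have "holder_on 0 T \<alpha> (M + M) (\<lambda>u. y u - z u)"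
        using yb zb by (intro holder_on_diff) (auto simp: holder_ball_def)
      then have "holder_on 0 T \<alpha>' ((M + M) powr (\<alpha>' / \<alpha>) * (2 * \<delta>1) powr (1 - \<alpha>' / \<alpha>)) (\<lambda>u. y u - z u)"
        by (rule holder_on_interpolate) (use yz M \<alpha>' in \<open>auto intro: less_imp_le\<close>)
      then have "holder_on 0 T \<alpha>' e (\<lambda>u. y u - z u)" by (rule holder_on_mono) (rule \<delta>1(2))
      then have "weak.path_bound T e (\<lambda>u. time_augmented y u - time_augmented z u)"
        by (rule weak.time_augmented_diff_bound) (use e in simp)
      then have "\<bar>f (time_augmented y) s - f (time_augmented z) s\<bar> \<le> K * e"
        unfolding K_def using e zb(2) by (intro f(4)[OF TT N _ bound[OF yb(1)] bound[OF zb(1)]]) auto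
      then show ?thesis unfolding dist_real_def using 1 Ke \<epsilon> by linarith
    qed
    then show "\<exists>\<delta>>0. \<forall>t y s z. (t, y) \<in> S \<longrightarrow> (s, z) \<in> S \<longrightarrow> \<bar>t - s\<bar> < \<delta> \<longrightarrow>
        (\<forall>r\<in>{0..T}. norm (y r - z r) < \<delta>) \<longrightarrow>
        dist (f (time_augmented (snd (t, y))) (fst (t, y))) (f (time_augmented (snd (s, z))) (fst (s, z))) < \<epsilon>"
      using \<delta>1(1) \<delta>2(1) by (intro exI[of _ "min \<delta>1 \<delta>2"]) auto
  qed
  then show ?thesis by (simp add: f_def)
qed

text \<open>The signature is blind to the starting value, so separation is claimed only for paths
  starting at the common point v. The time letter recovers t; the integrals against polynomials
  recover the path on [0,t]; and beyond t a stopped path carries no further information.\<close>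

lemma signature_separates:
  fixes z z' :: "real \<Rightarrow> real ^ 'm"
  assumes p: "(t, z) \<in> stopped_ball T \<alpha> M {v}" and p': "(t', z') \<in> stopped_ball T \<alpha> M {v}"
    and M: "0 \<le> M" and neq: "(t, z) \<noteq> (t', z')"
  shows "\<exists>P. linear_on_signature P \<and> P (time_augmented z) t \<noteq> P (time_augmented z') t'"
proof (rule ccontr)
  assume "\<nexists>P. linear_on_signature P \<and> P (time_augmented z) t \<noteq> P (time_augmented z') t'"
  then have same: "P (time_augmented z) t = P (time_augmented z') t'" if "linear_on_signature P" for P
    using that by blast
  have \<alpha>0: "0 < \<alpha>" using \<alpha> by simp
  have b: "t \<in> {0..T}" "t' \<in> {0..T}" "z \<in> holder_ball T \<alpha> M {v}" "z' \<in> holder_ball T \<alpha> M {v}"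
    using subsetD[OF stopped_ball_subset[OF M \<alpha>0] p] subsetD[OF stopped_ball_subset[OF M \<alpha>0] p'] by auto
  have t: "t = t'" using same[OF linear_on_signature_increment[of None]] by simp
  have eq: "z u = z' u" if u: "u \<in> {0..t}" for u
  proof (cases "t = 0")
    case True
    then show ?thesis using u b by (auto simp: holder_ball_def)
  next
    case False
    then have t0: "0 < t" using b by simp
    have cont: "continuous_on {0..t} y" if "y \<in> holder_ball T \<alpha> M {v}" for y
      by (rule holder_on_continuous[OF holder_on_subinterval \<alpha>0]) (use that b in \<open>auto simp: holder_ball_def\<close>)
    have "z u $ i - z' u $ i = 0" for i
    proof (rule continuous_orthogonal_to_polynomials[OF t0 _ _ u])
      show "continuous_on {0..t} (\<lambda>u. z u $ i - z' u $ i)"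
        by (intro continuous_intros cont b)
      fix p :: "real \<Rightarrow> real" assume poly: "real_polynomial_function p"
      have pc: "continuous_on {0..t} p"
        using poly by (intro continuous_at_imp_continuous_on ballI continuous_real_polymonial_function)
      \<comment> \<open>Integrates p(u) * (z_i(u) - z_i(0)) in time along an augmented path.
        Products and integrals of linear functionals are again linear functionals, so P takes equal
        values at both points by assumption.\<close>
      define P where "P = (\<lambda>z t. rs_integral (\<lambda>u. p (z u $ None - z 0 $ None) * (z u $ Some i - z 0 $ Some i))
        (\<lambda>u. z u $ None) 0 t)"
      have "linear_on_signature P"
        unfolding P_def
        by (rule linear_on_signature_integral[OF linear_on_signature_mult[OF
              linear_on_signature_polynomial[OF poly] linear_on_signature_increment]])
      then have PP: "P (time_augmented z) t = P (time_augmented z') t" using same t by blast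
      have c: "continuous_on {0..t} (\<lambda>u. p u * (y u $ i - y 0 $ i))" if "y \<in> holder_ball T \<alpha> M {v}" for y
        by (intro continuous_intros cont that pc)
      have P: "P (time_augmented y) t = integral {0..t} (\<lambda>u. p u * (y u $ i - y 0 $ i))"
        if "y \<in> holder_ball T \<alpha> M {v}" for y
        unfolding P_def using has_rs_integral_id[OF _ c[OF that]] t0 by (intro rs_integral_eqI) simp
      have "integral {0..t} (\<lambda>u. p u * (z u $ i - z 0 $ i) - p u * (z' u $ i - z' 0 $ i)) = 0"
        using PP P[OF b(3)] P[OF b(4)] integral_diff[OF integrable_continuous_real[OF c[OF b(3)]] integrable_continuous_real[OF c[OF b(4)]]]
        by simp
      moreover have "z 0 = z' 0" using b by (simp add: holder_ball_def)
      ultimately show "integral {0..t} (\<lambda>u. p u * (z u $ i - z' u $ i)) = 0"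
        by (simp add: algebra_simps)
    qed
    then show ?thesis by (simp add: vec_eq_iff)
  qed
  have "z r = z' r" for r
  proof (cases "r \<in> {0..T}")
    case True
    then show ?thesis
      using stopped_ball_stopped[OF p True] stopped_ball_stopped[OF p' True] eq[of "min r t"] t b by auto
  next
    case False
    then show ?thesis using b by (auto simp: holder_ball_def extensional_def)
  qed
  then show False using neq t by auto
qed

lemma signature_approximation:
  fixes F :: "real \<times> (real \<Rightarrow> real ^ 'm) \<Rightarrow> real"
  assumes M: "0 \<le> M" and F: "continuous_on (stopped_ball T \<alpha> M {v}) F" and \<epsilon>: "0 < \<epsilon>"
  shows "\<exists>l. \<forall>t\<in>{0..T}. \<forall>y\<in>holder_ball T \<alpha> M {v}.
    \<bar>F (t, stopped_path T y t) - tensor_pairing l (signature (time_augmented y) t)\<bar> < \<epsilon>"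
proof -
  let ?S = "stopped_ball T \<alpha> M {v :: real ^ 'm}"
  \<comment> \<open>Membership prescribes f only on the compact set; there the representing
    functional turns sums and products of functions into those of words.\<close>
  define R where "R = {f. \<exists>P. linear_on_signature P \<and> (\<forall>p\<in>?S. f p = P (time_augmented (snd p)) (fst p))}"
  have \<alpha>0: "0 < \<alpha>" using \<alpha> by simp
  have sub: "?S \<subseteq> {0..T} \<times> holder_ball T \<alpha> M {v}" by (rule stopped_ball_subset[OF M \<alpha>0])
  have reg: "time_augmented z \<in> regular_paths" if "(t, z) \<in> ?S" for t z
    using that sub M by (intro time_augmented_regular[of M]) (auto simp: holder_ball_def)
  interpret function_ring_on R ?S
  proof
    show "compact ?S" by (rule compact_stopped_ball[OF _ T0 M \<alpha>0]) simp
    show "(\<lambda>_. c) \<in> R" for c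
      unfolding R_def using linear_on_signature_const[of c] by (intro CollectI exI[of _ "\<lambda>_ _. c"]) auto
  next
    fix f assume "f \<in> R"
    then obtain P where P: "linear_on_signature P" "\<forall>p\<in>?S. f p = P (time_augmented (snd p)) (fst p)"
      by (auto simp: R_def)
    then obtain l where l: "\<forall>z\<in>regular_paths. \<forall>t\<in>{0..T}. P z t = tensor_pairing l (signature z t)"
      unfolding linear_on_signature_def by blast
    have "f p = tensor_pairing l (signature (time_augmented (snd p)) (fst p))" if "p \<in> ?S" for p
    proof -
      obtain t z where p: "p = (t, z)" by (cases p)
      have tz: "(t, z) \<in> ?S" using that p by simp
      then have "t \<in> {0..T}" using sub by auto
      then show ?thesis using P(2)[rule_format, OF tz] l[rule_format, OF reg[OF tz]] by (simp add: p)
    qed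
    then show "continuous_on ?S f"
      using continuous_on_signature[OF M sub, of l] by (simp cong: continuous_on_cong)
  next
    fix f g assume "f \<in> R" "g \<in> R"
    then obtain P Q where P: "linear_on_signature P" "\<forall>p\<in>?S. f p = P (time_augmented (snd p)) (fst p)"
      and Q: "linear_on_signature Q" "\<forall>p\<in>?S. g p = Q (time_augmented (snd p)) (fst p)"
      unfolding R_def by blast
    show "(\<lambda>x. f x + g x) \<in> R"
      unfolding R_def using P Q linear_on_signature_add[OF P(1) Q(1)]
      by (intro CollectI exI[of _ "\<lambda>z t. P z t + Q z t"]) auto
    show "(\<lambda>x. f x * g x) \<in> R"
      unfolding R_def using P Q linear_on_signature_mult[OF P(1) Q(1)]
      by (intro CollectI exI[of _ "\<lambda>z t. P z t * Q z t"]) auto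
  next
    fix x y assume xy: "x \<in> ?S" "y \<in> ?S" "x \<noteq> y"
    obtain t z t' z' where e: "x = (t, z)" "y = (t', z')" by (cases x, cases y) auto
    obtain P where P: "linear_on_signature P" "P (time_augmented z) t \<noteq> P (time_augmented z') t'"
      using signature_separates[of t z M v t' z'] xy M unfolding e by blast
    show "\<exists>f\<in>R. f x \<noteq> f y"
      by (rule bexI[of _ "\<lambda>p. P (time_augmented (snd p)) (fst p)"]) (use P in \<open>auto simp: e R_def\<close>)
  qed
  obtain g where g: "g \<in> R" "\<And>x. x \<in> ?S \<Longrightarrow> \<bar>F x - g x\<bar> < \<epsilon>"
    using Stone_Weierstrass_basic[OF F \<epsilon>] by blast
  then obtain P where P: "linear_on_signature P" "\<forall>p\<in>?S. g p = P (time_augmented (snd p)) (fst p)"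
    by (auto simp: R_def)
  then obtain l where l: "\<forall>z\<in>regular_paths. \<forall>t\<in>{0..T}. P z t = tensor_pairing l (signature z t)"
    unfolding linear_on_signature_def by blast
  show ?thesis
  proof (intro exI[of _ l] ballI)
    fix t y assume t: "t \<in> {0..T}" and y: "y \<in> holder_ball T \<alpha> M {v}"
    have S: "(t, stopped_path T y t) \<in> ?S" using t y by (force simp: stopped_ball_def)
    \<comment> \<open>Stone--Weierstrass speaks about stopped paths, the equation about the original
      one. The signature at time t sees only [0,t], where the two coincide.\<close>
    have "signature (time_augmented (stopped_path T y t)) t = signature (time_augmented y) t"
    proof (rule signature_cong)
      fix u assume "u \<in> {0..t}"
      then have "stopped_path T y t u = y u" using t by (simp add: stopped_path_def)
      then show "time_augmented (stopped_path T y t) u = time_augmented y u"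
        by (auto simp: vec_eq_iff time_augmented_def split: option.split)
    qed (use t in simp)
    then have "g (t, stopped_path T y t) = tensor_pairing l (signature (time_augmented y) t)"
      using P(2)[rule_format, OF S] l[rule_format, OF reg[OF S] t] by simp
    then show "\<bar>F (t, stopped_path T y t) - tensor_pairing l (signature (time_augmented y) t)\<bar> < \<epsilon>"
      using g(2)[OF S] by simp
  qed
qed

end

section \<open>Signature equations approximate functional equations\<close>

lemma finite_uniform_bound:
  fixes Q :: "'i::finite \<Rightarrow> 'j::finite \<Rightarrow> real \<Rightarrow> bool"
  assumes ex: "\<And>i j. \<exists>C\<ge>0. Q i j C" and mono: "\<And>i j C C'. Q i j C \<Longrightarrow> C \<le> C' \<Longrightarrow> Q i j C'"
  shows "\<exists>C\<ge>0. \<forall>i j. Q i j C"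
proof -
  obtain c where c: "\<And>i j. 0 \<le> c i j" "\<And>i j. Q i j (c i j)"
    using ex by metis
  define C where "C = (\<Sum>i\<in>UNIV. \<Sum>j\<in>UNIV. c i j)"
  have "c i j \<le> C" for i j
  proof -
    have "c i j \<le> (\<Sum>j\<in>UNIV. c i j)" using c by (intro member_le_sum) auto
    also have "\<dots> \<le> C" unfolding C_def using c by (intro member_le_sum sum_nonneg) auto
    finally show ?thesis .
  qed
  moreover have "0 \<le> C" unfolding C_def by (intro sum_nonneg c)
  ultimately show ?thesis using mono c(2) by blast
qed

lemma lipschitz_functionalE:
  assumes "lipschitz_functional \<alpha> \<beta> T f"
  obtains L where "0 \<le> L" "\<And>p q. p \<in> stopped_paths \<alpha> T \<Longrightarrow> q \<in> stopped_paths \<alpha> T \<Longrightarrow>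
    norm (f p - f q) \<le> L * stopped_dist \<beta> T p q"
proof -
  obtain L where L: "\<forall>p \<in> stopped_paths \<alpha> T. \<forall>q \<in> stopped_paths \<alpha> T. norm (f p - f q) \<le> L * stopped_dist \<beta> T p q"
    using assms unfolding lipschitz_functional_def by blast
  have "0 \<le> stopped_dist \<beta> T p q" for p q :: "real \<times> (real \<Rightarrow> 'a)"
    by (auto simp: stopped_dist_def holder_dist_def holder_norm_def split: prod.splits)
  then have "L * stopped_dist \<beta> T p q \<le> \<bar>L\<bar> * stopped_dist \<beta> T p q" for p q :: "real \<times> (real \<Rightarrow> 'a)"
    by (intro mult_right_mono) auto
  then show ?thesis
    by (intro that[of "\<bar>L\<bar>"]) (use L in \<open>blast intro: order_trans abs_ge_zero\<close>)+
qed

lemma matrix_entry_diff_le: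
  fixes b b' :: "(real ^ 'd) \<Rightarrow>\<^sub>L (real ^ 'm)"
  shows "\<bar>matrix (blinfun_apply b) $ i $ j - matrix (blinfun_apply b') $ i $ j\<bar> \<le> norm (b - b')"
proof -
  have "\<bar>matrix (blinfun_apply b) $ i $ j - matrix (blinfun_apply b') $ i $ j\<bar> = \<bar>blinfun_apply (b - b') (axis j 1) $ i\<bar>"
    by (simp add: matrix_def blinfun.diff_left)
  also have "\<dots> \<le> norm (blinfun_apply (b - b') (axis j 1))" by (rule component_le_norm_cart)
  also have "\<dots> \<le> norm (b - b') * norm (axis j (1::real) :: real ^ 'd)" by (rule norm_blinfun)
  finally show ?thesis by simp
qed

lemma matrix_entry_le:
  fixes b :: "(real ^ 'd) \<Rightarrow>\<^sub>L (real ^ 'm)"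
  shows "\<bar>matrix (blinfun_apply b) $ i $ j\<bar> \<le> norm b"
  using matrix_entry_diff_le[of b i j 0] by (simp add: matrix_def)

lemma stopped_pathsI:
  "t \<in> {0..T} \<Longrightarrow> y \<in> holder_paths \<alpha> T \<Longrightarrow> (t, stopped_path T y t) \<in> stopped_paths \<alpha> T"
  by (auto simp: stopped_paths_def)

lemma stopped_diff_holder:
  fixes y z :: "real \<Rightarrow> 'a::real_normed_vector"
  assumes "holder_on 0 s \<gamma> D (\<lambda>t. y t - z t)" "s \<in> {0..T}" "0 \<le> D" "0 < \<gamma>"
  shows "holder_on 0 T \<gamma> D (\<lambda>t. stopped_path T y s t - stopped_path T z s t)"
  unfolding holder_on_def
proof (intro allI impI)
  fix p q assume pq: "0 \<le> p" "p < q" "q \<le> T"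
  have "norm ((y (min q s) - z (min q s)) - (y (min p s) - z (min p s))) \<le> D * (min q s - min p s) powr \<gamma>"
    using pq assms by (intro holder_onD[OF assms(1)]) auto
  also have "\<dots> \<le> D * (q - p) powr \<gamma>" using pq assms by (intro mult_left_mono powr_mono2) auto
  finally show "norm (stopped_path T y s q - stopped_path T z s q - (stopped_path T y s p - stopped_path T z s p))
      \<le> D * (q - p) powr \<gamma>"
    using pq by (simp add: stopped_path_def)
qed

text \<open>The difference of the two stopped paths is y clamped to the time window [u,s], minus a
  constant. Its increments live on length s - u, so \<alpha> - \<beta> of the exponent can be traded
  for \<open>(s - u) powr (\<alpha> - \<beta>)\<close>: this is where the time regularity \<alpha> -
  \<beta> of f comes from.\<close>

lemma stopped_at_two_times_holder:
  fixes y :: "real \<Rightarrow> 'a::real_normed_vector"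
  assumes y: "holder_on 0 T \<alpha> C y" and us: "0 \<le> u" "u \<le> s" "s \<le> T" and "0 \<le> C" "0 < \<beta>" "\<beta> \<le> \<alpha>"
  shows "holder_on 0 T \<beta> (C * (s - u) powr (\<alpha> - \<beta>)) (\<lambda>t. stopped_path T y s t - stopped_path T y u t)"
  unfolding holder_on_def
proof (intro allI impI)
  fix p q assume pq: "0 \<le> p" "p < q" "q \<le> T"
  define cl where "cl = (\<lambda>r. max u (min r s))"
  have d: "y (min r s) - y (min r u) = y (cl r) - y u" for r
    using us by (auto simp: cl_def min_def max_def)
  have c: "0 \<le> cl q - cl p" "cl q - cl p \<le> s - u" "cl q - cl p \<le> q - p"
    using pq us by (auto simp: cl_def min_def max_def)
  have "norm ((y (min q s) - y (min q u)) - (y (min p s) - y (min p u))) = norm (y (cl q) - y (cl p))"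
    by (simp add: d)
  also have "\<dots> \<le> C * (cl q - cl p) powr \<alpha>"
  proof (rule holder_onD[OF y])
    have "u \<le> T" using us by linarith
    then show "0 \<le> cl p" "cl p \<le> cl q" "cl q \<le> T"
      using us c by (auto simp: cl_def le_max_iff_disj min_le_iff_disj)
  qed
  also have "\<dots> \<le> C * ((s - u) powr (\<alpha> - \<beta>) * (cl q - cl p) powr \<beta>)"
    using c assms by (intro mult_left_mono powr_le_powr_interval) auto
  also have "\<dots> \<le> C * ((s - u) powr (\<alpha> - \<beta>) * (q - p) powr \<beta>)"
    using c assms by (intro mult_left_mono powr_mono2) auto
  finally show "norm (stopped_path T y s q - stopped_path T y u q - (stopped_path T y s p - stopped_path T y u p))
      \<le> C * (s - u) powr (\<alpha> - \<beta>) * (q - p) powr \<beta>"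
    using pq by (simp add: stopped_path_def mult.assoc)
qed

text \<open>Lipschitz functionals grow at most linearly away from a base point, here the constant
  path v at time 0. Stopping does not alter a constant path, so changing its time costs at most T in
  the distance.\<close>

lemma functional_growth:
  assumes f: "lipschitz_functional \<alpha> \<beta> T f" and T: "0 \<le> T" and \<beta>: "0 < \<beta>" "\<beta> \<le> \<alpha>"
  shows "\<exists>A\<ge>0. \<forall>y\<in>holder_paths \<alpha> T. y 0 = v \<longrightarrow> (\<forall>s\<in>{0..T}. \<forall>D\<ge>0. holder_on 0 s \<alpha> D y \<longrightarrow>
    norm (f (s, stopped_path T y s)) \<le> A * (1 + D))"
proof -
  obtain L where L: "0 \<le> L" "\<And>p q. p \<in> stopped_paths \<alpha> T \<Longrightarrow> q \<in> stopped_paths \<alpha> T \<Longrightarrow>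
    norm (f p - f q) \<le> L * stopped_dist \<beta> T p q"
    by (rule lipschitz_functionalE[OF f]) (rule that)
  define c where "c = restrict (\<lambda>_::real. v) {0..T}"
  have c: "c \<in> holder_paths \<alpha> T"
    by (rule holder_pathsI[where C = 0]) (auto simp: c_def holder_on_def)
  define p0 where "p0 = (0 :: real, stopped_path T c 0)"
  have p0: "p0 \<in> stopped_paths \<alpha> T" unfolding p0_def using T c by (intro stopped_pathsI) auto
  define A where "A = norm (f p0) + L * (T + T powr (\<alpha> - \<beta>))"
  have "norm (f (s, stopped_path T y s)) \<le> A * (1 + D)"
    if y: "y \<in> holder_paths \<alpha> T" "y 0 = v" and s: "s \<in> {0..T}" and D: "0 \<le> D" "holder_on 0 s \<alpha> D y" for y s D
  proof -
    have "holder_on 0 s \<alpha> D (\<lambda>t. y t - c t)"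
      using D s unfolding holder_on_def c_def by auto
    then have "holder_on 0 s \<beta> (D * T powr (\<alpha> - \<beta>)) (\<lambda>t. y t - c t)"
      by (rule holder_on_exponent_le) (use s D \<beta> in auto)
    then have "holder_on 0 T \<beta> (D * T powr (\<alpha> - \<beta>)) (\<lambda>t. stopped_path T y s t - stopped_path T c s t)"
      by (rule stopped_diff_holder) (use s D \<beta> in auto)
    moreover have "stopped_path T c s = stopped_path T c 0"
      using s by (auto simp: stopped_path_def c_def fun_eq_iff)
    ultimately have "holder_dist \<beta> T (stopped_path T y s) (stopped_path T c 0) \<le>
        norm (stopped_path T y s 0 - stopped_path T c 0 0) + D * T powr (\<alpha> - \<beta>)"
      using D by (intro holder_dist_le) auto
    moreover have "stopped_path T y s 0 = stopped_path T c 0 0"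
      using y s T by (simp add: stopped_path_def c_def)
    ultimately have "stopped_dist \<beta> T (s, stopped_path T y s) p0 \<le> T + D * T powr (\<alpha> - \<beta>)"
      using s by (simp add: stopped_dist_def p0_def)
    then have "L * stopped_dist \<beta> T (s, stopped_path T y s) p0 \<le> L * (T + D * T powr (\<alpha> - \<beta>))"
      using L by (intro mult_left_mono) auto
    then have "norm (f (s, stopped_path T y s) - f p0) \<le> L * (T + D * T powr (\<alpha> - \<beta>))"
      using L(2)[OF stopped_pathsI[OF s y(1)] p0] by linarith
    then have "norm (f (s, stopped_path T y s)) \<le> norm (f p0) + L * (T + D * T powr (\<alpha> - \<beta>))"
      using norm_triangle_sub[of "f (s, stopped_path T y s)" "f p0"] by linarith
    also have "\<dots> \<le> A * (1 + D)"
    proof -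
      have "0 \<le> norm (f p0) * D" "0 \<le> L * T * D" "0 \<le> L * T powr (\<alpha> - \<beta>)" using L T D by auto
      then show ?thesis by (simp add: A_def algebra_simps)
    qed
    finally show ?thesis .
  qed
  moreover have "0 \<le> A" using L T by (simp add: A_def)
  ultimately show ?thesis by blast
qed

text \<open>\<sigma> may be bounded, so its own range need not contain the values of f. The affine
  map stretches the image of a fixed compact interval over [-F,F]; compactness of that interval will
  make the inverse continuous.\<close>

lemma strict_mono_affine_cover:
  fixes \<sigma> :: "real \<Rightarrow> real"
  assumes "strict_mono \<sigma> \<or> monotone (<) (>) \<sigma>" and cont: "continuous_on UNIV \<sigma>"
  shows "\<exists>c0 c1. 0 < c1 \<and> {- F..F} \<subseteq> (\<lambda>r. c1 * \<sigma> r + c0) ` {0..1}"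
proof -
  have ne: "\<sigma> 0 \<noteq> \<sigma> 1" using assms(1) unfolding strict_mono_def monotone_on_def by (metis less_irrefl zero_less_one UNIV_I)
  \<comment> \<open>Scales the gap between \<sigma> 0 and \<sigma> 1 to 2 * |F| + 1, positive for
    every F; c0 then centres the image at 0. Whether \<sigma> increases or decreases only swaps the
    end points.\<close>
  define c1 where "c1 = (2 * \<bar>F\<bar> + 1) / \<bar>\<sigma> 1 - \<sigma> 0\<bar>"
  define c0 where "c0 = - c1 * (\<sigma> 0 + \<sigma> 1) / 2"
  define \<phi> where "\<phi> = (\<lambda>r. c1 * \<sigma> r + c0)"
  have c1: "0 < c1" using ne by (simp add: c1_def)
  have d: "c1 * \<bar>\<sigma> 1 - \<sigma> 0\<bar> = 2 * \<bar>F\<bar> + 1" using ne by (simp add: c1_def)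
  have v: "\<phi> 0 = c1 * (\<sigma> 0 - \<sigma> 1) / 2" "\<phi> 1 = c1 * (\<sigma> 1 - \<sigma> 0) / 2"
    by (simp_all add: \<phi>_def c0_def field_simps)
  have "continuous_on {0..1} \<phi>"
    unfolding \<phi>_def by (intro continuous_intros continuous_on_subset[OF cont]) auto
  then have conn: "connected (\<phi> ` {0..1})" by (intro connected_continuous_image) auto
  have mem: "\<phi> 0 \<in> \<phi> ` {0..1}" "\<phi> 1 \<in> \<phi> ` {0..1}" by auto
  have "{- F..F} \<subseteq> \<phi> ` {0..1}"
  proof (cases "\<sigma> 0 < \<sigma> 1")
    case True
    then have "c1 * (\<sigma> 1 - \<sigma> 0) = 2 * \<bar>F\<bar> + 1" using d by simp
    then have "\<phi> 0 \<le> - F" "F \<le> \<phi> 1" unfolding v by (simp_all add: algebra_simps)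
    then show ?thesis using connected_contains_Icc[OF conn mem(1) mem(2)] by auto
  next
    case False
    then have "c1 * (\<sigma> 0 - \<sigma> 1) = 2 * \<bar>F\<bar> + 1" using d ne by simp
    then have "\<phi> 1 \<le> - F" "F \<le> \<phi> 0" unfolding v by (simp_all add: algebra_simps)
    then show ?thesis using connected_contains_Icc[OF conn mem(2) mem(1)] by auto
  qed
  then show ?thesis using c1 unfolding \<phi>_def by blast
qed

section \<open>Both right-hand sides as coefficients\<close>

context history
begin

lemma holder_ball_continuation:
  assumes "y \<in> continuations" "holder_on 0 T1 \<alpha> M y"
  shows "y \<in> holder_ball T1 \<alpha> M {w 0}"
  using assms continuation_start[OF assms(1)]
  by (auto simp: holder_ball_def continuations_def holder_paths_def)

text \<open>The pairing with l grows like a power of the Hoelder norm of the past; the logarithmic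
  bound on \<sigma> reduces this to linear growth, so that solutions cannot explode. The constant A
  still depends on l through that power.\<close>

lemma coefficient_signature:
  fixes l :: "'m option tensor_poly ^ 'd ^ 'm"
  assumes "\<gamma> \<le> \<alpha>" and \<sigma>: "L-lipschitz_on UNIV \<sigma>" and log: "\<And>r. \<bar>\<sigma> r\<bar> \<le> C\<^sub>\<sigma> * (1 + ln (1 + \<bar>r\<bar>))"
  shows "\<exists>A\<ge>0. coefficient A (signature_coeff \<sigma> l c0 c1)"
proof -
  interpret signature_paths T1 \<alpha> by unfold_locales (use T \<alpha> in auto)
  define P where "P = (\<lambda>i j z t. tensor_pairing (l $ i $ j) (signature z t))"
  have G: "signature_coeff \<sigma> l c0 c1 y t $ i $ j = c1 * \<sigma> (P i j (time_augmented y) t) + c0" for y t i j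
    by (simp add: signature_coeff_def P_def)
  have L: "0 \<le> L" "\<And>a b. \<bar>\<sigma> a - \<sigma> b\<bar> \<le> L * \<bar>a - b\<bar>"
    using lipschitz_on_nonneg[OF \<sigma>] lipschitz_onD[OF \<sigma>] by (auto simp: dist_real_def)
  have "0 \<le> C\<^sub>\<sigma>" using order_trans[OF abs_ge_zero log[of 0]] by simp
  define \<tau> where "\<tau> = T1 powr (1 - \<alpha>)"
  have \<tau>: "0 \<le> \<tau>" by (simp add: \<tau>_def)
  have tame: "tame (P i j)" for i j unfolding P_def by (rule tame_pairing)
  have A1: "entries_holder T1 \<gamma> (signature_coeff \<sigma> l c0 c1 y)" if y: "y \<in> continuations" for y
    unfolding entries_holder_def
  proof (rule finite_uniform_bound)
    fix i :: 'm and j :: 'd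
    obtain C where C: "0 \<le> C" "holder_on 0 T1 \<alpha> C y" by (rule continuation_holderE[OF y]) (rule that)
    obtain D where D: "0 \<le> D" "holder_on 0 T1 \<alpha> D (P i j (time_augmented y))"
      "\<And>t. t \<in> {0..T1} \<Longrightarrow> \<bar>P i j (time_augmented y) t\<bar> \<le> D"
      by (rule tame_holder[OF tame time_augmented_regular[OF C(2,1)]]) (rule that)
    have "holder_on 0 T1 \<alpha> (L * D) (\<lambda>t. \<sigma> (P i j (time_augmented y) t))"
      unfolding holder_on_def
    proof (intro allI impI)
      fix s t assume st: "0 \<le> s" "s < t" "t \<le> T1"
      have "norm (\<sigma> (P i j (time_augmented y) t) - \<sigma> (P i j (time_augmented y) s)) \<le>
          L * \<bar>P i j (time_augmented y) t - P i j (time_augmented y) s\<bar>" using L(2) by simp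
      also have "\<dots> \<le> L * (D * (t - s) powr \<alpha>)"
        using L(1) holder_onD[OF D(2), of s t] st by (intro mult_left_mono) auto
      finally show "norm (\<sigma> (P i j (time_augmented y) t) - \<sigma> (P i j (time_augmented y) s)) \<le> L * D * (t - s) powr \<alpha>"
        by (simp add: mult.assoc)
    qed
    from holder_on_add[OF holder_on_cmult[OF this, of c1] holder_on_const[OF order_refl, of 0 T1 \<alpha> c0]]
    have "holder_on 0 T1 \<alpha> (\<bar>c1\<bar> * (L * D)) (\<lambda>t. signature_coeff \<sigma> l c0 c1 y t $ i $ j)"
      by (simp add: G)
    then have "holder_on 0 T1 \<gamma> (\<bar>c1\<bar> * (L * D) * T1 powr (\<alpha> - \<gamma>)) (\<lambda>t. signature_coeff \<sigma> l c0 c1 y t $ i $ j)"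
      by (rule holder_on_exponent_le) (use assms(1) L D in auto)
    then show "\<exists>C\<ge>0. holder_on 0 T1 \<gamma> C (\<lambda>t. signature_coeff \<sigma> l c0 c1 y t $ i $ j)"
      using L(1) D(1) by (intro exI[of _ "\<bar>c1\<bar> * (L * D) * T1 powr (\<alpha> - \<gamma>)"]) auto
  qed (rule holder_on_mono)
  have A2: "\<exists>L'\<ge>0. \<forall>i j. \<forall>y\<in>continuations. \<forall>z\<in>continuations. holder_on 0 T1 \<alpha> M y \<longrightarrow> holder_on 0 T1 \<alpha> M z \<longrightarrow>
      (\<forall>s\<in>{0..T1}. \<forall>D\<ge>0. holder_on 0 s \<alpha> D (\<lambda>t. y t - z t) \<longrightarrow>
        \<bar>signature_coeff \<sigma> l c0 c1 y s $ i $ j - signature_coeff \<sigma> l c0 c1 z s $ i $ j\<bar> \<le> L' * D)" for M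
  proof (rule finite_uniform_bound)
    fix i :: 'm and j :: 'd
    define N where "N = 1 + \<tau> + \<bar>M\<bar>"
    have N: "1 \<le> N" using \<tau> by (simp add: N_def)
    from tame[of i j] obtain c n where f': "tame_with c n (P i j)"
      by (auto simp: tame_def)
    note f = tame_withD[OF f']
    define K where "K = \<bar>c1\<bar> * (L * (c * N ^ n))"
    have "\<bar>signature_coeff \<sigma> l c0 c1 y s $ i $ j - signature_coeff \<sigma> l c0 c1 z s $ i $ j\<bar> \<le> K * D"
      if "holder_on 0 T1 \<alpha> M y" "holder_on 0 T1 \<alpha> M z" and s: "s \<in> {0..T1}"
        and D: "0 \<le> D" "holder_on 0 s \<alpha> D (\<lambda>t. y t - z t)" for y z s D
    proof -
      have b: "path_bound s N (time_augmented y)" if "holder_on 0 T1 \<alpha> M y" for y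
        unfolding N_def \<tau>_def
        by (rule time_augmented_path_bound[OF holder_on_subinterval[OF holder_on_mono[OF that]]]) (use s in auto)
      have "\<bar>P i j (time_augmented y) s - P i j (time_augmented z) s\<bar> \<le> c * N ^ n * D"
        using s by (intro f(4)[OF s N D(1) b b time_augmented_diff_bound[OF D(2,1)]] that) auto
      then have "L * \<bar>P i j (time_augmented y) s - P i j (time_augmented z) s\<bar> \<le> L * (c * N ^ n * D)"
        using L(1) by (intro mult_left_mono)
      then have "\<bar>\<sigma> (P i j (time_augmented y) s) - \<sigma> (P i j (time_augmented z) s)\<bar> \<le> L * (c * N ^ n * D)"
        using L(2) order_trans by blast
      then have "\<bar>c1\<bar> * \<bar>\<sigma> (P i j (time_augmented y) s) - \<sigma> (P i j (time_augmented z) s)\<bar> \<le> \<bar>c1\<bar> * (L * (c * N ^ n * D))"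
        by (intro mult_left_mono) auto
      then show ?thesis by (simp add: G K_def mult.assoc flip: abs_mult right_diff_distrib)
    qed
    moreover have "0 \<le> K" using L f(1) N by (simp add: K_def)
    ultimately show "\<exists>C\<ge>0. \<forall>y\<in>continuations. \<forall>z\<in>continuations. holder_on 0 T1 \<alpha> M y \<longrightarrow> holder_on 0 T1 \<alpha> M z \<longrightarrow>
      (\<forall>s\<in>{0..T1}. \<forall>D\<ge>0. holder_on 0 s \<alpha> D (\<lambda>t. y t - z t) \<longrightarrow>
        \<bar>signature_coeff \<sigma> l c0 c1 y s $ i $ j - signature_coeff \<sigma> l c0 c1 z s $ i $ j\<bar> \<le> C * D)"
      by blast
  next
    fix i j and C C' :: real
    assume C: "\<forall>y\<in>continuations. \<forall>z\<in>continuations. holder_on 0 T1 \<alpha> M y \<longrightarrow> holder_on 0 T1 \<alpha> M z \<longrightarrow>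
      (\<forall>s\<in>{0..T1}. \<forall>D\<ge>0. holder_on 0 s \<alpha> D (\<lambda>t. y t - z t) \<longrightarrow>
        \<bar>signature_coeff \<sigma> l c0 c1 y s $ i $ j - signature_coeff \<sigma> l c0 c1 z s $ i $ j\<bar> \<le> C * D)" and "C \<le> C'"
    have "C * D \<le> C' * D" if "0 \<le> D" for D using \<open>C \<le> C'\<close> that by (rule mult_right_mono)
    then show "\<forall>y\<in>continuations. \<forall>z\<in>continuations. holder_on 0 T1 \<alpha> M y \<longrightarrow> holder_on 0 T1 \<alpha> M z \<longrightarrow>
      (\<forall>s\<in>{0..T1}. \<forall>D\<ge>0. holder_on 0 s \<alpha> D (\<lambda>t. y t - z t) \<longrightarrow>
        \<bar>signature_coeff \<sigma> l c0 c1 y s $ i $ j - signature_coeff \<sigma> l c0 c1 z s $ i $ j\<bar> \<le> C' * D)"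
      using C by (meson order_trans)
  qed
  have "\<exists>A\<ge>0. \<forall>i j. \<forall>y s D. s \<in> {0..T1} \<longrightarrow> 0 \<le> D \<longrightarrow> holder_on 0 s \<alpha> D y \<longrightarrow>
      \<bar>signature_coeff \<sigma> l c0 c1 y s $ i $ j\<bar> \<le> A * (1 + D)"
  proof (rule finite_uniform_bound)
    fix i :: 'm and j :: 'd
    from tame[of i j] obtain c n where f': "tame_with c n (P i j)"
      by (auto simp: tame_def)
    note f = tame_withD[OF f']
    define A where "A = \<bar>c1\<bar> * (C\<^sub>\<sigma> * (1 + ln (1 + c) + real n * (\<tau> + 1))) + \<bar>c0\<bar>"
    have ln0: "0 \<le> ln (1 + c)" using f(1) by simp
    have "\<bar>signature_coeff \<sigma> l c0 c1 y s $ i $ j\<bar> \<le> A * (1 + D)"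
      if s: "s \<in> {0..T1}" and D: "0 \<le> D" "holder_on 0 s \<alpha> D y" for y s D
    proof -
      define N where "N = 1 + \<tau> + D"
      have N: "1 \<le> N" using \<tau> D by (simp add: N_def)
      define r where "r = P i j (time_augmented y) s"
      have "path_bound s N (time_augmented y)"
        unfolding N_def \<tau>_def by (rule time_augmented_path_bound[OF D(2,1)]) (use s in auto)
      then have r: "\<bar>r\<bar> \<le> c * N ^ n" unfolding r_def using s by (intro f(2)[OF s N]) auto
      have "1 + \<bar>r\<bar> \<le> (1 + c) * N ^ n"
        using r one_le_power[OF N, of n] by (simp add: algebra_simps)
      then have "ln (1 + \<bar>r\<bar>) \<le> ln ((1 + c) * N ^ n)" by (subst ln_le_cancel_iff) auto
      also have "\<dots> = ln (1 + c) + real n * ln N"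
        using f(1) N by (simp add: ln_mult ln_realpow)
      \<comment> \<open>The logarithm has turned the degree n into a factor, and ln N \<le> N - 1
        makes the bound linear in D.\<close>
      also have "\<dots> \<le> ln (1 + c) + real n * (N - 1)"
        using N by (intro add_left_mono mult_left_mono ln_le_minus_one) auto
      also have "\<dots> \<le> (ln (1 + c) + real n * (\<tau> + 1)) * (1 + D)"
      proof -
        have "0 \<le> ln (1 + c) * D" "0 \<le> real n * (\<tau> * D)" "0 \<le> real n" using ln0 D \<tau> by auto
        then show ?thesis by (simp add: N_def algebra_simps)
      qed
      finally have "1 + ln (1 + \<bar>r\<bar>) \<le> (1 + ln (1 + c) + real n * (\<tau> + 1)) * (1 + D)"
        using D by (simp add: algebra_simps)
      then have "C\<^sub>\<sigma> * (1 + ln (1 + \<bar>r\<bar>)) \<le> C\<^sub>\<sigma> * ((1 + ln (1 + c) + real n * (\<tau> + 1)) * (1 + D))"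
        using \<open>0 \<le> C\<^sub>\<sigma>\<close> by (intro mult_left_mono)
      then have "\<bar>c1\<bar> * \<bar>\<sigma> r\<bar> \<le> \<bar>c1\<bar> * (C\<^sub>\<sigma> * ((1 + ln (1 + c) + real n * (\<tau> + 1)) * (1 + D)))"
        using log[of r] by (intro mult_left_mono) auto
      moreover have "\<bar>c0\<bar> * 1 \<le> \<bar>c0\<bar> * (1 + D)" using D by (intro mult_left_mono) auto
      moreover have "\<bar>c1 * \<sigma> r + c0\<bar> \<le> \<bar>c1\<bar> * \<bar>\<sigma> r\<bar> + \<bar>c0\<bar> * 1"
        by (rule order_trans[OF abs_triangle_ineq]) (simp add: abs_mult)
      ultimately have "\<bar>c1 * \<sigma> r + c0\<bar> \<le> \<bar>c1\<bar> * (C\<^sub>\<sigma> * ((1 + ln (1 + c) + real n * (\<tau> + 1)) * (1 + D))) + \<bar>c0\<bar> * (1 + D)"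
        by linarith
      also have "\<dots> = A * (1 + D)" unfolding A_def by (simp only: distrib_right mult.assoc)
      finally show ?thesis by (simp add: G r_def)
    qed
    moreover have "0 \<le> A" using \<open>0 \<le> C\<^sub>\<sigma>\<close> ln0 \<tau> by (simp add: A_def)
    ultimately show "\<exists>A\<ge>0. \<forall>y s D. s \<in> {0..T1} \<longrightarrow> 0 \<le> D \<longrightarrow> holder_on 0 s \<alpha> D y \<longrightarrow>
      \<bar>signature_coeff \<sigma> l c0 c1 y s $ i $ j\<bar> \<le> A * (1 + D)" by blast
  next
    fix i j and C C' :: real
    assume C: "\<forall>y s D. s \<in> {0..T1} \<longrightarrow> 0 \<le> D \<longrightarrow> holder_on 0 s \<alpha> D y \<longrightarrow>
      \<bar>signature_coeff \<sigma> l c0 c1 y s $ i $ j\<bar> \<le> C * (1 + D)" and "C \<le> C'"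
    have "C * (1 + D) \<le> C' * (1 + D)" if "0 \<le> D" for D using \<open>C \<le> C'\<close> that by (intro mult_right_mono) auto
    then show "\<forall>y s D. s \<in> {0..T1} \<longrightarrow> 0 \<le> D \<longrightarrow> holder_on 0 s \<alpha> D y \<longrightarrow>
      \<bar>signature_coeff \<sigma> l c0 c1 y s $ i $ j\<bar> \<le> C' * (1 + D)"
      using C by (meson order_trans)
  qed
  then obtain A where A: "0 \<le> A" "\<forall>i j. \<forall>y s D. s \<in> {0..T1} \<longrightarrow> 0 \<le> D \<longrightarrow> holder_on 0 s \<alpha> D y \<longrightarrow>
      \<bar>signature_coeff \<sigma> l c0 c1 y s $ i $ j\<bar> \<le> A * (1 + D)" by blast
  have "coefficient A (signature_coeff \<sigma> l c0 c1)"
    unfolding coefficient_def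
  proof (intro conjI allI ballI impI)
    fix M
    show "\<exists>L\<ge>0. lipschitz_on_ball M L (signature_coeff \<sigma> l c0 c1)"
      using A2[of M] by (elim exE conjE) (rule exI, rule conjI, assumption, simp add: lipschitz_on_ball_def)
  qed (use A1 A in auto)
  then show ?thesis using A(1) by blast
qed

text \<open>Regularity in time comes from stopping one path at two times, the Lipschitz property
  from stopping two paths at one time; the latter holds with the same constant on every ball. Common
  starting values remove the pointwise term of the distance.\<close>

lemma coefficient_functional:
  fixes f :: "real \<times> (real \<Rightarrow> real ^ 'm) \<Rightarrow> (real ^ 'd) \<Rightarrow>\<^sub>L (real ^ 'm)"
  assumes f: "lipschitz_functional \<alpha> \<beta> T1 f" and \<beta>: "0 < \<beta>" "\<beta> < \<alpha>" and \<gamma>eq: "\<gamma> = \<alpha> - \<beta>"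
  shows "\<exists>A\<ge>0. coefficient A (functional_coeff T1 f)"
proof -
  have T1: "0 \<le> T1" using T by simp
  obtain L where L: "0 \<le> L" "\<And>p q. p \<in> stopped_paths \<alpha> T1 \<Longrightarrow> q \<in> stopped_paths \<alpha> T1 \<Longrightarrow>
    norm (f p - f q) \<le> L * stopped_dist \<beta> T1 p q"
    by (rule lipschitz_functionalE[OF f]) (rule that)
  obtain A where A: "0 \<le> A" "\<forall>y\<in>holder_paths \<alpha> T1. y 0 = w 0 \<longrightarrow> (\<forall>s\<in>{0..T1}. \<forall>D\<ge>0. holder_on 0 s \<alpha> D y \<longrightarrow>
    norm (f (s, stopped_path T1 y s)) \<le> A * (1 + D))"
    using functional_growth[OF f T1 \<beta>(1) less_imp_le[OF \<beta>(2)], of "w 0"] by blast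
  have entry: "\<bar>functional_coeff T1 f y s $ i $ j - functional_coeff T1 f z u $ i $ j\<bar> \<le>
      L * (\<bar>s - u\<bar> + holder_dist \<beta> T1 (stopped_path T1 y s) (stopped_path T1 z u))"
    if "y \<in> continuations" "z \<in> continuations" "s \<in> {0..T1}" "u \<in> {0..T1}" for y z s u i j
  proof -
    have "\<bar>functional_coeff T1 f y s $ i $ j - functional_coeff T1 f z u $ i $ j\<bar> \<le>
        norm (f (s, stopped_path T1 y s) - f (u, stopped_path T1 z u))"
      unfolding functional_coeff_def by (rule matrix_entry_diff_le)
    also have "\<dots> \<le> L * stopped_dist \<beta> T1 (s, stopped_path T1 y s) (u, stopped_path T1 z u)"
      using that by (intro L stopped_pathsI) (auto simp: continuations_def)
    finally show ?thesis by (simp add: stopped_dist_def)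
  qed
  have start: "stopped_path T1 y s 0 = w 0" if "y \<in> continuations" "s \<in> {0..T1}" for y s
    using continuation_start[OF that(1)] that(2) by (simp add: stopped_path_def)
  have "coefficient A (functional_coeff T1 f)"
    unfolding coefficient_def
  proof (intro conjI ballI allI impI)
    fix y assume y: "y \<in> continuations"
    obtain C where C: "0 \<le> C" "holder_on 0 T1 \<alpha> C y" by (rule continuation_holderE[OF y]) (rule that)
    define K where "K = L * (T1 powr (1 - \<gamma>) + C)"
    have "holder_on 0 T1 \<gamma> K (\<lambda>s. functional_coeff T1 f y s $ i $ j)" for i j
      unfolding holder_on_def
    proof (intro allI impI)
      fix u s assume us: "0 \<le> u" "u < s" "s \<le> T1"
      have "holder_on 0 T1 \<beta> (C * (s - u) powr (\<alpha> - \<beta>)) (\<lambda>t. stopped_path T1 y s t - stopped_path T1 y u t)"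
        using us C \<beta> by (intro stopped_at_two_times_holder) auto
      from holder_dist_le[OF this]
      have d: "holder_dist \<beta> T1 (stopped_path T1 y s) (stopped_path T1 y u) \<le> C * (s - u) powr \<gamma>"
        using start[OF y, of s] start[OF y, of u] us C by (simp add: \<gamma>eq)
      have "\<bar>s - u\<bar> = (s - u) powr 1" using us by simp
      also have "\<dots> \<le> T1 powr (1 - \<gamma>) * (s - u) powr \<gamma>"
        using us \<gamma> by (intro powr_le_powr_interval) auto
      finally have "\<bar>s - u\<bar> + holder_dist \<beta> T1 (stopped_path T1 y s) (stopped_path T1 y u) \<le>
          (T1 powr (1 - \<gamma>) + C) * (s - u) powr \<gamma>" using d by (simp add: algebra_simps)
      then have "L * (\<bar>s - u\<bar> + holder_dist \<beta> T1 (stopped_path T1 y s) (stopped_path T1 y u)) \<le>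
          L * ((T1 powr (1 - \<gamma>) + C) * (s - u) powr \<gamma>)" using L by (intro mult_left_mono)
      then show "norm (functional_coeff T1 f y s $ i $ j - functional_coeff T1 f y u $ i $ j) \<le> K * (s - u) powr \<gamma>"
        using entry[OF y y, of s u i j] us by (simp add: K_def mult.assoc)
    qed
    moreover have "0 \<le> K" using L C by (simp add: K_def)
    ultimately show "entries_holder T1 \<gamma> (functional_coeff T1 f y)" unfolding entries_holder_def by blast
  next
    fix M
    have "\<bar>functional_coeff T1 f y s $ i $ j - functional_coeff T1 f z s $ i $ j\<bar> \<le> L * T1 powr (\<alpha> - \<beta>) * D"
      if y: "y \<in> continuations" and z: "z \<in> continuations" and s: "s \<in> {0..T1}"
        and D: "0 \<le> D" "holder_on 0 s \<alpha> D (\<lambda>t. y t - z t)" for y z s D i j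
    proof -
      have "holder_on 0 s \<beta> (D * T1 powr (\<alpha> - \<beta>)) (\<lambda>t. y t - z t)"
        by (rule holder_on_exponent_le[OF D(2)]) (use s D \<beta> in auto)
      then have "holder_on 0 T1 \<beta> (D * T1 powr (\<alpha> - \<beta>)) (\<lambda>t. stopped_path T1 y s t - stopped_path T1 z s t)"
        by (rule stopped_diff_holder) (use s D \<beta> in auto)
      from holder_dist_le[OF this]
      have "holder_dist \<beta> T1 (stopped_path T1 y s) (stopped_path T1 z s) \<le> D * T1 powr (\<alpha> - \<beta>)"
        using start[OF y s] start[OF z s] D by simp
      then have "L * (\<bar>s - s\<bar> + holder_dist \<beta> T1 (stopped_path T1 y s) (stopped_path T1 z s)) \<le> L * (D * T1 powr (\<alpha> - \<beta>))"
        using L by (intro mult_left_mono) auto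
      then show ?thesis using entry[OF y z s s, of i j] by (simp add: mult_ac)
    qed
    then show "\<exists>L\<ge>0. lipschitz_on_ball M L (functional_coeff T1 f)"
      unfolding lipschitz_on_ball_def using L(1) by (intro exI[of _ "L * T1 powr (\<alpha> - \<beta>)"]) auto
  next
    fix y s and D :: real and i j
    assume a: "y \<in> continuations" "s \<in> {0..T1}" "0 \<le> D" "holder_on 0 s \<alpha> D y"
    have "norm (f (s, stopped_path T1 y s)) \<le> A * (1 + D)"
      using A(2) a continuation_start[OF a(1)] by (auto simp: continuations_def)
    then show "\<bar>functional_coeff T1 f y s $ i $ j\<bar> \<le> A * (1 + D)"
      unfolding functional_coeff_def by (rule order_trans[OF matrix_entry_le])
  qed
  then show ?thesis using A(1) by blast
qed

end

lemma unit_clamp_lipschitz: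
  fixes a b :: real
  shows "\<bar>max (- 1) (min 1 a) - max (- 1) (min 1 b)\<bar> \<le> \<bar>a - b\<bar>"
  by (auto simp: max_def min_def)

section \<open>Truncated coefficients and approximation of solutions\<close>

context history
begin

text \<open>Moving \<open>G\<close> towards \<open>H\<close> by at most \<open>1\<close> gives a coefficient whose growth does not depend on \<open>H\<close>, and
  which coincides with \<open>H\<close> where the two differ by at most \<open>1\<close>. Hence solutions of the \<open>H\<close>-equation
  obey a priori bounds independent of \<open>H\<close>.\<close>

definition corrected ::
    "((real \<Rightarrow> real ^ 'm) \<Rightarrow> real \<Rightarrow> real ^ 'd ^ 'm) \<Rightarrow> ((real \<Rightarrow> real ^ 'm) \<Rightarrow> real \<Rightarrow> real ^ 'd ^ 'm) \<Rightarrow>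
      (real \<Rightarrow> real ^ 'm) \<Rightarrow> real \<Rightarrow> real ^ 'd ^ 'm"
  where "corrected G H y s = (\<chi> i j. G y s $ i $ j + max (- 1) (min 1 (H y s $ i $ j - G y s $ i $ j)))"

text \<open>Each entry of the correction is at most 1 in absolute value, so A' does not reach the
  growth constant. Hoelder and Lipschitz constants may depend on H, as they do not enter the a
  priori bound.\<close>

lemma coefficient_corrected:
  fixes G H :: "(real \<Rightarrow> real ^ 'm) \<Rightarrow> real \<Rightarrow> real ^ 'd ^ 'm"
  assumes G: "coefficient A G" and H: "coefficient A' H" and A: "0 \<le> A"
  shows "coefficient (A + 1) (corrected G H)"
  unfolding coefficient_def
proof (intro conjI ballI allI impI)
  fix y assume y: "y \<in> continuations"
  obtain C where C: "0 \<le> C" "\<And>i j. holder_on 0 T1 \<gamma> C (\<lambda>s. G y s $ i $ j)"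
    using coefficient_entries_holder[OF G y] by (auto simp: entries_holder_def)
  obtain D where D: "0 \<le> D" "\<And>i j. holder_on 0 T1 \<gamma> D (\<lambda>s. H y s $ i $ j)"
    using coefficient_entries_holder[OF H y] by (auto simp: entries_holder_def)
  have "holder_on 0 T1 \<gamma> (C + (D + C)) (\<lambda>s. corrected G H y s $ i $ j)" for i j
  proof -
    have hd: "holder_on 0 T1 \<gamma> (D + C) (\<lambda>s. H y s $ i $ j - G y s $ i $ j)"
      by (intro holder_on_diff C D)
    have "holder_on 0 T1 \<gamma> (D + C) (\<lambda>s. max (- 1) (min 1 (H y s $ i $ j - G y s $ i $ j)))"
      unfolding holder_on_def real_norm_def
    proof (intro allI impI)
      fix s t assume st: "0 \<le> s" "s < t" "t \<le> T1"
      show "\<bar>max (- 1) (min 1 (H y t $ i $ j - G y t $ i $ j)) - max (- 1) (min 1 (H y s $ i $ j - G y s $ i $ j))\<bar>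
          \<le> (D + C) * (t - s) powr \<gamma>"
        by (rule order_trans[OF unit_clamp_lipschitz holder_onD[OF hd, unfolded real_norm_def]]) (use st in auto)
    qed
    from holder_on_add[OF C(2)[of i j] this] show ?thesis by (simp add: corrected_def)
  qed
  then show "entries_holder T1 \<gamma> (corrected G H y)"
    unfolding entries_holder_def using C D by (intro exI[of _ "C + (D + C)"]) auto
next
  fix M
  obtain L where L: "0 \<le> L" "lipschitz_on_ball M L G"
    by (rule coefficient_lipschitz[OF G, of M]) (rule that)
  obtain L' where L': "0 \<le> L'" "lipschitz_on_ball M L' H"
    by (rule coefficient_lipschitz[OF H, of M]) (rule that)
  have "\<bar>corrected G H y s $ i $ j - corrected G H z s $ i $ j\<bar> \<le> (L + (L' + L)) * D"
    if a: "y \<in> continuations" "z \<in> continuations" "holder_on 0 T1 \<alpha> M y" "holder_on 0 T1 \<alpha> M z"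
      "s \<in> {0..T1}" "0 \<le> D" "holder_on 0 s \<alpha> D (\<lambda>t. y t - z t)" for y z s D i j
  proof -
    have "\<bar>corrected G H y s $ i $ j - corrected G H z s $ i $ j\<bar> \<le>
        \<bar>G y s $ i $ j - G z s $ i $ j\<bar> + \<bar>(H y s $ i $ j - G y s $ i $ j) - (H z s $ i $ j - G z s $ i $ j)\<bar>"
    proof -
      have "\<bar>(a + c) - (b + d)\<bar> \<le> \<bar>a - b\<bar> + e" if "\<bar>c - d\<bar> \<le> e" for a b c d e :: real
        using that by linarith
      from this[OF unit_clamp_lipschitz] show ?thesis by (simp add: corrected_def)
    qed
    also have "\<dots> \<le> L * D + (L' * D + L * D)"
      using lipschitz_on_ballD[OF L(2) a, of i j] lipschitz_on_ballD[OF L'(2) a, of i j] by linarith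
    finally show ?thesis by (simp add: algebra_simps)
  qed
  then show "\<exists>L\<ge>0. lipschitz_on_ball M L (corrected G H)"
    unfolding lipschitz_on_ball_def using L(1) L'(1) by (intro exI[of _ "L + (L' + L)"]) auto
next
  fix y s and D :: real and i j
  assume a: "y \<in> continuations" "s \<in> {0..T1}" "0 \<le> D" "holder_on 0 s \<alpha> D y"
  have "\<bar>corrected G H y s $ i $ j\<bar> \<le> \<bar>G y s $ i $ j\<bar> + 1" unfolding corrected_def by simp
  also have "\<dots> \<le> A * (1 + D) + (1 + D)" using coefficient_growth[OF G a] a(3) by (intro add_mono) auto
  finally show "\<bar>corrected G H y s $ i $ j\<bar> \<le> (A + 1) * (1 + D)" by (simp add: algebra_simps)
qed

lemma coefficient_mono:
  fixes G :: "(real \<Rightarrow> real ^ 'm) \<Rightarrow> real \<Rightarrow> real ^ 'd ^ 'm"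
  assumes G: "coefficient A G" and "A \<le> A'"
  shows "coefficient A' G"
proof -
  have "A * (1 + D) \<le> A' * (1 + D)" if "0 \<le> D" for D
    using assms(2) that by (intro mult_right_mono) auto
  then have "\<forall>y\<in>continuations. \<forall>s\<in>{0..T1}. \<forall>D\<ge>0. holder_on 0 s \<alpha> D y \<longrightarrow> (\<forall>i j. \<bar>G y s $ i $ j\<bar> \<le> A' * (1 + D))"
    using coefficient_growth[OF G] order_trans by blast
  then show ?thesis using G unfolding coefficient_def by blast
qed

text \<open>The fixed-point equation evaluates the coefficient only along z and after T0, so
  agreement there is enough to change the equation.\<close>

lemma solution_corrected:
  fixes G H :: "(real \<Rightarrow> real ^ 'm) \<Rightarrow> real \<Rightarrow> real ^ 'd ^ 'm"
  assumes G: "coefficient A G" and H: "coefficient A' H" and A: "0 \<le> A" and x: "driver T1 K x"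
    and z: "is_solution T0 T1 \<alpha> w (corrected G H) x z"
    and near: "\<And>s i j. s \<in> {T0..T1} \<Longrightarrow> \<bar>G z s $ i $ j - H z s $ i $ j\<bar> \<le> 1"
  shows "is_solution T0 T1 \<alpha> w H x z"
proof -
  have zc: "z \<in> continuations" and zeq: "\<forall>t\<in>{T0..T1}. z t = w T0 + rs_drive (corrected G H z) x T0 t"
    using z is_solution_iff[OF coefficient_corrected[OF G H A] x] by auto
  have "corrected G H z s $ i $ j = H z s $ i $ j" if "s \<in> {T0..T1}" for s i j
    using near[OF that, of i j] by (simp add: corrected_def abs_le_iff max_def min_def)
  then have "rs_drive (corrected G H z) x T0 t = rs_drive (H z) x T0 t" if "t \<in> {T0..T1}" for t
    unfolding rs_drive_def vec_eq_iff using that by (auto intro!: sum.cong rs_integral_cong)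
  then show ?thesis using is_solution_iff[OF H x] zc zeq by auto
qed

lemma stopped_ball_subset_stopped_paths:
  "0 \<le> M \<Longrightarrow> stopped_ball T1 \<alpha> M V \<subseteq> stopped_paths \<alpha> T1"
  unfolding stopped_ball_def
  by (auto simp: holder_ball_def intro!: stopped_pathsI intro: holder_pathsI)

text \<open>f is Lipschitz for a \<beta>-Hoelder distance, which uniform closeness controls on an
  \<alpha>-Hoelder ball because \<beta> < \<alpha>.\<close>

lemma continuous_on_functional_entry:
  fixes f :: "real \<times> (real \<Rightarrow> real ^ 'm) \<Rightarrow> (real ^ 'd) \<Rightarrow>\<^sub>L (real ^ 'm)"
  assumes f: "lipschitz_functional \<alpha> \<beta> T1 f" and \<beta>: "0 < \<beta>" "\<beta> < \<alpha>" and M: "0 \<le> M"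
  shows "continuous_on (stopped_ball T1 \<alpha> M {w 0}) (\<lambda>p. matrix (blinfun_apply (f p)) $ i $ j)"
proof -
  let ?S = "stopped_ball T1 \<alpha> M {w 0}"
  have T1: "0 \<le> T1" and \<alpha>0: "0 < \<alpha>" using T \<alpha> by auto
  obtain L where L: "0 \<le> L" "\<And>p q. p \<in> stopped_paths \<alpha> T1 \<Longrightarrow> q \<in> stopped_paths \<alpha> T1 \<Longrightarrow>
    norm (f p - f q) \<le> L * stopped_dist \<beta> T1 p q"
    by (rule lipschitz_functionalE[OF f]) (rule that)
  have sub: "?S \<subseteq> {0..T1} \<times> holder_ball T1 \<alpha> M {w 0}" by (rule stopped_ball_subset[OF M \<alpha>0])
  have sp: "?S \<subseteq> stopped_paths \<alpha> T1" by (rule stopped_ball_subset_stopped_paths[OF M])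
  show ?thesis
  proof (rule continuous_on_holder_ball[OF T1 \<alpha>0 M])
    show "?S \<subseteq> UNIV \<times> holder_ball T1 \<alpha> M {w 0}" using sub by auto
    fix \<epsilon> :: real assume \<epsilon>: "0 < \<epsilon>"
    define e where "e = \<epsilon> / (3 * (L + 1))"
    have e: "0 < e" using \<epsilon> L by (simp add: e_def)
    have Le: "L * (2 * e) < \<epsilon>"
    proof -
      have "L * (2 * e) = (L / (L + 1)) * (2 * \<epsilon> / 3)" by (simp add: e_def)
      also have "\<dots> \<le> 1 * (2 * \<epsilon> / 3)" using L \<epsilon> by (intro mult_right_mono) auto
      finally show ?thesis using \<epsilon> by simp
    qed
    obtain \<delta> where \<delta>: "0 < \<delta>" "(M + M) powr (\<beta> / \<alpha>) * (2 * \<delta>) powr (1 - \<beta> / \<alpha>) \<le> e" "\<delta> \<le> e"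
      using small_interpolation_constant[of "M + M" \<beta> \<alpha> e] M \<beta> e by auto
    have "dist (matrix (blinfun_apply (f (t, y))) $ i $ j) (matrix (blinfun_apply (f (s, z))) $ i $ j) < \<epsilon>"
      if y: "(t, y) \<in> ?S" and z: "(s, z) \<in> ?S" and ts: "\<bar>t - s\<bar> < \<delta>" and yz: "\<forall>r\<in>{0..T1}. norm (y r - z r) < \<delta>"
      for t y s z
    proof -
      have yb: "y \<in> holder_ball T1 \<alpha> M {w 0}" and zb: "z \<in> holder_ball T1 \<alpha> M {w 0}" using y z sub by auto
      have "holder_on 0 T1 \<alpha> (M + M) (\<lambda>u. y u - z u)"
        using yb zb by (intro holder_on_diff) (auto simp: holder_ball_def)
      then have "holder_on 0 T1 \<beta> ((M + M) powr (\<beta> / \<alpha>) * (2 * \<delta>) powr (1 - \<beta> / \<alpha>)) (\<lambda>u. y u - z u)"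
        by (rule holder_on_interpolate) (use yz M \<beta> in \<open>auto intro: less_imp_le\<close>)
      then have "holder_on 0 T1 \<beta> e (\<lambda>u. y u - z u)" by (rule holder_on_mono) (rule \<delta>(2))
      from holder_dist_le[OF this] have "holder_dist \<beta> T1 y z \<le> e"
        using yb zb e by (simp add: holder_ball_def)
      then have "stopped_dist \<beta> T1 (t, y) (s, z) \<le> 2 * e" using ts \<delta>(3) by (simp add: stopped_dist_def)
      then have "L * stopped_dist \<beta> T1 (t, y) (s, z) \<le> L * (2 * e)" using L by (intro mult_left_mono) auto
      moreover have "norm (f (t, y) - f (s, z)) \<le> L * stopped_dist \<beta> T1 (t, y) (s, z)"
        using y z sp by (intro L) auto
      ultimately show ?thesis
        using matrix_entry_diff_le[of "f (t, y)" i j "f (s, z)"] Le by (simp add: dist_real_def)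
    qed
    then show "\<exists>\<delta>>0. \<forall>t y s z. (t, y) \<in> ?S \<longrightarrow> (s, z) \<in> ?S \<longrightarrow> \<bar>t - s\<bar> < \<delta> \<longrightarrow> (\<forall>r\<in>{0..T1}. norm (y r - z r) < \<delta>) \<longrightarrow>
      dist (matrix (blinfun_apply (f (t, y))) $ i $ j) (matrix (blinfun_apply (f (s, z))) $ i $ j) < \<epsilon>"
      using \<delta>(1) by blast
  qed
qed

text \<open>\<theta> is the inverse of the scaled \<sigma> on [0,1], continuous by compactness. Each
  entry of \<theta> applied to f is approximated by a pairing, and the Lipschitz constant of
  \<sigma> carries the error back through \<sigma>.\<close>

lemma signature_coeff_approximation:
  fixes f :: "real \<times> (real \<Rightarrow> real ^ 'm) \<Rightarrow> (real ^ 'd) \<Rightarrow>\<^sub>L (real ^ 'm)"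
  assumes f: "lipschitz_functional \<alpha> \<beta> T1 f" and \<beta>: "0 < \<beta>" "\<beta> < \<alpha>" and M: "0 \<le> M"
    and \<sigma>: "L-lipschitz_on UNIV \<sigma>" "inj \<sigma>" and c1: "0 < c1" and \<epsilon>: "0 < \<epsilon>"
    and cover: "\<And>p i j. p \<in> stopped_ball T1 \<alpha> M {w 0} \<Longrightarrow>
      matrix (blinfun_apply (f p)) $ i $ j \<in> (\<lambda>r. c1 * \<sigma> r + c0) ` {0..1}"
  shows "\<exists>l. \<forall>y\<in>holder_ball T1 \<alpha> M {w 0}. \<forall>t\<in>{0..T1}. \<forall>i j.
    \<bar>functional_coeff T1 f y t $ i $ j - signature_coeff \<sigma> l c0 c1 y t $ i $ j\<bar> \<le> \<epsilon>"
proof -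
  interpret signature_paths T1 \<alpha> by unfold_locales (use T \<alpha> in auto)
  let ?S = "stopped_ball T1 \<alpha> M {w 0}"
  define \<phi> where "\<phi> = (\<lambda>r. c1 * \<sigma> r + c0)"
  define \<theta> where "\<theta> = inv_into {0..1} \<phi>"
  have L: "0 \<le> L" "\<And>a b. \<bar>\<sigma> a - \<sigma> b\<bar> \<le> L * \<bar>a - b\<bar>"
    using lipschitz_on_nonneg[OF \<sigma>(1)] lipschitz_onD[OF \<sigma>(1)] by (auto simp: dist_real_def)
  have "inj \<phi>" using \<sigma>(2) c1 by (auto simp: \<phi>_def inj_def)
  then have inj: "inj_on \<phi> {0..1}" by (rule inj_on_subset) simp
  have \<phi>c: "continuous_on {0..1} \<phi>"
    unfolding \<phi>_def
    by (intro continuous_intros continuous_on_subset[OF lipschitz_on_continuous_on[OF \<sigma>(1)]]) auto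
  have \<theta>c: "continuous_on (\<phi> ` {0..1}) \<theta>"
    by (rule continuous_on_inv[OF \<phi>c compact_Icc]) (use inj in \<open>auto simp: \<theta>_def\<close>)
  define \<delta> where "\<delta> = \<epsilon> / (c1 * L + 1)"
  have pos: "0 < c1 * L + 1" using c1 L by (simp add: add_nonneg_pos)
  have \<delta>: "0 < \<delta>" using \<epsilon> pos by (simp add: \<delta>_def)
  have "\<exists>l. \<forall>t\<in>{0..T1}. \<forall>y\<in>holder_ball T1 \<alpha> M {w 0}.
      \<bar>\<theta> (matrix (blinfun_apply (f (t, stopped_path T1 y t))) $ i $ j) - tensor_pairing l (signature (time_augmented y) t)\<bar> < \<delta>"
    for i j
  proof (rule signature_approximation[OF M _ \<delta>])
    show "continuous_on ?S (\<lambda>p. \<theta> (matrix (blinfun_apply (f p)) $ i $ j))"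
      by (rule continuous_on_compose2[OF \<theta>c continuous_on_functional_entry[OF f \<beta> M]])
        (use cover in \<open>auto simp: \<phi>_def\<close>)
  qed
  then obtain l where l: "\<And>i j t y. t \<in> {0..T1} \<Longrightarrow> y \<in> holder_ball T1 \<alpha> M {w 0} \<Longrightarrow>
      \<bar>\<theta> (matrix (blinfun_apply (f (t, stopped_path T1 y t))) $ i $ j) -
        tensor_pairing (l i j) (signature (time_augmented y) t)\<bar> < \<delta>"
    by metis
  show ?thesis
  proof (intro exI[of _ "\<chi> i j. l i j"] ballI allI)
    fix y t i j assume y: "y \<in> holder_ball T1 \<alpha> M {w 0}" and t: "t \<in> {0..T1}"
    define m where "m = matrix (blinfun_apply (f (t, stopped_path T1 y t))) $ i $ j"
    define p where "p = tensor_pairing (l i j) (signature (time_augmented y) t)"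
    have "(t, stopped_path T1 y t) \<in> ?S" using y t by (force simp: stopped_ball_def)
    then have "m \<in> \<phi> ` {0..1}" unfolding m_def \<phi>_def by (rule cover)
    then have \<phi>\<theta>: "\<phi> (\<theta> m) = m" unfolding \<theta>_def by (rule f_inv_into_f)
    have "\<bar>m - (c1 * \<sigma> p + c0)\<bar> = \<bar>c1 * (\<sigma> (\<theta> m) - \<sigma> p)\<bar>"
      by (subst \<phi>\<theta>[symmetric]) (simp add: \<phi>_def right_diff_distrib)
    also have "\<dots> = c1 * \<bar>\<sigma> (\<theta> m) - \<sigma> p\<bar>" using c1 by (simp add: abs_mult)
    \<comment> \<open>The pairing p may leave [0,1], where \<theta> no longer inverts; this is
      harmless, as \<sigma> is Lipschitz on the whole line and only \<theta> m has to be
      inverted.\<close>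
    also have "\<dots> \<le> c1 * (L * \<delta>)"
    proof (intro mult_left_mono)
      have "\<bar>\<sigma> (\<theta> m) - \<sigma> p\<bar> \<le> L * \<bar>\<theta> m - p\<bar>" by (rule L)
      also have "\<dots> \<le> L * \<delta>" using l[OF t y, of i j] L unfolding m_def p_def by (intro mult_left_mono) auto
      finally show "\<bar>\<sigma> (\<theta> m) - \<sigma> p\<bar> \<le> L * \<delta>" .
    qed (use c1 in simp)
    also have "\<dots> \<le> (c1 * L + 1) * \<delta>" using \<delta> by (simp add: algebra_simps)
    also have "\<dots> = \<epsilon>" using pos by (simp add: \<delta>_def)
    finally show "\<bar>functional_coeff T1 f y t $ i $ j - signature_coeff \<sigma> (\<chi> i j. l i j) c0 c1 y t $ i $ j\<bar> \<le> \<epsilon>"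
      by (simp add: functional_coeff_def signature_coeff_def m_def p_def)
  qed
qed

text \<open>The order of the quantifiers is the point: M is fixed by the growth constant A + 1
  before c0, c1, \<epsilon> and l. The corrected equation has a solution in the ball of radius M;
  there l approximates well enough for the correction to be inactive, so it also solves the
  signature equation and by uniqueness is the given z.\<close>

lemma signature_solution_approximation:
  fixes f :: "real \<times> (real \<Rightarrow> real ^ 'm) \<Rightarrow> (real ^ 'd) \<Rightarrow>\<^sub>L (real ^ 'm)"
  assumes f: "lipschitz_functional \<alpha> \<beta> T1 f" and \<beta>: "0 < \<beta>" "\<beta> < \<alpha>" and \<gamma>eq: "\<gamma> = \<alpha> - \<beta>"
    and \<sigma>: "L-lipschitz_on UNIV \<sigma>" "inj \<sigma>" and log: "\<And>r. \<bar>\<sigma> r\<bar> \<le> C\<^sub>\<sigma> * (1 + ln (1 + \<bar>r\<bar>))" and K: "0 \<le> K"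
  shows "\<exists>M\<ge>0. \<forall>c0 c1. 0 < c1 \<longrightarrow> (\<forall>p\<in>stopped_ball T1 \<alpha> M {w 0}. \<forall>i j.
      matrix (blinfun_apply (f p)) $ i $ j \<in> (\<lambda>r. c1 * \<sigma> r + c0) ` {0..1}) \<longrightarrow>
    (\<forall>\<epsilon>>0. \<exists>l. \<forall>x y z. driver T1 K x \<longrightarrow> is_solution T0 T1 \<alpha> w (functional_coeff T1 f) x y \<longrightarrow>
      is_solution T0 T1 \<alpha> w (signature_coeff \<sigma> l c0 c1) x z \<longrightarrow> holder_on 0 T1 \<alpha> \<epsilon> (\<lambda>t. y t - z t))"
proof -
  let ?G = "functional_coeff T1 f :: (real \<Rightarrow> real ^ 'm) \<Rightarrow> real \<Rightarrow> real ^ 'd ^ 'm"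
  obtain A where A: "0 \<le> A" and G: "coefficient A ?G"
    using coefficient_functional[OF f \<beta> \<gamma>eq] by blast
  have A1: "0 \<le> A + 1" and G1: "coefficient (A + 1) ?G"
    using A coefficient_mono[OF G, of "A + 1"] by auto
  obtain M where M: "0 \<le> M" "\<forall>(G :: (real \<Rightarrow> real ^ 'm) \<Rightarrow> real \<Rightarrow> real ^ 'd ^ 'm) x y.
    coefficient (A + 1) G \<longrightarrow> driver T1 K x \<longrightarrow> is_solution T0 T1 \<alpha> w G x y \<longrightarrow> holder_on 0 T1 \<alpha> M y"
    using solution_bound[OF A1 K] by blast
  obtain C where C: "0 \<le> C" "\<forall>A' (H :: (real \<Rightarrow> real ^ 'm) \<Rightarrow> real \<Rightarrow> real ^ 'd ^ 'm) x y z \<epsilon>. coefficient A' H \<longrightarrow>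
    driver T1 K x \<longrightarrow> is_solution T0 T1 \<alpha> w ?G x y \<longrightarrow> is_solution T0 T1 \<alpha> w H x z \<longrightarrow>
    holder_on 0 T1 \<alpha> M y \<longrightarrow> holder_on 0 T1 \<alpha> M z \<longrightarrow> 0 \<le> \<epsilon> \<longrightarrow>
    (\<forall>u\<in>{T0..T1}. \<forall>i j. \<bar>?G z u $ i $ j - H z u $ i $ j\<bar> \<le> \<epsilon>) \<longrightarrow>
    holder_on 0 T1 \<alpha> (C * \<epsilon>) (\<lambda>t. y t - z t)"
    using solution_comparison[OF G K, of M] by blast
  show ?thesis
  proof (intro exI[of _ M] conjI M(1) allI impI)
    fix c0 c1 \<epsilon> :: real
    assume c1: "0 < c1" and cover: "\<forall>p\<in>stopped_ball T1 \<alpha> M {w 0}. \<forall>i j.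
      matrix (blinfun_apply (f p)) $ i $ j \<in> (\<lambda>r. c1 * \<sigma> r + c0) ` {0..1}" and \<epsilon>: "0 < \<epsilon>"
    \<comment> \<open>At most 1, so that the clamp in \<open>corrected\<close> has no effect, and
      small enough for the stability constant C to turn it into \<epsilon>.\<close>
    define e where "e = min 1 (\<epsilon> / (C + 1))"
    have e: "0 < e" "e \<le> 1" "C * e \<le> \<epsilon>"
    proof -
      show "0 < e" "e \<le> 1" using \<epsilon> C by (auto simp: e_def)
      have "C * e \<le> C * (\<epsilon> / (C + 1))" using C by (intro mult_left_mono) (auto simp: e_def)
      also have "\<dots> = (C / (C + 1)) * \<epsilon>" by simp
      also have "\<dots> \<le> 1 * \<epsilon>" using C \<epsilon> by (intro mult_right_mono) auto
      finally show "C * e \<le> \<epsilon>" by simp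
    qed
    obtain l where l: "\<forall>y\<in>holder_ball T1 \<alpha> M {w 0}. \<forall>t\<in>{0..T1}. \<forall>i j.
      \<bar>?G y t $ i $ j - signature_coeff \<sigma> l c0 c1 y t $ i $ j\<bar> \<le> e"
      using signature_coeff_approximation[OF f \<beta> M(1) \<sigma> c1 e(1)] cover by blast
    let ?H = "signature_coeff \<sigma> l c0 c1"
    obtain A' where H: "coefficient A' ?H"
      using coefficient_signature[OF _ \<sigma>(1) log, of l c0 c1] \<beta> \<gamma>eq by auto
    show "\<exists>l. \<forall>x y z. driver T1 K x \<longrightarrow> is_solution T0 T1 \<alpha> w (functional_coeff T1 f) x y \<longrightarrow>
      is_solution T0 T1 \<alpha> w (signature_coeff \<sigma> l c0 c1) x z \<longrightarrow> holder_on 0 T1 \<alpha> \<epsilon> (\<lambda>t. y t - z t)"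
    proof (intro exI[of _ l] allI impI)
      fix x y z assume x: "driver T1 K x" and y: "is_solution T0 T1 \<alpha> w ?G x y"
        and z: "is_solution T0 T1 \<alpha> w ?H x z"
      have cG: "coefficient (A + 1) (corrected ?G ?H)" by (rule coefficient_corrected[OF G H A])
      obtain z' where z': "is_solution T0 T1 \<alpha> w (corrected ?G ?H) x z'"
        using solution_exists[OF cG A1 x] by blast
      have z'M: "holder_on 0 T1 \<alpha> M z'" using M(2) cG x z' by blast
      have z'c: "z' \<in> continuations" using z' is_solution_iff[OF cG x] by blast
      have near: "\<bar>?G z' s $ i $ j - ?H z' s $ i $ j\<bar> \<le> e" if "s \<in> {T0..T1}" for s i j
        using l holder_ball_continuation[OF z'c z'M] that T by auto
      have "is_solution T0 T1 \<alpha> w ?H x z'"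
        by (rule solution_corrected[OF G H A x z']) (use near e(2) order_trans in blast)
      then have zz: "z' = z" using solution_unique[OF H x] z by blast
      have yM: "holder_on 0 T1 \<alpha> M y" using M(2) G1 x y by blast
      have "holder_on 0 T1 \<alpha> (C * e) (\<lambda>t. y t - z t)"
        by (rule C(2)[rule_format, OF H x y z yM z'M[unfolded zz]]) (use near e(1) zz in auto)
      then show "holder_on 0 T1 \<alpha> \<epsilon> (\<lambda>t. y t - z t)" by (rule holder_on_mono) (rule e(3))
    qed
  qed
qed

lemma functional_bounded_on_stopped_ball:
  fixes f :: "real \<times> (real \<Rightarrow> real ^ 'm) \<Rightarrow> (real ^ 'd) \<Rightarrow>\<^sub>L (real ^ 'm)"
  assumes f: "lipschitz_functional \<alpha> \<beta> T1 f" and \<beta>: "0 < \<beta>" "\<beta> < \<alpha>" and M: "0 \<le> M"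
  shows "\<exists>F. \<forall>p\<in>stopped_ball T1 \<alpha> M {w 0}. norm (f p) \<le> F"
proof -
  obtain A where A: "0 \<le> A" "\<forall>y\<in>holder_paths \<alpha> T1. y 0 = w 0 \<longrightarrow> (\<forall>s\<in>{0..T1}. \<forall>D\<ge>0. holder_on 0 s \<alpha> D y \<longrightarrow>
    norm (f (s, stopped_path T1 y s)) \<le> A * (1 + D))"
    using functional_growth[OF f _ \<beta>(1) less_imp_le[OF \<beta>(2)], of "w 0"] T by auto
  have "norm (f (s, stopped_path T1 y s)) \<le> A * (1 + M)"
    if s: "s \<in> {0..T1}" and y: "y \<in> holder_ball T1 \<alpha> M {w 0}" for s y
  proof (rule A(2)[rule_format])
    show "y \<in> holder_paths \<alpha> T1" using y M by (intro holder_pathsI) (auto simp: holder_ball_def)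
    show "holder_on 0 s \<alpha> M y" by (rule holder_on_subinterval[of 0 T1]) (use y s in \<open>auto simp: holder_ball_def\<close>)
  qed (use y s M in \<open>auto simp: holder_ball_def\<close>)
  then show ?thesis by (intro exI[of _ "A * (1 + M)"]) (auto simp: stopped_ball_def)
qed

end

section \<open>Weights\<close>

text \<open>B n k stands for the error bound of the n-th equation on the ball of radius k. At level
  N the weight dominates all entries with both indices at most N, multiplied by 1 + N, so beyond
  radius n the ratio of error to weight for the n-th equation is at most 1 / (1 + n).\<close>

lemma diagonal_weight_exists:
  fixes B :: "nat \<Rightarrow> nat \<Rightarrow> real"
  shows "\<exists>b :: real \<Rightarrow> real. (\<forall>s\<ge>0. 1 \<le> b s) \<and> (\<forall>R. \<exists>r. \<forall>s\<ge>0. b s \<le> R \<longleftrightarrow> s \<le> r) \<and>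
    (\<forall>n s. real n \<le> s \<longrightarrow> (1 + real n) * B n (nat \<lceil>s\<rceil>) \<le> b s)"
proof -
  define S where "S = (\<lambda>N. \<Sum>m\<le>N. \<Sum>k\<le>N. \<bar>B m k\<bar>)"
  define b where "b = (\<lambda>N. (1 + real N) * (1 + S N))"
  have S0: "0 \<le> S N" for N unfolding S_def by (intro sum_nonneg) auto
  have Smono: "S N \<le> S N'" if "N \<le> N'" for N N'
    unfolding S_def using that
    by (intro order_trans[OF sum_mono2 sum_mono] sum_nonneg sum_mono2) auto
  have bmono: "b N \<le> b N'" if "N \<le> N'" for N N'
    unfolding b_def using that Smono[OF that] S0[of N] by (intro mult_mono) auto
  have blow: "1 + real N \<le> b N" for N
  proof -
    have "(1 + real N) * 1 \<le> (1 + real N) * (1 + S N)" using S0[of N] by (intro mult_left_mono) auto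
    then show ?thesis by (simp add: b_def)
  qed
  show ?thesis
  \<comment> \<open>Rounding up, rather than down, makes the sublevel sets intervals closed on the
    right.\<close>
  proof (intro exI[of _ "\<lambda>s. b (nat \<lceil>s\<rceil>)"] conjI allI impI)
    fix s :: real
    show "1 \<le> b (nat \<lceil>s\<rceil>)" using blow[of "nat \<lceil>s\<rceil>"] by linarith
  next
    fix R :: real
    let ?N = "{N. b N \<le> R}"
    have fin: "finite ?N"
    proof (rule finite_subset)
      show "?N \<subseteq> {..nat \<lceil>\<bar>R\<bar>\<rceil>}"
      proof
        fix N assume "N \<in> ?N"
        then have "real N \<le> \<bar>R\<bar>" using blow[of N] by simp
        then show "N \<in> {..nat \<lceil>\<bar>R\<bar>\<rceil>}" by (simp add: le_nat_iff le_ceiling_iff)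
      qed
    qed simp
    show "\<exists>r::real. \<forall>s\<ge>0. b (nat \<lceil>s\<rceil>) \<le> R \<longleftrightarrow> s \<le> r"
    proof (cases "?N = {}")
      case True
      then show ?thesis by (intro exI[of _ "- 1"]) auto
    next
      case False
      have bMax: "b N \<le> R \<longleftrightarrow> N \<le> Max ?N" for N
      proof
        assume "b N \<le> R" then show "N \<le> Max ?N" using fin by simp
      next
        assume "N \<le> Max ?N"
        then have "b N \<le> b (Max ?N)" by (rule bmono)
        also have "\<dots> \<le> R" using Max_in[OF fin False] by simp
        finally show "b N \<le> R" .
      qed
      have eq: "b (nat \<lceil>s\<rceil>) \<le> R \<longleftrightarrow> s \<le> real (Max ?N)" for s
        by (rule trans[OF bMax nat_ceiling_le_eq])
      show ?thesis by (intro exI[of _ "real (Max ?N)"] allI impI eq)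
    qed
  next
    fix n and s :: real assume ns: "real n \<le> s"
    define N where "N = nat \<lceil>s\<rceil>"
    have nN: "n \<le> N" using ns by (simp add: N_def le_nat_iff le_ceiling_iff)
    have "B n N \<le> \<bar>B n N\<bar>" by simp
    also have "\<dots> \<le> (\<Sum>k\<le>N. \<bar>B n k\<bar>)" by (intro member_le_sum[of N _ "\<lambda>k. \<bar>B n k\<bar>"]) auto
    also have "\<dots> \<le> S N" unfolding S_def
      using nN by (intro member_le_sum[of n _ "\<lambda>m. \<Sum>k\<le>N. \<bar>B m k\<bar>"] sum_nonneg) auto
    finally have "B n N \<le> 1 + S N" by simp
    then have "(1 + real n) * B n N \<le> (1 + real n) * (1 + S N)" by (intro mult_left_mono) auto
    also have "\<dots> \<le> (1 + real N) * (1 + S N)" using nN S0[of N] by (intro mult_right_mono) auto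
    finally show "(1 + real n) * B n (nat \<lceil>s\<rceil>) \<le> b (nat \<lceil>s\<rceil>)" by (simp add: b_def N_def)
  qed
qed

text \<open>Monotonicity makes the sublevel set an initial segment, continuity makes it closed, and
  superlinear growth makes it bounded, so its supremum is the required r.\<close>

lemma superlinear_sublevel:
  fixes \<eta> :: "real \<Rightarrow> real"
  assumes cont: "continuous_on {0..} \<eta>" and mono: "mono_on {0..} \<eta>"
    and super: "filterlim (\<lambda>t. \<eta> t / t) at_top at_top"
  shows "\<exists>r. \<forall>s\<ge>0. \<eta> s \<le> R \<longleftrightarrow> s \<le> r"
proof -
  define S where "S = {0..} \<inter> \<eta> -` {..R}"
  show ?thesis
  proof (cases "S = {}")
    case True
    then have "\<not> \<eta> s \<le> R" if "0 \<le> s" for s using that by (auto simp: S_def)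
    then show ?thesis by (intro exI[of _ "- 1"]) auto
  next
    case False
    have cl: "closed S" unfolding S_def by (rule continuous_closed_preimage[OF cont]) auto
    have "eventually (\<lambda>t. 1 \<le> \<eta> t / t) at_top" using super by (simp add: filterlim_at_top)
    then obtain N where N: "\<And>t. N \<le> t \<Longrightarrow> 1 \<le> \<eta> t / t" by (auto simp: eventually_at_top_linorder)
    have "s \<le> max (max N 1) R" if "s \<in> S" for s
    proof (cases "max N 1 \<le> s")
      case True
      then have "s \<le> \<eta> s" using N[of s] by (simp add: le_divide_eq)
      then show ?thesis using that by (auto simp: S_def)
    qed auto
    then have bdd: "bdd_above S" by (auto simp: bdd_above_def)
    have Sup: "Sup S \<in> S" by (rule closed_contains_Sup[OF False bdd cl])
    show ?thesis
    proof (intro exI[of _ "Sup S"] allI impI iffI)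
      fix s :: real assume "0 \<le> s" "\<eta> s \<le> R"
      then show "s \<le> Sup S" by (intro cSup_upper bdd) (auto simp: S_def)
    next
      fix s :: real assume s: "0 \<le> s" "s \<le> Sup S"
      have "\<eta> s \<le> \<eta> (Sup S)" using s Sup by (intro mono_onD[OF mono]) (auto simp: S_def)
      then show "\<eta> s \<le> R" using Sup by (simp add: S_def)
    qed
  qed
qed

text \<open>Half of \<delta> is used pointwise because strict inequalities do not survive a
  supremum.\<close>

lemma weighted_SUP_less:
  fixes \<Delta> :: "'x \<Rightarrow> real \<Rightarrow> 'a::real_normed_vector"
  assumes "0 < \<delta>" and pos: "\<And>x. x \<in> X \<Longrightarrow> 0 < \<psi> x"
    and bound: "\<And>x. x \<in> X \<Longrightarrow> \<exists>e\<ge>0. holder_on 0 T \<beta> e (\<Delta> x) \<and> e \<le> \<delta> / 2 * \<psi> x"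
  shows "(SUP x\<in>X. ennreal (inverse (\<psi> x)) * holder_seminorm \<beta> T (\<Delta> x)) < ennreal \<delta>"
proof -
  have "(SUP x\<in>X. ennreal (inverse (\<psi> x)) * holder_seminorm \<beta> T (\<Delta> x)) \<le> ennreal (\<delta> / 2)"
  proof (rule SUP_least)
    fix x assume x: "x \<in> X"
    obtain e where e: "0 \<le> e" "holder_on 0 T \<beta> e (\<Delta> x)" "e \<le> \<delta> / 2 * \<psi> x" using bound[OF x] by blast
    have "holder_seminorm \<beta> T (\<Delta> x) \<le> ennreal e" using holder_seminorm_le_holder_on[OF e(1)] e(2) by blast
    then have "ennreal (inverse (\<psi> x)) * holder_seminorm \<beta> T (\<Delta> x) \<le> ennreal (inverse (\<psi> x)) * ennreal e"
      by (intro mult_left_mono) auto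
    also have "\<dots> = ennreal (inverse (\<psi> x) * e)" using pos[OF x] e(1) by (simp add: ennreal_mult)
    also have "\<dots> \<le> ennreal (\<delta> / 2)"
      using e(3) pos[OF x] by (intro ennreal_leI) (simp add: field_simps)
    finally show "ennreal (inverse (\<psi> x)) * holder_seminorm \<beta> T (\<Delta> x) \<le> ennreal (\<delta> / 2)" .
  qed
  also have "\<dots> < ennreal \<delta>" using assms(1) by (simp add: ennreal_less_iff)
  finally show ?thesis .
qed

lemma driver_of_holder_norm:
  fixes x :: "real \<Rightarrow> real ^ 'd"
  assumes "x \<in> holder_paths 1 T" "holder_norm 1 T x \<le> K"
  shows "driver T K x"
proof -
  have n: "norm (x 0) \<le> K" "holder_on 0 T 1 (K - norm (x 0)) x"
    using holder_norm_le_iff[OF assms(1)] assms(2) by auto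
  have "holder_on 0 T 1 K x" by (rule holder_on_mono[OF n(2)]) simp
  then show ?thesis
    using order_trans[OF norm_ge_zero n(1)] by (auto simp: driver_def intro: holder_on_component)
qed

theorem theorem4p11:
  fixes T0 T1 \<alpha> \<beta> Bw C\<^sub>\<sigma> :: real
    and w :: "real \<Rightarrow> real ^ 'm"
    and f :: "real \<times> (real \<Rightarrow> real ^ 'm) \<Rightarrow> (real ^ 'd) \<Rightarrow>\<^sub>L (real ^ 'm)"
    and \<sigma> :: "real \<Rightarrow> real"
  assumes "0 < T1" and "0 \<le> T0" and "T0 < T1"
    and "1 / 2 < \<alpha>" and "\<alpha> < 1" and "0 < \<beta>" and "\<beta> < \<alpha>"
    and "0 < Bw" and "w \<in> holder_paths \<alpha> T0" and "holder_seminorm \<alpha> T0 w \<le> ennreal Bw"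
    and "lipschitz_functional \<alpha> \<beta> T1 f"
    and "\<exists>L. L-lipschitz_on UNIV \<sigma>"
    and "strict_mono \<sigma> \<or> monotone (<) (>) \<sigma>"
    and "\<And>r. \<bar>\<sigma> r\<bar> \<le> C\<^sub>\<sigma> * (1 + ln (1 + \<bar>r\<bar>))"
  shows
    "(\<forall>x \<in> holder_paths 1 T1. \<exists>!y. is_solution T0 T1 \<alpha> w (functional_coeff T1 f) x y) \<and>
     (\<forall>(l :: 'm option tensor_poly ^ 'd ^ 'm) c0 c1. 0 < c1 \<longrightarrow>
       (\<forall>x \<in> holder_paths 1 T1. \<exists>!y. is_solution T0 T1 \<alpha> w (signature_coeff \<sigma> l c0 c1) x y)) \<and>
     (let y = (\<lambda>x. solution T0 T1 \<alpha> w (functional_coeff T1 f) x);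
          y_sig = (\<lambda>(l :: 'm option tensor_poly ^ 'd ^ 'm) c0 c1 x.
            solution T0 T1 \<alpha> w (signature_coeff \<sigma> l c0 c1) x)
      in \<exists>\<eta>. 0 < \<eta> \<and> \<eta> < 1 \<and>
        (\<exists>\<psi>. admissible_weight (lipschitz_path_topology \<eta> T1) \<psi> \<and>
          (\<forall>\<delta>>0. \<exists>l c0 c1. 0 < c1 \<and>
            (SUP x \<in> holder_paths 1 T1.
               ennreal (inverse (\<psi> x)) * holder_seminorm \<beta> T1 (\<lambda>t. y x t - y_sig l c0 c1 x t))
            < ennreal \<delta>)) \<and>
        (bounded (f ` stopped_paths \<alpha> T1) \<and> bounded (range \<sigma>) \<longrightarrow>
          (\<forall>\<eta>\<^sub>c. continuous_on {0..} \<eta>\<^sub>c \<and> mono_on {0..} \<eta>\<^sub>c \<and> (\<forall>t\<ge>0. 0 < \<eta>\<^sub>c t) \<and>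
              filterlim (\<lambda>t. \<eta>\<^sub>c t / t) at_top at_top \<longrightarrow>
            (let \<psi> = (\<lambda>x. \<eta>\<^sub>c (holder_norm 1 T1 x)) in
              admissible_weight (lipschitz_path_topology \<eta> T1) \<psi> \<and>
              (\<forall>\<delta>>0. \<exists>l c0 c1. 0 < c1 \<and>
                (SUP x \<in> holder_paths 1 T1.
                   ennreal (inverse (\<psi> x)) * holder_seminorm \<beta> T1 (\<lambda>t. y x t - y_sig l c0 c1 x t))
                < ennreal \<delta>)))))"
proof -
  \<comment> \<open>The time regularity is instantiated by \<alpha> - \<beta>, the one available for
    f; the signature coefficient has the better exponent \<alpha> and is weakened to it.\<close>
  interpret history T0 T1 \<alpha> "\<alpha> - \<beta>" Bw w
    using assms holder_seminorm_le_holder_on[of Bw \<alpha> T0 w] by unfold_locales auto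
  obtain L where L: "L-lipschitz_on UNIV \<sigma>" using assms(12) by blast
  note log = assms(14)
  note f = assms(11) and \<beta> = assms(6,7)
  have inj: "inj \<sigma>"
    unfolding inj_def
  proof (intro allI impI)
    fix a b assume "\<sigma> a = \<sigma> b"
    then show "a = b"
      using assms(13) unfolding strict_mono_def monotone_on_def by (metis UNIV_I less_irrefl linorder_neqE)
  qed
  have cover_exists: "\<exists>c0 c1. 0 < c1 \<and> {- F..F} \<subseteq> (\<lambda>r. c1 * \<sigma> r + c0) ` {0..1}" for F
    by (rule strict_mono_affine_cover[OF assms(13) lipschitz_on_continuous_on[OF L]])
  let ?G = "functional_coeff T1 f :: (real \<Rightarrow> real ^ 'm) \<Rightarrow> real \<Rightarrow> real ^ 'd ^ 'm"
  obtain A where A: "0 \<le> A" and G: "coefficient A ?G"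
    using coefficient_functional[OF f \<beta> refl] by blast
  have Sig: "\<exists>A\<ge>0. coefficient A (signature_coeff \<sigma> l c0 c1)"
    for l :: "'m option tensor_poly ^ 'd ^ 'm" and c0 c1
    by (rule coefficient_signature[OF _ L log]) (use \<beta> in auto)
  have lip: "driver T1 (holder_norm 1 T1 x) x" if "x \<in> holder_paths 1 T1" for x :: "real \<Rightarrow> real ^ 'd"
    by (rule driver_of_holder_norm[OF that order_refl])
  have unique: "\<exists>!y. is_solution T0 T1 \<alpha> w H x y"
    if "coefficient A' H" "0 \<le> A'" "x \<in> holder_paths 1 T1"
    for A' x and H :: "(real \<Rightarrow> real ^ 'm) \<Rightarrow> real \<Rightarrow> real ^ 'd ^ 'm"
    using solution_exists[OF that(1,2) lip[OF that(3)]] solution_unique[OF that(1) lip[OF that(3)]] by blast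
  have uG: "\<exists>!y. is_solution T0 T1 \<alpha> w ?G x y" if "x \<in> holder_paths 1 T1" for x
    by (rule unique[OF G A that])
  have uS: "\<exists>!y. is_solution T0 T1 \<alpha> w (signature_coeff \<sigma> l c0 c1) x y" if "x \<in> holder_paths 1 T1"
    for l :: "'m option tensor_poly ^ 'd ^ 'm" and c0 c1 x
    using Sig[of l c0 c1] unique that by blast
  define Y where "Y = (\<lambda>x. solution T0 T1 \<alpha> w ?G x)"
  define Z where "Z = (\<lambda>(l :: 'm option tensor_poly ^ 'd ^ 'm) c0 c1 x.
    solution T0 T1 \<alpha> w (signature_coeff \<sigma> l c0 c1) x)"
  have Y: "is_solution T0 T1 \<alpha> w ?G x (Y x)" if "x \<in> holder_paths 1 T1" for x
    unfolding Y_def solution_def by (rule theI'[OF uG[OF that]])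
  have Z: "is_solution T0 T1 \<alpha> w (signature_coeff \<sigma> l c0 c1) x (Z l c0 c1 x)" if "x \<in> holder_paths 1 T1" for l c0 c1 x
    unfolding Z_def solution_def by (rule theI'[OF uS[OF that]])
  define \<tau> where "\<tau> = T1 powr (\<alpha> - \<beta>)"
  have \<tau>: "0 \<le> \<tau>" by (simp add: \<tau>_def)
  have to_\<beta>: "holder_on 0 T1 \<beta> (e * \<tau>) d" if "holder_on 0 T1 \<alpha> e d" "0 \<le> e" for e and d :: "real \<Rightarrow> real ^ 'm"
    unfolding \<tau>_def by (rule holder_on_exponent_le[OF that(1)]) (use that \<beta> in auto)
  have norm0: "0 \<le> holder_norm 1 T1 x" for x :: "real \<Rightarrow> real ^ 'd" by (simp add: holder_norm_def)
  \<comment> \<open>For fixed l no closeness is claimed here, merely a finite error on every ball,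
    from the a priori bounds of the two equations separately. It depends on l through A' and feeds
    the array B below.\<close>
  have crude: "\<exists>e\<ge>0. \<forall>x\<in>holder_paths 1 T1. holder_norm 1 T1 x \<le> K \<longrightarrow>
      holder_on 0 T1 \<beta> e (\<lambda>t. Y x t - Z l c0 c1 x t)" if K: "0 \<le> K" for l c0 c1 K
  proof -
    obtain A' where A': "0 \<le> A'" "coefficient A' (signature_coeff \<sigma> l c0 c1)" using Sig by blast
    obtain M where M: "0 \<le> M" "\<forall>(G :: (real \<Rightarrow> real ^ 'm) \<Rightarrow> real \<Rightarrow> real ^ 'd ^ 'm) x y.
      coefficient A G \<longrightarrow> driver T1 K x \<longrightarrow> is_solution T0 T1 \<alpha> w G x y \<longrightarrow> holder_on 0 T1 \<alpha> M y"
      using solution_bound[OF A K] by blast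
    obtain M' where M': "0 \<le> M'" "\<forall>(G :: (real \<Rightarrow> real ^ 'm) \<Rightarrow> real \<Rightarrow> real ^ 'd ^ 'm) x y.
      coefficient A' G \<longrightarrow> driver T1 K x \<longrightarrow> is_solution T0 T1 \<alpha> w G x y \<longrightarrow> holder_on 0 T1 \<alpha> M' y"
      using solution_bound[OF A'(1) K] by blast
    have "holder_on 0 T1 \<beta> ((M + M') * \<tau>) (\<lambda>t. Y x t - Z l c0 c1 x t)"
      if x: "x \<in> holder_paths 1 T1" and n: "holder_norm 1 T1 x \<le> K" for x
    proof (rule to_\<beta>[OF holder_on_diff])
      have d: "driver T1 K x" by (rule driver_of_holder_norm[OF x n])
      show "holder_on 0 T1 \<alpha> M (Y x)" using M(2) G d Y[OF x] by blast
      show "holder_on 0 T1 \<alpha> M' (Z l c0 c1 x)" using M'(2) A'(2) d Z[OF x] by blast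
    qed (use M M' in simp)
    then show ?thesis using M M' \<tau> by (intro exI[of _ "(M + M') * \<tau>"]) auto
  qed
  have approx: "\<exists>M\<ge>0. \<forall>c0 c1. 0 < c1 \<longrightarrow> (\<forall>p\<in>stopped_ball T1 \<alpha> M {w 0}. \<forall>i j.
      matrix (blinfun_apply (f p)) $ i $ j \<in> (\<lambda>r. c1 * \<sigma> r + c0) ` {0..1}) \<longrightarrow>
      (\<forall>\<epsilon>>0. \<exists>l. \<forall>x\<in>holder_paths 1 T1. holder_norm 1 T1 x \<le> K \<longrightarrow>
        holder_on 0 T1 \<beta> \<epsilon> (\<lambda>t. Y x t - Z l c0 c1 x t))" if K: "0 \<le> K" for K
  proof -
    obtain M where M: "0 \<le> M" "\<forall>c0 c1. 0 < c1 \<longrightarrow> (\<forall>p\<in>stopped_ball T1 \<alpha> M {w 0}. \<forall>i j.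
        matrix (blinfun_apply (f p)) $ i $ j \<in> (\<lambda>r. c1 * \<sigma> r + c0) ` {0..1}) \<longrightarrow>
      (\<forall>\<epsilon>>0. \<exists>l. \<forall>x y z. driver T1 K x \<longrightarrow> is_solution T0 T1 \<alpha> w ?G x y \<longrightarrow>
        is_solution T0 T1 \<alpha> w (signature_coeff \<sigma> l c0 c1) x z \<longrightarrow> holder_on 0 T1 \<alpha> \<epsilon> (\<lambda>t. y t - z t))"
      using signature_solution_approximation[OF f \<beta> refl L inj log K] by blast
    show ?thesis
    proof (intro exI[of _ M] conjI M(1) allI impI)
      fix c0 c1 \<epsilon> :: real
      assume c: "0 < c1" "\<forall>p\<in>stopped_ball T1 \<alpha> M {w 0}. \<forall>i j.
        matrix (blinfun_apply (f p)) $ i $ j \<in> (\<lambda>r. c1 * \<sigma> r + c0) ` {0..1}" and \<epsilon>: "0 < \<epsilon>"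
      define e where "e = \<epsilon> / (\<tau> + 1)"
      have e: "0 < e" using \<epsilon> \<tau> by (simp add: e_def)
      have "e * \<tau> = (\<tau> / (\<tau> + 1)) * \<epsilon>" by (simp add: e_def)
      also have "\<dots> \<le> 1 * \<epsilon>" using \<tau> \<epsilon> by (intro mult_right_mono) auto
      finally have e\<tau>: "e * \<tau> \<le> \<epsilon>" by simp
      obtain l where l: "\<forall>x y z. driver T1 K x \<longrightarrow> is_solution T0 T1 \<alpha> w ?G x y \<longrightarrow>
        is_solution T0 T1 \<alpha> w (signature_coeff \<sigma> l c0 c1) x z \<longrightarrow> holder_on 0 T1 \<alpha> e (\<lambda>t. y t - z t)"
        using M(2) c e by blast
      have "holder_on 0 T1 \<beta> \<epsilon> (\<lambda>t. Y x t - Z l c0 c1 x t)"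
        if x: "x \<in> holder_paths 1 T1" and n: "holder_norm 1 T1 x \<le> K" for x
      proof -
        have "holder_on 0 T1 \<alpha> e (\<lambda>t. Y x t - Z l c0 c1 x t)"
          using l driver_of_holder_norm[OF x n] Y[OF x] Z[OF x] by blast
        then have "holder_on 0 T1 \<beta> (e * \<tau>) (\<lambda>t. Y x t - Z l c0 c1 x t)" by (rule to_\<beta>) (use e in simp)
        then show ?thesis by (rule holder_on_mono) (rule e\<tau>)
      qed
      then show "\<exists>l. \<forall>x\<in>holder_paths 1 T1. holder_norm 1 T1 x \<le> K \<longrightarrow>
        holder_on 0 T1 \<beta> \<epsilon> (\<lambda>t. Y x t - Z l c0 c1 x t)" by blast
    qed
  qed
  \<comment> \<open>The value 1 / 2 is an arbitrary choice of \<eta> in (0,1).\<close>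
  have general: "\<exists>\<psi>. admissible_weight (lipschitz_path_topology (1 / 2) T1) \<psi> \<and>
      (\<forall>\<delta>>0. \<exists>l c0 c1. 0 < c1 \<and> (SUP x \<in> holder_paths 1 T1.
        ennreal (inverse (\<psi> x)) * holder_seminorm \<beta> T1 (\<lambda>t. Y x t - Z l c0 c1 x t)) < ennreal \<delta>)"
  proof -
    have "\<exists>l c0 c1. 0 < c1 \<and> (\<forall>x\<in>holder_paths 1 T1. holder_norm 1 T1 x \<le> real n \<longrightarrow>
        holder_on 0 T1 \<beta> (1 / (1 + real n)) (\<lambda>t. Y x t - Z l c0 c1 x t))" for n :: nat
    proof -
      obtain M where M: "0 \<le> M" "\<forall>c0 c1. 0 < c1 \<longrightarrow> (\<forall>p\<in>stopped_ball T1 \<alpha> M {w 0}. \<forall>i j.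
        matrix (blinfun_apply (f p)) $ i $ j \<in> (\<lambda>r. c1 * \<sigma> r + c0) ` {0..1}) \<longrightarrow>
        (\<forall>\<epsilon>>0. \<exists>l. \<forall>x\<in>holder_paths 1 T1. holder_norm 1 T1 x \<le> real n \<longrightarrow>
          holder_on 0 T1 \<beta> \<epsilon> (\<lambda>t. Y x t - Z l c0 c1 x t))"
        using approx[of "real n"] by auto
      obtain F where F: "\<forall>p\<in>stopped_ball T1 \<alpha> M {w 0}. norm (f p) \<le> F"
        using functional_bounded_on_stopped_ball[OF f \<beta> M(1)] by blast
      obtain c0 c1 where c: "0 < c1" "{- F..F} \<subseteq> (\<lambda>r. c1 * \<sigma> r + c0) ` {0..1}" using cover_exists by blast
      have "matrix (blinfun_apply (f p)) $ i $ j \<in> {- F..F}" if "p \<in> stopped_ball T1 \<alpha> M {w 0}" for p i j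
        using matrix_entry_le[of "f p" i j] F that by (fastforce simp: abs_le_iff)
      then have "\<forall>p\<in>stopped_ball T1 \<alpha> M {w 0}. \<forall>i j.
          matrix (blinfun_apply (f p)) $ i $ j \<in> (\<lambda>r. c1 * \<sigma> r + c0) ` {0..1}" using c(2) by blast
      moreover have "0 < 1 / (1 + real n)" by simp
      ultimately show ?thesis using M(2) c(1) by blast
    qed
    then obtain l c0 c1 where l: "\<And>n. 0 < c1 n" "\<And>n x. x \<in> holder_paths 1 T1 \<Longrightarrow> holder_norm 1 T1 x \<le> real n \<Longrightarrow>
        holder_on 0 T1 \<beta> (1 / (1 + real n)) (\<lambda>t. Y x t - Z (l n) (c0 n) (c1 n) x t)"
      by metis
    define P where "P = (\<lambda>n k e. 0 \<le> e \<and> (\<forall>x\<in>holder_paths 1 T1. holder_norm 1 T1 x \<le> real k \<longrightarrow>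
      holder_on 0 T1 \<beta> e (\<lambda>t. Y x t - Z (l n) (c0 n) (c1 n) x t)))"
    define B where "B = (\<lambda>n k. SOME e. P n k e)"
    have "P n k (B n k)" for n k
    proof -
      have "\<exists>e. P n k e" using crude[of "real k" "l n" "c0 n" "c1 n"] unfolding P_def by simp
      then show ?thesis unfolding B_def by (rule someI_ex)
    qed
    then have B: "\<And>n k. 0 \<le> B n k" "\<And>n k x. x \<in> holder_paths 1 T1 \<Longrightarrow> holder_norm 1 T1 x \<le> real k \<Longrightarrow>
      holder_on 0 T1 \<beta> (B n k) (\<lambda>t. Y x t - Z (l n) (c0 n) (c1 n) x t)"
      unfolding P_def by simp_all
    obtain b :: "real \<Rightarrow> real" where b: "\<forall>s\<ge>0. 1 \<le> b s" "\<forall>R. \<exists>r. \<forall>s\<ge>0. b s \<le> R \<longleftrightarrow> s \<le> r"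
      "\<forall>n s. real n \<le> s \<longrightarrow> (1 + real n) * B n (nat \<lceil>s\<rceil>) \<le> b s"
      using diagonal_weight_exists[of B] by blast
    show ?thesis
    proof (intro exI[of _ "\<lambda>x. b (holder_norm 1 T1 x)"] conjI allI impI)
      show "admissible_weight (lipschitz_path_topology (1 / 2) T1) (\<lambda>x :: real \<Rightarrow> real ^ 'd. b (holder_norm 1 T1 x))"
      proof (rule admissible_weight_norm[where b = b])
        fix s :: real assume "0 \<le> s"
        then have "1 \<le> b s" using b(1) by blast
        then show "0 < b s" by linarith
      qed (use assms(1) b(2) in auto)
      fix \<delta> :: real assume \<delta>: "0 < \<delta>"
      obtain n :: nat where n: "2 / \<delta> < real n" using reals_Archimedean2 by blast
      \<comment> \<open>One n serves both ranges: 1 / (1 + n) bounds the error itself where the norm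
        is at most n and the weight is at least 1, and it bounds the ratio of error to weight
        beyond.\<close>
      have n': "1 / (1 + real n) \<le> \<delta> / 2" using n \<delta> by (simp add: field_simps)
      show "\<exists>l c0 c1. 0 < c1 \<and> (SUP x \<in> holder_paths 1 T1.
        ennreal (inverse (b (holder_norm 1 T1 x))) * holder_seminorm \<beta> T1 (\<lambda>t. Y x t - Z l c0 c1 x t)) < ennreal \<delta>"
      proof (rule exI[of _ "l n"], rule exI[of _ "c0 n"], rule exI[of _ "c1 n"], rule conjI[OF l(1)])
        show "(SUP x \<in> holder_paths 1 T1. ennreal (inverse (b (holder_norm 1 T1 x))) *
          holder_seminorm \<beta> T1 (\<lambda>t. Y x t - Z (l n) (c0 n) (c1 n) x t)) < ennreal \<delta>"
        proof (rule weighted_SUP_less[OF \<delta>])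
          fix x :: "real \<Rightarrow> real ^ 'd" assume x: "x \<in> holder_paths 1 T1"
          define s where "s = holder_norm 1 T1 x"
          have s: "0 \<le> s" "1 \<le> b s" using norm0 b(1) by (auto simp: s_def)
          show "0 < b (holder_norm 1 T1 x)" using s by (simp add: s_def)
          show "\<exists>e\<ge>0. holder_on 0 T1 \<beta> e (\<lambda>t. Y x t - Z (l n) (c0 n) (c1 n) x t) \<and> e \<le> \<delta> / 2 * b (holder_norm 1 T1 x)"
          proof (cases "s \<le> real n")
            case True
            have "\<delta> / 2 * 1 \<le> \<delta> / 2 * b s" using s \<delta> by (intro mult_left_mono) auto
            then show ?thesis using l(2)[OF x True[unfolded s_def]] n'
              by (intro exI[of _ "1 / (1 + real n)"]) (auto simp: s_def)
          next
            case False
            have "(1 + real n) * B n (nat \<lceil>s\<rceil>) \<le> b s" using b(3) False by simp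
            then have "B n (nat \<lceil>s\<rceil>) \<le> 1 / (1 + real n) * b s" by (simp add: field_simps)
            also have "\<dots> \<le> \<delta> / 2 * b s" using n' s by (intro mult_right_mono) auto
            finally have le: "B n (nat \<lceil>s\<rceil>) \<le> \<delta> / 2 * b s" .
            have "s \<le> real (nat \<lceil>s\<rceil>)" by linarith
            then show ?thesis using B(2)[OF x, of "nat \<lceil>s\<rceil>" n] B(1)[of n "nat \<lceil>s\<rceil>"] le
              by (intro exI[of _ "B n (nat \<lceil>s\<rceil>)"]) (auto simp: s_def)
          qed
        qed
      qed
    qed
  qed
  have bounded_case: "admissible_weight (lipschitz_path_topology (1 / 2) T1) (\<lambda>x :: real \<Rightarrow> real ^ 'd. \<eta> (holder_norm 1 T1 x)) \<and>
      (\<forall>\<delta>>0. \<exists>l c0 c1. 0 < c1 \<and> (SUP x \<in> holder_paths 1 T1.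
        ennreal (inverse (\<eta> (holder_norm 1 T1 x))) * holder_seminorm \<beta> T1 (\<lambda>t. Y x t - Z l c0 c1 x t)) < ennreal \<delta>)"
    if bf: "bounded (f ` stopped_paths \<alpha> T1)" and b\<sigma>: "bounded (range \<sigma>)"
      and \<eta>: "continuous_on {0..} \<eta>" "mono_on {0..} \<eta>" "\<forall>t\<ge>0. 0 < \<eta> t" "filterlim (\<lambda>t. \<eta> t / t) at_top at_top"
    for \<eta> :: "real \<Rightarrow> real"
  proof (intro conjI allI impI)
    show "admissible_weight (lipschitz_path_topology (1 / 2) T1) (\<lambda>x :: real \<Rightarrow> real ^ 'd. \<eta> (holder_norm 1 T1 x))"
    proof (rule admissible_weight_norm[where b = \<eta>])
      show "0 < \<eta> s" if "0 \<le> s" for s using \<eta>(3) that by simp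
      show "\<exists>r. \<forall>s\<ge>0. \<eta> s \<le> R \<longleftrightarrow> s \<le> r" for R by (rule superlinear_sublevel[OF \<eta>(1,2,4)])
    qed (use assms(1) in auto)
    fix \<delta> :: real assume \<delta>: "0 < \<delta>"
    obtain F where "0 < F" and F': "\<forall>v\<in>f ` stopped_paths \<alpha> T1. norm v \<le> F"
      using bounded_pos[THEN iffD1, OF bf] by blast
    then have F: "0 \<le> F" "\<And>p. p \<in> stopped_paths \<alpha> T1 \<Longrightarrow> norm (f p) \<le> F" by simp_all
    obtain S where "0 < S" and S': "\<forall>v\<in>range \<sigma>. norm v \<le> S"
      using bounded_pos[THEN iffD1, OF b\<sigma>] by blast
    then have S: "0 \<le> S" "\<And>r. \<bar>\<sigma> r\<bar> \<le> S" by simp_all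
    \<comment> \<open>A global bound F for f allows c0 and c1 to be fixed before any ball. This
      breaks the circle: the linear constant Q is known first, it determines the radius K, and only
      then is l chosen for that radius.\<close>
    obtain c0 c1 where c: "0 < c1" "{- F..F} \<subseteq> (\<lambda>r. c1 * \<sigma> r + c0) ` {0..1}" using cover_exists by blast
    define E where "E = F + (c1 * S + \<bar>c0\<bar>)"
    have E: "0 \<le> E" using F S c by (simp add: E_def)
    define Q where "Q = real CARD('m) * real CARD('d) * E * exp T1 * \<tau>"
    have Q: "0 \<le> Q" using E \<tau> by (simp add: Q_def)
    have linear: "holder_on 0 T1 \<beta> (Q * holder_norm 1 T1 x) (\<lambda>t. Y x t - Z l c0 c1 x t)"
      if x: "x \<in> holder_paths 1 T1" for x l
    proof -
      obtain A' where A': "coefficient A' (signature_coeff \<sigma> l c0 c1)" using Sig by blast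
      have yp: "Y x \<in> holder_paths \<alpha> T1" using Y[OF x] by (simp add: is_solution_def)
      have "\<bar>?G (Y x) u $ i $ j - signature_coeff \<sigma> l c0 c1 (Z l c0 c1 x) u $ i $ j\<bar> \<le> E"
        if u: "u \<in> {T0..T1}" for u i j
      proof -
        have "\<bar>?G (Y x) u $ i $ j\<bar> \<le> F"
          unfolding functional_coeff_def
          by (rule order_trans[OF matrix_entry_le F(2)[OF stopped_pathsI[OF _ yp]]]) (use u assms(2) in auto)
        moreover have "\<bar>signature_coeff \<sigma> l c0 c1 (Z l c0 c1 x) u $ i $ j\<bar> \<le> c1 * S + \<bar>c0\<bar>"
        proof -
          have 1: "\<bar>c1 * \<sigma> r + c0\<bar> \<le> c1 * \<bar>\<sigma> r\<bar> + \<bar>c0\<bar>" for r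
            by (rule order_trans[OF abs_triangle_ineq]) (use c in \<open>simp add: abs_mult\<close>)
          have 2: "c1 * \<bar>\<sigma> r\<bar> \<le> c1 * S" for r using S c by (intro mult_left_mono) auto
          have "\<bar>c1 * \<sigma> r + c0\<bar> \<le> c1 * S + \<bar>c0\<bar>" for r using 1[of r] 2[of r] by linarith
          then show ?thesis by (simp add: signature_coeff_def)
        qed
        ultimately show ?thesis unfolding E_def by linarith
      qed
      then have "holder_on 0 T1 \<alpha> (real CARD('m) * real CARD('d) * holder_norm 1 T1 x * E * exp T1) (\<lambda>t. Y x t - Z l c0 c1 x t)"
        by (rule bounded_solutions_diff[OF G A' lip[OF x] Y[OF x] Z[OF x] E])
      from to_\<beta>[OF this] show ?thesis using norm0 E by (simp add: Q_def mult_ac)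
    qed
    have "eventually (\<lambda>t. 2 * Q / \<delta> \<le> \<eta> t / t) at_top" using \<eta>(4) by (simp add: filterlim_at_top)
    then obtain N where N: "\<And>t. N \<le> t \<Longrightarrow> 2 * Q / \<delta> \<le> \<eta> t / t" by (auto simp: eventually_at_top_linorder)
    \<comment> \<open>The radius beyond which the weight outgrows the linear error; at least 1, so
      that division by s is legitimate.\<close>
    define K where "K = max N 1"
    have K: "0 \<le> K" by (simp add: K_def)
    have far: "Q * s \<le> \<delta> / 2 * \<eta> s" if "K \<le> s" for s
    proof -
      have s: "0 < s" "N \<le> s" using that by (auto simp: K_def)
      have "2 * Q / \<delta> * s \<le> \<eta> s / s * s" using s N[of s] by (intro mult_right_mono) auto
      then show ?thesis using s \<delta> by (simp add: field_simps)
    qed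
    obtain M where M: "0 \<le> M" "\<forall>c0 c1. 0 < c1 \<longrightarrow> (\<forall>p\<in>stopped_ball T1 \<alpha> M {w 0}. \<forall>i j.
      matrix (blinfun_apply (f p)) $ i $ j \<in> (\<lambda>r. c1 * \<sigma> r + c0) ` {0..1}) \<longrightarrow>
      (\<forall>\<epsilon>>0. \<exists>l. \<forall>x\<in>holder_paths 1 T1. holder_norm 1 T1 x \<le> K \<longrightarrow>
        holder_on 0 T1 \<beta> \<epsilon> (\<lambda>t. Y x t - Z l c0 c1 x t))"
      using approx[OF K] by blast
    have "matrix (blinfun_apply (f p)) $ i $ j \<in> {- F..F}" if "p \<in> stopped_ball T1 \<alpha> M {w 0}" for p i j
    proof -
      have "p \<in> stopped_paths \<alpha> T1" using stopped_ball_subset_stopped_paths[OF M(1)] that by blast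
      then show ?thesis using matrix_entry_le[of "f p" i j] F(2)[of p] by (auto simp: abs_le_iff)
    qed
    then have cover: "\<forall>p\<in>stopped_ball T1 \<alpha> M {w 0}. \<forall>i j.
      matrix (blinfun_apply (f p)) $ i $ j \<in> (\<lambda>r. c1 * \<sigma> r + c0) ` {0..1}" using c(2) by blast
    \<comment> \<open>By monotonicity \<eta> 0 is the smallest value of the weight, so this accuracy
      is sufficient on the whole ball of radius K.\<close>
    have "0 < \<delta> / 2 * \<eta> 0" using \<delta> \<eta>(3) by simp
    then obtain l where l: "\<forall>x\<in>holder_paths 1 T1. holder_norm 1 T1 x \<le> K \<longrightarrow>
        holder_on 0 T1 \<beta> (\<delta> / 2 * \<eta> 0) (\<lambda>t. Y x t - Z l c0 c1 x t)"
      using M(2) c(1) cover by blast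
    show "\<exists>l c0 c1. 0 < c1 \<and> (SUP x \<in> holder_paths 1 T1.
        ennreal (inverse (\<eta> (holder_norm 1 T1 x))) * holder_seminorm \<beta> T1 (\<lambda>t. Y x t - Z l c0 c1 x t)) < ennreal \<delta>"
    proof (rule exI[of _ l], rule exI[of _ c0], rule exI[of _ c1], rule conjI[OF c(1)])
      show "(SUP x \<in> holder_paths 1 T1. ennreal (inverse (\<eta> (holder_norm 1 T1 x))) *
        holder_seminorm \<beta> T1 (\<lambda>t. Y x t - Z l c0 c1 x t)) < ennreal \<delta>"
      proof (rule weighted_SUP_less[OF \<delta>])
        fix x :: "real \<Rightarrow> real ^ 'd" assume x: "x \<in> holder_paths 1 T1"
        show "0 < \<eta> (holder_norm 1 T1 x)" using \<eta>(3) norm0 by blast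
        show "\<exists>e\<ge>0. holder_on 0 T1 \<beta> e (\<lambda>t. Y x t - Z l c0 c1 x t) \<and> e \<le> \<delta> / 2 * \<eta> (holder_norm 1 T1 x)"
        proof (cases "holder_norm 1 T1 x \<le> K")
          case True
          have "\<eta> 0 \<le> \<eta> (holder_norm 1 T1 x)" by (rule mono_onD[OF \<eta>(2)]) (use norm0 in auto)
          then have "\<delta> / 2 * \<eta> 0 \<le> \<delta> / 2 * \<eta> (holder_norm 1 T1 x)" using \<delta> by (intro mult_left_mono) auto
          then show ?thesis using l x True \<open>0 < \<delta> / 2 * \<eta> 0\<close> by (intro exI[of _ "\<delta> / 2 * \<eta> 0"]) auto
        next
          case False
          then have "Q * holder_norm 1 T1 x \<le> \<delta> / 2 * \<eta> (holder_norm 1 T1 x)" by (intro far) simp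
          then show ?thesis using linear[OF x, of l] Q norm0[of x]
            by (intro exI[of _ "Q * holder_norm 1 T1 x"]) auto
        qed
      qed
    qed
  qed
  show ?thesis
    unfolding Let_def Y_def[symmetric] Z_def[symmetric]
  proof (intro conjI)
    show "\<forall>x \<in> holder_paths 1 T1. \<exists>!y. is_solution T0 T1 \<alpha> w ?G x y" using uG by blast
    show "\<forall>(l :: 'm option tensor_poly ^ 'd ^ 'm) c0 c1. 0 < c1 \<longrightarrow>
       (\<forall>x \<in> holder_paths 1 T1. \<exists>!y. is_solution T0 T1 \<alpha> w (signature_coeff \<sigma> l c0 c1) x y)" using uS by blast
    show "\<exists>\<eta>. 0 < \<eta> \<and> \<eta> < 1 \<and>
        (\<exists>\<psi>. admissible_weight (lipschitz_path_topology \<eta> T1) \<psi> \<and>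
          (\<forall>\<delta>>0. \<exists>l c0 c1. 0 < c1 \<and>
            (SUP x \<in> holder_paths 1 T1.
               ennreal (inverse (\<psi> x)) * holder_seminorm \<beta> T1 (\<lambda>t. Y x t - Z l c0 c1 x t))
            < ennreal \<delta>)) \<and>
        (bounded (f ` stopped_paths \<alpha> T1) \<and> bounded (range \<sigma>) \<longrightarrow>
          (\<forall>\<eta>\<^sub>c. continuous_on {0..} \<eta>\<^sub>c \<and> mono_on {0..} \<eta>\<^sub>c \<and> (\<forall>t\<ge>0. 0 < \<eta>\<^sub>c t) \<and>
              filterlim (\<lambda>t. \<eta>\<^sub>c t / t) at_top at_top \<longrightarrow>
              admissible_weight (lipschitz_path_topology \<eta> T1) (\<lambda>x :: real \<Rightarrow> real ^ 'd. \<eta>\<^sub>c (holder_norm 1 T1 x)) \<and>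
              (\<forall>\<delta>>0. \<exists>l c0 c1. 0 < c1 \<and>
                (SUP x \<in> holder_paths 1 T1.
                   ennreal (inverse (\<eta>\<^sub>c (holder_norm 1 T1 x))) * holder_seminorm \<beta> T1 (\<lambda>t. Y x t - Z l c0 c1 x t))
                < ennreal \<delta>)))"
      using general bounded_case by (intro exI[of _ "1 / 2"] conjI) (simp_all only: zero_less_divide_1_iff, auto)
  qed
qed


end
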